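(* Let $\Omega\subset\mathbb{R}^N$ be a bounded open set, $M$ a symmetric matrix of measurable coefficients with $\alpha|\xi|^2\le M(x)\xi\cdot\xi$, $|M(x)|\le\beta$ ($0<\alpha\le\beta$) for a.e. $x$ and all $\xi$. Let $\sigma>0$ and $h:[0,\sigma)\to\mathbb{R}^+$ continuous, strictly increasing, with $\lim_{s\to\sigma^-}h(s)=+\infty$, and suppose $h\in L^1((0,\sigma))$, i.e. $H(\sigma)=\frac1\alpha\int_0^\sigma h(s)\,ds<+\infty$. Let $f\in L^p(\Omega)$, $p>N/2$, $f\ge0$, $f\not\equiv0$, and let $\lambda>\lambda_1(f)\,e^{H(\sigma)}\psi(\sigma)$. Then the problem $$-\mathrm{div}(M(x)\nabla u)+h(u)|\nabla u|^2=\lambda f\text{ in }\Omega,\qquad u=0\text{ on }\partial\Omega$$ has no (weak) solution. Consequently $\Lambda_f<+\infty$.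
   Context: $H(s)=\frac1\alpha\int_0^s h(t)\,dt$ and $\psi(s)=\int_0^s e^{-H(t)}\,dt$ for $s\in[0,\sigma]$. $\lambda_1(f)$ is the first eigenvalue of $-\mathrm{div}(M(x)\nabla\cdot)$ in $\Omega$ with homogeneous Dirichlet conditions and weight $f$, i.e. $-\mathrm{div}(M\nabla\varphi_1)=\lambda_1(f)f\varphi_1$ in $\Omega$, $\varphi_1=0$ on $\partial\Omega$ with $\varphi_1>0$. A (weak) solution is $u\in H^1_0(\Omega)$ with $0\le u<\sigma$ a.e., $h(u)|\nabla u|^2\in L^1(\Omega)$ and $\int_\Omega M\nabla u\cdot\nabla\varphi+\int_\Omega h(u)|\nabla u|^2\varphi=\lambda\int_\Omega f\varphi$ for all $\varphi\in H^1_0(\Omega)\cap L^\infty(\Omega)$. $\Lambda_f=\sup\{\lambda>0:\ \text{there is a solution } u \text{ with } u\le\sigma-\varepsilon \text{ a.e. for some }\varepsilon>0\}$, with $\sup\emptyset=0$. *)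

theory Defs
  imports "HOL-Analysis.Analysis"
begin

text \<open>Points of the ambient space are vectors in real^'n, N = CARD('n).
  Functions are handled through representatives; all integrals are Lebesgue integrals.\<close>

definition test_fun :: "(real^'n) set \<Rightarrow> (real^'n \<Rightarrow> real) \<Rightarrow> (real^'n \<Rightarrow> real^'n) \<Rightarrow> bool" where
  "test_fun \<Omega> \<phi> g \<longleftrightarrow>
     continuous_on UNIV g \<and> (\<forall>x. (\<phi> has_derivative (\<lambda>v. g x \<bullet> v)) (at x)) \<and>
     compact (closure {x. \<phi> x \<noteq> 0}) \<and> closure {x. \<phi> x \<noteq> 0} \<subseteq> \<Omega>"

definition L2_on :: "(real^'n) set \<Rightarrow> (real^'n \<Rightarrow> 'b::euclidean_space) \<Rightarrow> bool" where
  "L2_on \<Omega> v \<longleftrightarrow> set_borel_measurable lebesgue \<Omega> v \<and>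
     set_integrable lebesgue \<Omega> (\<lambda>x. (norm (v x))^2)"

definition weak_grad :: "(real^'n) set \<Rightarrow> (real^'n \<Rightarrow> real) \<Rightarrow> (real^'n \<Rightarrow> real^'n) \<Rightarrow> bool" where
  "weak_grad \<Omega> u G \<longleftrightarrow>
     (\<forall>\<phi> g i. test_fun \<Omega> \<phi> g \<longrightarrow>
        (LINT x:\<Omega>|lebesgue. u x * (g x $ i)) = - (LINT x:\<Omega>|lebesgue. (G x $ i) * \<phi> x))"

definition H10 :: "(real^'n) set \<Rightarrow> (real^'n \<Rightarrow> real) \<Rightarrow> (real^'n \<Rightarrow> real^'n) \<Rightarrow> bool" where
  "H10 \<Omega> u G \<longleftrightarrow> L2_on \<Omega> u \<and> L2_on \<Omega> G \<and> weak_grad \<Omega> u G \<and>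
     (\<exists>\<phi> g. (\<forall>k. test_fun \<Omega> (\<phi> k) (g k)) \<and>
        (\<lambda>k. LINT x:\<Omega>|lebesgue. (\<phi> k x - u x)^2) \<longlonglongrightarrow> 0 \<and>
        (\<lambda>k. LINT x:\<Omega>|lebesgue. (norm (g k x - G x))^2) \<longlonglongrightarrow> 0)"

definition Linfty_on :: "(real^'n) set \<Rightarrow> (real^'n \<Rightarrow> real) \<Rightarrow> bool" where
  "Linfty_on \<Omega> v \<longleftrightarrow> (\<exists>C. AE x in lebesgue. x \<in> \<Omega> \<longrightarrow> \<bar>v x\<bar> \<le> C)"

definition is_eigenvalue ::
  "(real^'n) set \<Rightarrow> (real^'n \<Rightarrow> real^'n^'n) \<Rightarrow> (real^'n \<Rightarrow> real) \<Rightarrow> real \<Rightarrow> bool" where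
  "is_eigenvalue \<Omega> M f \<mu> \<longleftrightarrow>
     (\<exists>\<phi> \<Phi>. H10 \<Omega> \<phi> \<Phi> \<and> \<not> (AE x in lebesgue. x \<in> \<Omega> \<longrightarrow> \<phi> x = 0) \<and>
        (\<forall>\<psi> \<Psi>. H10 \<Omega> \<psi> \<Psi> \<longrightarrow>
           (LINT x:\<Omega>|lebesgue. (M x *v \<Phi> x) \<bullet> \<Psi> x) = \<mu> * (LINT x:\<Omega>|lebesgue. f x * \<phi> x * \<psi> x)))"

definition lambda1 :: "(real^'n) set \<Rightarrow> (real^'n \<Rightarrow> real^'n^'n) \<Rightarrow> (real^'n \<Rightarrow> real) \<Rightarrow> real" where
  "lambda1 \<Omega> M f = Inf {\<mu>. is_eigenvalue \<Omega> M f \<mu>}"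

definition Hfun :: "real \<Rightarrow> (real \<Rightarrow> real) \<Rightarrow> real \<Rightarrow> real" where
  "Hfun \<alpha> h s = (1 / \<alpha>) * (LINT t:{0..s}|lborel. h t)"

definition psifun :: "real \<Rightarrow> (real \<Rightarrow> real) \<Rightarrow> real \<Rightarrow> real" where
  "psifun \<alpha> h s = (LINT t:{0..s}|lborel. exp (- Hfun \<alpha> h t))"

definition weak_solution ::
  "(real^'n) set \<Rightarrow> (real^'n \<Rightarrow> real^'n^'n) \<Rightarrow> (real \<Rightarrow> real) \<Rightarrow> real \<Rightarrow> (real^'n \<Rightarrow> real) \<Rightarrow> real
   \<Rightarrow> (real^'n \<Rightarrow> real) \<Rightarrow> bool" where
  "weak_solution \<Omega> M h \<sigma> f lam u \<longleftrightarrow>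
     (\<exists>G. H10 \<Omega> u G \<and>
        (AE x in lebesgue. x \<in> \<Omega> \<longrightarrow> 0 \<le> u x \<and> u x < \<sigma>) \<and>
        set_integrable lebesgue \<Omega> (\<lambda>x. h (u x) * (norm (G x))^2) \<and>
        (\<forall>\<phi> \<Phi>. H10 \<Omega> \<phi> \<Phi> \<and> Linfty_on \<Omega> \<phi> \<longrightarrow>
           (LINT x:\<Omega>|lebesgue. (M x *v G x) \<bullet> \<Phi> x)
           + (LINT x:\<Omega>|lebesgue. h (u x) * (norm (G x))^2 * \<phi> x)
           = lam * (LINT x:\<Omega>|lebesgue. f x * \<phi> x)))"

definition Lambda_f ::
  "(real^'n) set \<Rightarrow> (real^'n \<Rightarrow> real^'n^'n) \<Rightarrow> (real \<Rightarrow> real) \<Rightarrow> real \<Rightarrow> (real^'n \<Rightarrow> real) \<Rightarrow> ereal" where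
  "Lambda_f \<Omega> M h \<sigma> f =
     (let S = {lam. lam > 0 \<and> (\<exists>u \<epsilon>. \<epsilon> > 0 \<and> weak_solution \<Omega> M h \<sigma> f lam u \<and>
                   (AE x in lebesgue. x \<in> \<Omega> \<longrightarrow> u x \<le> \<sigma> - \<epsilon>))}
      in if S = {} then 0 else Sup (ereal ` S))"

end

theory Submission
  imports Defs "HOL-Complex_Analysis.Great_Picard" "HOL-Library.Diagonal_Subsequence"
begin

text \<open>
  Let \<open>u\<close> be a solution. Testing the equation with \<open>v\<^sup>2 e\<^sup>-\<^sup>H\<^sup>(\<^sup>u\<^sup>) / (\<psi>(u) + \<epsilon>)\<close> cancels the absorption term against
  the derivative of \<open>e\<^sup>-\<^sup>H\<close>, and what remains is Picone's identity: since \<open>e\<^sup>-\<^sup>H \<ge> e\<^sup>-\<^sup>H\<^sup>(\<^sup>\<sigma>\<^sup>)\<close> and \<open>\<psi> \<le> \<psi>(\<sigma>)\<close>,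
  the Rayleigh quotient \<open>\<integral> M \<nabla>v \<cdot> \<nabla>v / \<integral> f v\<^sup>2\<close> is at least \<open>\<lambda> e\<^sup>-\<^sup>H\<^sup>(\<^sup>\<sigma>\<^sup>) / \<psi>(\<sigma>)\<close>, and hence so is every eigenvalue.
  As \<open>h\<close> is unbounded near \<open>\<sigma>\<close>, this is carried out with \<open>h(min s c)\<close> in place of \<open>h\<close>, and \<open>c \<rightarrow> \<sigma>\<close>.

  An infimum over an empty set would be meaningless, so the existence of an eigenvalue has to be shown as well.
  Compactness of \<open>H\<^sub>0\<^sup>1\<close> in \<open>L\<^sup>2(f)\<close> comes from the averages of \<open>v\<close> over balls of radius \<open>r\<close>: they are
  equicontinuous on bounded sets of \<open>H\<^sub>0\<^sup>1\<close>, and their distance to \<open>v\<close> in \<open>L\<^sup>2(f)\<close> is of order \<open>r\<^sup>1\<^sup>-\<^sup>N\<^sup>/\<^sup>2\<^sup>p\<close>.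
\<close>

section \<open>Square-integrable functions\<close>

text \<open>The test function needs two regularisations, and their order matters. Since \<psi>
  vanishes at 0, \<epsilon> keeps the quotient bounded where u is small. Since h blows up at
  \<sigma>, the truncation keeps the derivative of the quotient bounded, which the chain rule
  demands. The part of h above level c is then left uncancelled, multiplied by at most sup v^2 /
  \<epsilon>. For fixed \<epsilon> it disappears as c tends to \<sigma>, because h(u)|grad u|^2 is
  integrable; only afterwards may \<epsilon> tend to 0. The factor 1/\<alpha> in H is the price of
  comparing h|grad u|^2 with (h/\<alpha>) times the form M grad u . grad u, which is what
  differentiating e^(-H(u)) produces. In the compactness estimate, a displacement of length at most
  r costs r^2 in squared norm, and averaging against a weight in L^p at scale s costs s^(-N/p). The
  power that remains is 2 - N/p, positive because p > N/2. Inequalities are proved for C^1 functions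
  of compact support and reach eigenfunctions by density and Fatou.\<close>

lemma quadratic_nonneg_imp_discriminant:
  fixes a b c :: real
  assumes nonneg: "\<And>t. 0 \<le> a + 2 * b * t + c * t^2"
  shows "b^2 \<le> a * c"
proof (cases "c = 0")
  case True
  have "b = 0"
  proof (rule ccontr)
    assume "b \<noteq> 0"
    then show False
      \<comment> \<open>At this point the affine function takes the value -1.\<close>
      using nonneg[of "- (a + 1) / (2 * b)"] True by (simp add: field_simps)
  qed
  then show ?thesis using True by simp
next
  case False
  have "c > 0"
  proof (rule ccontr)
    assume "\<not> c > 0"
    with False have c: "c < 0" by simp
    \<comment> \<open>Chosen so that |c| * t exceeds |a| + 2 * |b|, while t >= 1 allows |a| <= |a| *
      t.\<close>
    define t where "t = \<bar>a\<bar> / \<bar>c\<bar> + 2 * \<bar>b\<bar> / \<bar>c\<bar> + 1"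
    have t1: "t \<ge> 1" by (simp add: t_def)
    have e: "\<bar>c\<bar> * t = \<bar>a\<bar> + 2 * \<bar>b\<bar> + \<bar>c\<bar>"
      using c by (simp add: t_def field_simps)
    have "a + 2 * b * t + c * t^2 \<le> \<bar>a\<bar> * t + 2 * \<bar>b\<bar> * t - \<bar>c\<bar> * t * t"
    proof -
      have "a \<le> \<bar>a\<bar> * t" using t1 by (metis abs_ge_self abs_ge_zero mult.right_neutral mult_left_mono order_trans)
      moreover have "2 * b * t \<le> 2 * \<bar>b\<bar> * t" using t1 by (intro mult_right_mono) auto
      ultimately show ?thesis using c by (simp add: power2_eq_square)
    qed
    also have "\<dots> = t * (\<bar>a\<bar> + 2 * \<bar>b\<bar> - \<bar>c\<bar> * t)" by (simp add: algebra_simps)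
    also have "\<dots> < 0" using e c t1 by (simp add: mult_pos_neg)
    finally show False using nonneg[of t] by simp
  qed
  then show ?thesis
    using nonneg[of "- b / c"] by (simp add: field_simps power2_eq_square)
qed

definition L2 :: "'a measure \<Rightarrow> ('a \<Rightarrow> 'b::euclidean_space) \<Rightarrow> bool" where
  "L2 M f \<longleftrightarrow> f \<in> borel_measurable M \<and> integrable M (\<lambda>x. (norm (f x))^2)"

abbreviation L2sq :: "'a measure \<Rightarrow> ('a \<Rightarrow> 'b::euclidean_space) \<Rightarrow> real" where
  "L2sq M f \<equiv> (\<integral>x. (norm (f x))^2 \<partial>M)"

abbreviation L2_tendsto :: "'a measure \<Rightarrow> (nat \<Rightarrow> 'a \<Rightarrow> 'b::euclidean_space) \<Rightarrow> ('a \<Rightarrow> 'b) \<Rightarrow> bool" where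
  "L2_tendsto M f g \<equiv> (\<lambda>n. \<integral>x. (norm (f n x - g x))^2 \<partial>M) \<longlonglongrightarrow> 0"

lemma L2_measurable: "L2 M f \<Longrightarrow> f \<in> borel_measurable M"
  and L2_integrable_square: "L2 M f \<Longrightarrow> integrable M (\<lambda>x. (norm (f x))^2)"
  by (simp_all add: L2_def)

lemma norm_add_square_le:
  fixes a b :: "'a::real_inner"
  shows "(norm (a + b))^2 \<le> 2 * (norm a)^2 + 2 * (norm b)^2"
  using zero_le_power2[of "norm (a - b)"]
  by (simp add: power2_norm_eq_inner inner_simps inner_commute)

lemma norm_diff_square_le:
  fixes a b :: "'a::real_inner"
  shows "(norm (a - b))^2 \<le> 2 * (norm a)^2 + 2 * (norm b)^2"
  using norm_add_square_le[of a "-b"] by simp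

lemma L2_add:
  assumes "L2 M f" "L2 M g"
  shows "L2 M (\<lambda>x. f x + g x)"
proof -
  have [measurable]: "f \<in> borel_measurable M" "g \<in> borel_measurable M"
    using assms by (auto simp: L2_def)
  have "integrable M (\<lambda>x. (norm (f x + g x))^2)"
  proof (rule Bochner_Integration.integrable_bound)
    show "integrable M (\<lambda>x. 2 * (norm (f x))^2 + 2 * (norm (g x))^2)"
      using assms by (auto simp: L2_def)
    show "AE x in M. norm ((norm (f x + g x))^2) \<le> norm (2 * (norm (f x))^2 + 2 * (norm (g x))^2)"
      by (intro always_eventually allI) (simp add: norm_add_square_le)
  qed measurable
  then show ?thesis by (simp add: L2_def)
qed

lemma L2_mult_bounded:
  assumes "L2 M f" "k \<in> borel_measurable M" "AE x in M. \<bar>k x\<bar> \<le> C"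
  shows "L2 M (\<lambda>x. k x *\<^sub>R f x)"
  unfolding L2_def
proof
  show m: "(\<lambda>x. k x *\<^sub>R f x) \<in> borel_measurable M"
    using assms unfolding L2_def by (auto intro: borel_measurable_scaleR)
  show "integrable M (\<lambda>x. (norm (k x *\<^sub>R f x))^2)"
  proof (rule Bochner_Integration.integrable_bound[of M "\<lambda>x. C^2 * (norm (f x))^2"])
    show "AE x in M. norm ((norm (k x *\<^sub>R f x))^2) \<le> norm (C^2 * (norm (f x))^2)"
      using assms(3)
    proof eventually_elim
      case (elim x)
      have "(k x)^2 \<le> C^2" using elim by (metis abs_ge_zero abs_le_square_iff abs_of_nonneg order_trans)
      then show ?case by (simp add: power_mult_distrib mult_right_mono)
    qed
  qed (use assms m in \<open>auto simp: L2_def intro!: borel_measurable_power borel_measurable_norm\<close>)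
qed

lemma L2_scaleR: "L2 M f \<Longrightarrow> L2 M (\<lambda>x. c *\<^sub>R f x)"
  by (rule L2_mult_bounded[where C="\<bar>c\<bar>"]) auto

lemma L2_diff: "L2 M f \<Longrightarrow> L2 M g \<Longrightarrow> L2 M (\<lambda>x. f x - g x)"
  using L2_add[of M f "\<lambda>x. (-1) *\<^sub>R g x"] L2_scaleR[of M g "-1"] by simp

lemma L2_inner_integrable:
  assumes "L2 M f" "L2 M g"
  shows "integrable M (\<lambda>x. f x \<bullet> g x)"
proof (rule Bochner_Integration.integrable_bound[of M "\<lambda>x. (norm (f x))^2 + (norm (g x))^2"])
  have "\<bar>f x \<bullet> g x\<bar> \<le> (norm (f x))^2 + (norm (g x))^2" for x
  proof -
    have "\<bar>f x \<bullet> g x\<bar> \<le> norm (f x) * norm (g x)" by (rule Cauchy_Schwarz_ineq2)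
    also have "\<dots> \<le> (norm (f x))^2 + (norm (g x))^2"
      using sum_squares_bound[of "norm (f x)" "norm (g x)"]
        mult_nonneg_nonneg[OF norm_ge_zero[of "f x"] norm_ge_zero[of "g x"]] by linarith
    finally show ?thesis .
  qed
  then show "AE x in M. norm (f x \<bullet> g x) \<le> norm ((norm (f x))^2 + (norm (g x))^2)"
    by simp
qed (use assms in \<open>auto simp: L2_def\<close>)

text \<open>The squared norm of f + t g is a nonnegative quadratic in t.\<close>

lemma L2_Cauchy_Schwarz:
  assumes f: "L2 M f" and g: "L2 M g"
  shows "(\<integral>x. f x \<bullet> g x \<partial>M)^2 \<le> L2sq M f * L2sq M g"
proof (rule quadratic_nonneg_imp_discriminant)
  fix t :: real
  have "0 \<le> L2sq M (\<lambda>x. f x + t *\<^sub>R g x)" by simp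
  also have "\<dots> = (\<integral>x. (norm (f x))^2 + 2 * t * (f x \<bullet> g x) + t^2 * (norm (g x))^2 \<partial>M)"
    by (intro Bochner_Integration.integral_cong refl)
       (simp add: power2_norm_eq_inner inner_simps inner_commute algebra_simps, simp add: power2_eq_square)
  also have "\<dots> = L2sq M f + 2 * t * (\<integral>x. f x \<bullet> g x \<partial>M) + t^2 * L2sq M g"
    using L2_inner_integrable[OF f g] L2_integrable_square[OF f] L2_integrable_square[OF g] by simp
  finally show "0 \<le> L2sq M f + 2 * (\<integral>x. f x \<bullet> g x \<partial>M) * t + L2sq M g * t^2"
    by (simp add: mult_ac)
qed

lemma tendsto_L2_inner_zero:
  assumes f: "\<And>n. L2 M (f n)" and g: "\<And>n. L2 M (g n)"
    and f0: "(\<lambda>n. \<integral>x. (norm (f n x))^2 \<partial>M) \<longlonglongrightarrow> 0"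
    and gB: "\<And>n. L2sq M (g n) \<le> B"
  shows "(\<lambda>n. \<integral>x. f n x \<bullet> g n x \<partial>M) \<longlonglongrightarrow> 0"
proof -
  have "(\<lambda>n. (\<integral>x. f n x \<bullet> g n x \<partial>M)^2) \<longlonglongrightarrow> 0"
  proof (rule tendsto_sandwich[OF always_eventually always_eventually, of "\<lambda>_. 0"])
    show "\<forall>n. (\<integral>x. f n x \<bullet> g n x \<partial>M)^2 \<le> L2sq M (f n) * B"
      by (auto intro!: order_trans[OF L2_Cauchy_Schwarz[OF f g]] mult_left_mono gB)
    show "(\<lambda>n. L2sq M (f n) * B) \<longlonglongrightarrow> 0"
      using tendsto_mult_left_zero[OF f0] .
  qed auto
  then show ?thesis by simp
qed

text \<open>The product is expanded around the limits into (f - f')(g - g'), (f - f')g' and (g -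
  g')f'. In each term one factor tends to 0 in L^2 while the other stays bounded there.\<close>

lemma tendsto_L2_inner:
  assumes f: "\<And>n. L2 M (f n)" "L2 M f'" and g: "\<And>n. L2 M (g n)" "L2 M g'"
    and f0: "L2_tendsto M f f'"
    and g0: "L2_tendsto M g g'"
  shows "(\<lambda>n. \<integral>x. f n x \<bullet> g n x \<partial>M) \<longlonglongrightarrow> (\<integral>x. f' x \<bullet> g' x \<partial>M)"
proof -
  obtain B where B: "\<And>n. norm (L2sq M (\<lambda>x. g n x - g' x)) \<le> B"
    using convergent_imp_Bseq[OF convergentI[OF g0]] unfolding Bseq_def by blast
  have B': "L2sq M (\<lambda>x. g n x - g' x) \<le> B" for n
    using B[of n] by simp
  note df = L2_diff[OF f(1) f(2)] and dg = L2_diff[OF g(1) g(2)]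
  have 1: "(\<lambda>n. \<integral>x. (f n x - f' x) \<bullet> (g n x - g' x) \<partial>M) \<longlonglongrightarrow> 0"
    by (rule tendsto_L2_inner_zero[OF df dg f0 B'])
  have 2: "(\<lambda>n. \<integral>x. (f n x - f' x) \<bullet> g' x \<partial>M) \<longlonglongrightarrow> 0"
    by (rule tendsto_L2_inner_zero[OF df g(2) f0 order_refl])
  have 3: "(\<lambda>n. \<integral>x. (g n x - g' x) \<bullet> f' x \<partial>M) \<longlonglongrightarrow> 0"
    by (rule tendsto_L2_inner_zero[OF dg f(2) g0 order_refl])
  have eq: "(\<integral>x. f n x \<bullet> g n x \<partial>M) = (\<integral>x. (f n x - f' x) \<bullet> (g n x - g' x) \<partial>M)
      + (\<integral>x. (f n x - f' x) \<bullet> g' x \<partial>M) + (\<integral>x. (g n x - g' x) \<bullet> f' x \<partial>M) + (\<integral>x. f' x \<bullet> g' x \<partial>M)" for n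
  proof -
    have "(\<integral>x. f n x \<bullet> g n x \<partial>M) = (\<integral>x. (f n x - f' x) \<bullet> (g n x - g' x)
      + (f n x - f' x) \<bullet> g' x + (g n x - g' x) \<bullet> f' x + f' x \<bullet> g' x \<partial>M)"
      by (intro Bochner_Integration.integral_cong refl) (simp add: inner_simps inner_commute)
    then show ?thesis
      using L2_inner_integrable[OF df dg] L2_inner_integrable[OF df g(2)] L2_inner_integrable[OF dg f(2)]
        L2_inner_integrable[OF f(2) g(2)] by simp
  qed
  have "(\<lambda>n. (\<integral>x. (f n x - f' x) \<bullet> (g n x - g' x) \<partial>M)
      + (\<integral>x. (f n x - f' x) \<bullet> g' x \<partial>M) + (\<integral>x. (g n x - g' x) \<bullet> f' x \<partial>M) + (\<integral>x. f' x \<bullet> g' x \<partial>M))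
      \<longlonglongrightarrow> 0 + 0 + 0 + (\<integral>x. f' x \<bullet> g' x \<partial>M)"
    by (intro tendsto_add 1 2 3 tendsto_const)
  then show ?thesis unfolding eq by simp
qed

text \<open>The form in which Lipschitz operations inherit convergence: applying the coefficient
  matrix, composing with a Lipschitz function, multiplying by bounded functions.\<close>

lemma tendsto_L2_dominated:
  assumes f: "\<And>n. L2 M (f n)" "L2 M f'" and g: "\<And>n. L2 M (g n)" "L2 M g'"
    and le: "\<And>n. AE x in M. (norm (f n x - f' x))^2 \<le> c * (norm (g n x - g' x))^2"
    and lim: "L2_tendsto M g g'"
  shows "L2_tendsto M f f'"
proof (rule tendsto_sandwich[OF always_eventually always_eventually, of "\<lambda>_. 0"])
  show "\<forall>n. L2sq M (\<lambda>x. f n x - f' x) \<le> c * L2sq M (\<lambda>x. g n x - g' x)"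
    unfolding integral_mult_right_zero[symmetric]
    by (intro allI integral_mono_AE integrable_mult_right L2_integrable_square L2_diff f g le)
  show "(\<lambda>n. c * L2sq M (\<lambda>x. g n x - g' x)) \<longlonglongrightarrow> 0"
    by (rule tendsto_mult_right_zero[OF lim])
qed auto

lemma tendsto_L2_AE_subseq:
  assumes "\<And>n. L2 M (f n)" "L2 M g" "L2_tendsto M f g"
  obtains r :: "nat \<Rightarrow> nat" where "strict_mono r" "AE x in M. (\<lambda>n. f (r n) x) \<longlonglongrightarrow> g x"
proof -
  have "\<exists>r::nat\<Rightarrow>nat. strict_mono r \<and> (AE x in M. (\<lambda>n. (norm (f (r n) x - g x))^2) \<longlonglongrightarrow> 0)"
    by (rule tendsto_L1_AE_subseq)
       (use assms L2_integrable_square[OF L2_diff[OF assms(1,2)]] in simp_all)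
  then obtain r :: "nat \<Rightarrow> nat" where r: "strict_mono r"
      and ae: "AE x in M. (\<lambda>n. (norm (f (r n) x - g x))^2) \<longlonglongrightarrow> 0" by blast
  show thesis
  proof (rule that[OF r])
    show "AE x in M. (\<lambda>n. f (r n) x) \<longlonglongrightarrow> g x"
      using ae
    proof eventually_elim
      case (elim x)
      then have "(\<lambda>n. f (r n) x - g x) \<longlonglongrightarrow> 0"
        by (simp add: tendsto_norm_zero_iff)
      then show ?case using Lim_null by blast
    qed
  qed
qed

text \<open>Cauchy-Schwarz against the constant 1, which is square-integrable because the measure is
  finite.\<close>

lemma (in finite_measure) L2_integrable_norm_bound:
  assumes "L2 M f"
  shows "integrable M f" "(\<integral>x. norm (f x) \<partial>M)^2 \<le> measure M (space M) * L2sq M f"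
proof -
  have n: "L2 M (\<lambda>x. norm (f x))" and one: "L2 M (\<lambda>x. 1::real)"
    using assms by (auto simp: L2_def)
  show "integrable M f"
    using L2_inner_integrable[OF n one] assms
    by (simp add: L2_def integrable_norm_iff)
  show "(\<integral>x. norm (f x) \<partial>M)^2 \<le> measure M (space M) * L2sq M f"
    using L2_Cauchy_Schwarz[OF n one] by (simp add: mult.commute)
qed

text \<open>Fatou along an almost everywhere convergent subsequence identifies the pointwise limit as the
  limit in the mean.\<close>
lemma (in finite_measure) L2_complete:
  fixes f :: "nat \<Rightarrow> 'a \<Rightarrow> 'b::euclidean_space"
  assumes f: "\<And>n. L2 M (f n)"
    and cauchy: "\<And>e. e > 0 \<Longrightarrow> \<exists>N. \<forall>i\<ge>N. \<forall>j\<ge>N. L2sq M (\<lambda>x. f i x - f j x) < e"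
  obtains g where "L2 M g" "L2_tendsto M f g"
proof -
  have [measurable]: "f n \<in> borel_measurable M" for n using f by (rule L2_measurable)
  let ?m = "measure M (space M)"
  obtain r :: "nat \<Rightarrow> nat" where r: "strict_mono r" and ae: "AE x in M. Cauchy (\<lambda>i. f (r i) x)"
  proof (rule cauchy_L1_AE_cauchy_subseq[of M f])
    show "integrable M (f n)" for n using L2_integrable_norm_bound(1)[OF f] .
    fix e :: real assume e: "e > 0"
    \<comment> \<open>Passing from L^2 to L^1 costs the total mass m. Dividing by m + 1 admits m = 0
      and keeps the bound strict, as m / (m + 1) < 1.\<close>
    then have "e^2 / (?m + 1) > 0" by (simp add: add_nonneg_pos)
    from cauchy[OF this] obtain N where
      N: "\<And>i j. i \<ge> N \<Longrightarrow> j \<ge> N \<Longrightarrow> L2sq M (\<lambda>x. f i x - f j x) < e^2 / (?m + 1)" by blast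
    have "(\<integral>x. norm (f i x - f j x) \<partial>M) < e" if "i \<ge> N" "j \<ge> N" for i j
    proof (rule power2_less_imp_less)
      have "(\<integral>x. norm (f i x - f j x) \<partial>M)^2 \<le> ?m * L2sq M (\<lambda>x. f i x - f j x)"
        by (rule L2_integrable_norm_bound(2)[OF L2_diff[OF f f]])
      also have "\<dots> \<le> ?m * (e^2 / (?m + 1))"
        using N[OF that] by (intro mult_left_mono) auto
      also have "\<dots> < e^2"
        using e by (simp add: field_simps add_pos_nonneg)
      finally show "(\<integral>x. norm (f i x - f j x) \<partial>M)^2 < e^2" .
    qed (use e in simp)
    then show "\<exists>N. \<forall>i\<ge>N. \<forall>j\<ge>N. (\<integral>x. norm (f i x - f j x) \<partial>M) < e" by blast
  qed blast
  define g where "g = (\<lambda>x. lim (\<lambda>i. f (r i) x))"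
  have [measurable]: "g \<in> borel_measurable M" unfolding g_def by measurable
  have lim: "AE x in M. (\<lambda>i. f (r i) x) \<longlonglongrightarrow> g x"
    using ae by eventually_elim (simp add: g_def Cauchy_convergent convergent_LIMSEQ_iff[symmetric])
  have fatou: "(\<integral>\<^sup>+x. ennreal ((norm (f n x - g x))^2) \<partial>M) \<le> ennreal e"
    if N: "\<And>i j. i \<ge> N \<Longrightarrow> j \<ge> N \<Longrightarrow> L2sq M (\<lambda>x. f i x - f j x) < e" and n: "n \<ge> N" for n N e
  proof -
    have "(\<integral>\<^sup>+x. ennreal ((norm (f n x - g x))^2) \<partial>M)
        = (\<integral>\<^sup>+x. liminf (\<lambda>i. ennreal ((norm (f n x - f (r i) x))^2)) \<partial>M)"
    proof (rule nn_integral_cong_AE, use lim in eventually_elim)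
      case (elim x)
      have "(\<lambda>i. ennreal ((norm (f n x - f (r i) x))^2)) \<longlonglongrightarrow> ennreal ((norm (f n x - g x))^2)"
        by (intro tendsto_ennrealI tendsto_intros elim)
      then show ?case by (rule lim_imp_Liminf[OF trivial_limit_sequentially, symmetric])
    qed
    also have "\<dots> \<le> liminf (\<lambda>i. \<integral>\<^sup>+x. ennreal ((norm (f n x - f (r i) x))^2) \<partial>M)"
      by (rule nn_integral_liminf) measurable
    also have "\<dots> \<le> ennreal e"
    proof (rule Liminf_le)
      show "\<forall>\<^sub>F i in sequentially. (\<integral>\<^sup>+x. ennreal ((norm (f n x - f (r i) x))^2) \<partial>M) \<le> ennreal e"
      proof (rule eventually_sequentiallyI[of N])
        fix i assume "i \<ge> N"
        then have "r i \<ge> N" using seq_suble[OF r, of i] by linarith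
        then show "(\<integral>\<^sup>+x. ennreal ((norm (f n x - f (r i) x))^2) \<partial>M) \<le> ennreal e"
          using N[OF n \<open>r i \<ge> N\<close>]
          by (subst nn_integral_eq_integral[OF L2_integrable_square[OF L2_diff[OF f f]]]) (auto intro!: ennreal_leI)
      qed
    qed simp
    finally show ?thesis .
  qed
  have sub: "L2 M (\<lambda>x. f n x - g x)" "L2sq M (\<lambda>x. f n x - g x) \<le> e"
    if N: "\<And>i j. i \<ge> N \<Longrightarrow> j \<ge> N \<Longrightarrow> L2sq M (\<lambda>x. f i x - f j x) < e" and n: "n \<ge> N" and e: "e > 0" for n N e
  proof -
    have "integrable M (\<lambda>x. (norm (f n x - g x))^2)"
      using le_less_trans[OF fatou[OF N n] ennreal_less_top] by (intro integrableI_bounded) auto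
    then show "L2 M (\<lambda>x. f n x - g x)" by (simp add: L2_def)
    show "L2sq M (\<lambda>x. f n x - g x) \<le> e"
      using fatou[OF N n] e by (subst integral_eq_nn_integral) (auto intro: enn2real_leI)
  qed
  obtain N1 where N1: "\<And>i j. i \<ge> N1 \<Longrightarrow> j \<ge> N1 \<Longrightarrow> L2sq M (\<lambda>x. f i x - f j x) < 1"
    using cauchy[of 1] by auto
  have "L2 M (\<lambda>x. f N1 x - (f N1 x - g x))"
    by (rule L2_diff[OF f sub(1)[OF N1 order_refl]]) simp_all
  then have "L2 M g" by simp
  moreover have "L2_tendsto M f g"
  proof (rule LIMSEQ_I)
    fix e :: real assume e: "e > 0"
    obtain N where N: "\<And>i j. i \<ge> N \<Longrightarrow> j \<ge> N \<Longrightarrow> L2sq M (\<lambda>x. f i x - f j x) < e / 2"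
      using cauchy[of "e/2"] e by auto
    have "norm (L2sq M (\<lambda>x. f n x - g x) - 0) < e" if "n \<ge> N" for n
      using sub(2)[OF N that] e by simp
    then show "\<exists>N. \<forall>n\<ge>N. norm (L2sq M (\<lambda>x. f n x - g x) - 0) < e" by blast
  qed
  ultimately show thesis by (rule that)
qed

section \<open>Test functions and the space \<open>H\<^sub>0\<^sup>1\<close>\<close>

lemma set_integrable_lebesgue_on_iff:
  fixes f :: "'a::euclidean_space \<Rightarrow> 'b::{banach, second_countable_topology}"
  shows "open \<Omega> \<Longrightarrow> set_integrable lebesgue \<Omega> f \<longleftrightarrow> integrable (lebesgue_on \<Omega>) f"
  unfolding set_integrable_def by (subst integrable_restrict_space) (auto simp: borel_open)

lemma set_integral_lebesgue_on:
  fixes f :: "'a::euclidean_space \<Rightarrow> 'b::{banach, second_countable_topology}"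
  shows "open \<Omega> \<Longrightarrow> set_lebesgue_integral lebesgue \<Omega> f = integral\<^sup>L (lebesgue_on \<Omega>) f"
  unfolding set_lebesgue_integral_def by (subst integral_restrict_space) (auto simp: borel_open)

lemma AE_lebesgue_on_iff:
  "open \<Omega> \<Longrightarrow> (AE x in lebesgue_on \<Omega>. P x) \<longleftrightarrow> (AE x in lebesgue. x \<in> \<Omega> \<longrightarrow> P x)"
  by (subst AE_restrict_space_iff) (auto simp: borel_open)

lemma L2_on_iff: "open \<Omega> \<Longrightarrow> L2_on \<Omega> v \<longleftrightarrow> L2 (lebesgue_on \<Omega>) v"
  unfolding L2_on_def L2_def set_integrable_lebesgue_on_iff set_borel_measurable_def
  by (subst borel_measurable_restrict_space_iff) (auto simp: borel_open)

lemma finite_measure_lebesgue_on_bounded: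
  "open \<Omega> \<Longrightarrow> bounded \<Omega> \<Longrightarrow> finite_measure (lebesgue_on \<Omega>)"
  by (intro finite_measure_lebesgue_on lmeasurable_open)

lemma continuous_measurable_lebesgue_on:
  "continuous_on UNIV f \<Longrightarrow> f \<in> borel_measurable (lebesgue_on S)"
  for f :: "'a::euclidean_space \<Rightarrow> 'b::topological_space"
  by (intro measurable_restrict_space1 measurable_completion) (simp add: borel_measurable_continuous_onI)

text \<open>A bridge between the weak formulation, which integrates over \<Omega>, and
  \<open>lborel\<close>, where translations and Fubini are available.\<close>

lemma integral_lebesgue_on_eq_lborel:
  fixes f :: "'a::euclidean_space \<Rightarrow> 'b::{banach, second_countable_topology}"
  assumes "open \<Omega>" "f \<in> borel_measurable borel" "\<And>x. x \<notin> \<Omega> \<Longrightarrow> f x = 0"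
  shows "integral\<^sup>L (lebesgue_on \<Omega>) f = integral\<^sup>L lborel f"
    and "integrable (lebesgue_on \<Omega>) f \<longleftrightarrow> integrable lborel f"
proof -
  have eq: "indicator \<Omega> x *\<^sub>R f x = f x" for x
    using assms(3) by (auto simp: indicator_def)
  show "integral\<^sup>L (lebesgue_on \<Omega>) f = integral\<^sup>L lborel f"
    using assms by (subst integral_restrict_space) (auto simp: borel_open eq integral_completion)
  show "integrable (lebesgue_on \<Omega>) f \<longleftrightarrow> integrable lborel f"
    using assms by (subst integrable_restrict_space) (auto simp: borel_open eq integrable_completion)
qed

section \<open>C^1 functions of compact support\<close>

lemma test_fun_D:
  assumes "test_fun \<Omega> \<phi> g"
  shows "continuous_on UNIV \<phi>" "continuous_on UNIV g"
    "\<And>x. (\<phi> has_derivative (\<lambda>v. g x \<bullet> v)) (at x)"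
proof -
  show d: "\<And>x. (\<phi> has_derivative (\<lambda>v. g x \<bullet> v)) (at x)" and "continuous_on UNIV g"
    using assms by (auto simp: test_fun_def)
  show "continuous_on UNIV \<phi>"
    by (intro continuous_at_imp_continuous_on ballI has_derivative_continuous[OF d])
qed

text \<open>The complement of the closed support is open and \<phi> vanishes on it, so by uniqueness
  of derivatives the functional \<open>\<lambda>v. g x \<bullet> v\<close> is zero; evaluating it at
  \<open>g x\<close> itself gives \<open>g x = 0\<close>.\<close>

lemma test_fun_outside:
  assumes "test_fun \<Omega> \<phi> g" "x \<notin> closure {x. \<phi> x \<noteq> 0}"
  shows "\<phi> x = 0" "g x = 0"
proof -
  let ?U = "- closure {x. \<phi> x \<noteq> 0}"
  have U: "open ?U" "x \<in> ?U" using assms by auto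
  have z: "\<phi> y = 0" if "y \<in> ?U" for y
    using that closure_subset[of "{x. \<phi> x \<noteq> 0}"] by blast
  show "\<phi> x = 0" by (rule z[OF U(2)])
  have "(\<phi> has_derivative (\<lambda>v. 0)) (at x)"
  proof (rule has_derivative_transform_within_open[where f="\<lambda>_. 0", OF _ U])
    show "0 = \<phi> y" if "y \<in> ?U" for y using z[OF that] by (rule sym)
  qed (rule has_derivative_const)
  then have "(\<lambda>v. g x \<bullet> v) = (\<lambda>v. 0)"
    by (rule has_derivative_unique[OF test_fun_D(3)[OF assms(1)]])
  from fun_cong[OF this, of "g x"] have "g x \<bullet> g x = 0" .
  then show "g x = 0" by simp
qed

lemma test_fun_outside_domain:
  assumes "test_fun \<Omega> \<phi> g" "x \<notin> \<Omega>"
  shows "\<phi> x = 0" "g x = 0"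
  using test_fun_outside[OF assms(1), of x] assms unfolding test_fun_def by auto

lemma continuous_compact_support_bounded:
  fixes f :: "'a::topological_space \<Rightarrow> 'b::real_normed_vector"
  assumes "continuous_on UNIV f" "compact K" "\<And>x. x \<notin> K \<Longrightarrow> f x = 0"
  obtains C where "C \<ge> 0" "\<And>x. norm (f x) \<le> C"
proof -
  have "compact (f ` K)"
    by (intro compact_continuous_image continuous_on_subset[OF assms(1)] assms(2)) simp
  then obtain C where C: "\<And>x. x \<in> K \<Longrightarrow> norm (f x) \<le> C"
    using compact_imp_bounded bounded_iff by (metis imageI)
  have "norm (f x) \<le> max 0 C" for x
    using C[of x] assms(3)[of x] by (cases "x \<in> K") auto
  then show thesis using that[of "max 0 C"] by auto
qed

lemma test_fun_bounded:
  assumes "test_fun \<Omega> \<phi> g"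
  obtains C where "C \<ge> 0" "\<And>x. \<bar>\<phi> x\<bar> \<le> C" "\<And>x. norm (g x) \<le> C"
proof -
  let ?K = "closure {x. \<phi> x \<noteq> 0}"
  have K: "compact ?K" using assms by (simp add: test_fun_def)
  obtain A where A: "A \<ge> 0" "\<And>x. norm (\<phi> x) \<le> A"
    using continuous_compact_support_bounded[OF test_fun_D(1)[OF assms] K] test_fun_outside[OF assms] by metis
  obtain B where B: "B \<ge> 0" "\<And>x. norm (g x) \<le> B"
    using continuous_compact_support_bounded[OF test_fun_D(2)[OF assms] K] test_fun_outside[OF assms] by metis
  show thesis
    using A B by (intro that[of "max A B"]) (auto simp: le_max_iff_disj)
qed

lemma continuous_compact_support_integrable:
  fixes f :: "'a::euclidean_space \<Rightarrow> 'b::euclidean_space"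
  assumes "continuous_on UNIV f" "compact K" "\<And>x. x \<notin> K \<Longrightarrow> f x = 0"
  shows "integrable lborel f"
proof -
  have "integrable lborel (\<lambda>x. indicator K x *\<^sub>R f x)"
    by (rule borel_integrable_compact[OF assms(2) continuous_on_subset[OF assms(1) subset_UNIV]])
  moreover have "(\<lambda>x. indicator K x *\<^sub>R f x) = f"
    using assms(3) by (auto simp: fun_eq_iff indicator_def)
  ultimately show ?thesis by simp
qed

lemma test_fun_integrable_grad:
  assumes "test_fun \<Omega> \<phi> g"
  shows "integrable lborel g" "integrable lborel (\<lambda>x. (norm (g x))^2)" "integrable lborel \<phi>"
    "integrable lborel (\<lambda>x. (\<phi> x)^2)"
proof -
  let ?K = "closure {x. \<phi> x \<noteq> 0}"
  have K: "compact ?K" using assms by (simp add: test_fun_def)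
  note c = test_fun_D(1,2)[OF assms] and z = test_fun_outside[OF assms]
  show "integrable lborel g" "integrable lborel \<phi>"
    by (rule continuous_compact_support_integrable[OF _ K], rule c, erule z)+
  show "integrable lborel (\<lambda>x. (norm (g x))^2)"
    by (rule continuous_compact_support_integrable[OF _ K])
       (intro continuous_intros c, drule z(2), simp)
  show "integrable lborel (\<lambda>x. (\<phi> x)^2)"
    by (rule continuous_compact_support_integrable[OF _ K])
       (intro continuous_intros c, drule z(1), simp)
qed

lemma test_fun_L2:
  assumes "open \<Omega>" "bounded \<Omega>" "test_fun \<Omega> \<phi> g"
  shows "L2 (lebesgue_on \<Omega>) \<phi>" "L2 (lebesgue_on \<Omega>) g"
proof -
  interpret finite_measure "lebesgue_on \<Omega>"
    using assms by (intro finite_measure_lebesgue_on_bounded)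
  note c [measurable] = test_fun_D(1,2)[OF assms(3), THEN continuous_measurable_lebesgue_on]
  obtain C where C: "C \<ge> 0" "\<And>x. \<bar>\<phi> x\<bar> \<le> C" "\<And>x. norm (g x) \<le> C"
    by (rule test_fun_bounded[OF assms(3)]) blast
  have "integrable (lebesgue_on \<Omega>) (\<lambda>x. (norm (\<phi> x))^2)"
  proof (rule integrable_const_bound[of _ "C^2"])
    show "AE x in lebesgue_on \<Omega>. norm ((norm (\<phi> x))^2) \<le> C^2"
      using power_mono[OF C(2) abs_ge_zero, where n=2] by (intro always_eventually allI) simp
  qed measurable
  moreover have "integrable (lebesgue_on \<Omega>) (\<lambda>x. (norm (g x))^2)"
  proof (rule integrable_const_bound[of _ "C^2"])
    show "AE x in lebesgue_on \<Omega>. norm ((norm (g x))^2) \<le> C^2"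
      using power_mono[OF C(3) norm_ge_zero] by (intro always_eventually allI) simp
  qed measurable
  ultimately show "L2 (lebesgue_on \<Omega>) \<phi>" "L2 (lebesgue_on \<Omega>) g"
    using c by (auto simp: L2_def)
qed

text \<open>The support of the product lies in that of v, so w may be any C^1 function. Constants w
  give scaling, and w = v gives the square from which the Picone test function is built.\<close>

lemma test_fun_mult_C1:
  assumes v: "test_fun \<Omega> v g" and w: "\<And>x. (w has_derivative (\<lambda>y. k x \<bullet> y)) (at x)"
    and k: "continuous_on UNIV k"
  shows "test_fun \<Omega> (\<lambda>x. v x * w x) (\<lambda>x. v x *\<^sub>R k x + w x *\<^sub>R g x)"
proof -
  have cw: "continuous_on UNIV w"
    by (intro continuous_at_imp_continuous_on ballI has_derivative_continuous[OF w])
  have sub: "closure {x. v x * w x \<noteq> 0} \<subseteq> closure {x. v x \<noteq> 0}"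
    by (intro closure_mono) auto
  have "compact (closure {x. v x * w x \<noteq> 0})"
    using compact_closure bounded_subset[of "{x. v x \<noteq> 0}" "{x. v x * w x \<noteq> 0}"] v
    unfolding test_fun_def by auto
  moreover have "((\<lambda>x. v x * w x) has_derivative (\<lambda>y. (v x *\<^sub>R k x + w x *\<^sub>R g x) \<bullet> y)) (at x)" for x
    by (rule has_derivative_eq_rhs[OF has_derivative_mult[OF test_fun_D(3)[OF v] w]])
       (auto simp: inner_simps)
  ultimately show ?thesis
    using sub v unfolding test_fun_def
    by (auto intro!: continuous_intros test_fun_D[OF v] cw k)
qed

lemma test_fun_add:
  assumes "test_fun \<Omega> u g" "test_fun \<Omega> v k"
  shows "test_fun \<Omega> (\<lambda>x. u x + v x) (\<lambda>x. g x + k x)"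
proof -
  let ?A = "closure {x. u x \<noteq> 0}" and ?B = "closure {x. v x \<noteq> 0}" and ?C = "closure {x. u x + v x \<noteq> 0}"
  have sub: "?C \<subseteq> ?A \<union> ?B"
    unfolding closure_Un[symmetric] by (intro closure_mono) auto
  have cpt: "compact (?A \<union> ?B)"
    using assms by (auto simp: test_fun_def)
  have "compact ?C"
    using closed_Int_compact[OF closed_closure cpt, of "{x. u x + v x \<noteq> 0}"]
    unfolding Int_absorb2[OF sub] .
  moreover have "?C \<subseteq> \<Omega>"
    using sub assms unfolding test_fun_def by blast
  ultimately show ?thesis
    using assms unfolding test_fun_def
    by (auto intro!: continuous_intros derivative_eq_intros simp: inner_simps)
qed

lemma test_fun_scale:
  assumes "test_fun \<Omega> u g"
  shows "test_fun \<Omega> (\<lambda>x. c * u x) (\<lambda>x. c *\<^sub>R g x)"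
  using test_fun_mult_C1[OF assms, of "\<lambda>_. c" "\<lambda>_. 0"] by (simp add: mult.commute)

lemma test_fun_diff:
  assumes "test_fun \<Omega> u g" "test_fun \<Omega> v k"
  shows "test_fun \<Omega> (\<lambda>x. u x - v x) (\<lambda>x. g x - k x)"
  using test_fun_add[OF assms(1) test_fun_scale[OF assms(2), of "-1"]] by simp

section \<open>Translation invariance and integration by parts\<close>

lemma lborel_integral_translate:
  fixes f :: "'a::euclidean_space \<Rightarrow> 'b::{banach, second_countable_topology}"
  assumes "f \<in> borel_measurable borel"
  shows "(\<integral>x. f (x + z) \<partial>lborel) = (\<integral>x. f x \<partial>lborel)"
proof -
  have "(\<integral>x. f x \<partial>lborel) = (\<integral>x. f x \<partial>distr lborel borel ((+) z))"
    by (simp add: lborel_distr_plus)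
  also have "\<dots> = (\<integral>x. f (z + x) \<partial>lborel)"
    using assms by (intro integral_distr) auto
  finally show ?thesis by (simp add: add.commute)
qed

text \<open>Differentiate the translation-invariant integral of \<open>x \<mapsto> \<phi> (x + t e)\<close> in \<open>t\<close>.\<close>
lemma integral_test_fun_grad_eq_0:
  assumes t: "test_fun \<Omega> \<phi> g"
  shows "(\<integral>x. g x \<bullet> e \<partial>lborel) = 0"
proof -
  let ?K = "closure {x. \<phi> x \<noteq> 0}"
  obtain C where C: "C \<ge> 0" "\<And>x. \<bar>\<phi> x\<bar> \<le> C" "\<And>x. norm (g x) \<le> C"
    by (rule test_fun_bounded[OF t]) blast
  have "bounded ?K" using t compact_imp_bounded by (auto simp: test_fun_def)
  then obtain R where R: "\<And>x. x \<in> ?K \<Longrightarrow> norm x \<le> R" unfolding bounded_iff by blast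
  \<comment> \<open>Steps have length at most |e|. If |x| exceeds R + |e|, then both x and the
    shifted point lie outside the support, and the difference quotient vanishes.\<close>
  define B where "B = cball (0::real^'a) (R + norm e)"
  define a where "a = (\<lambda>n::nat. inverse (real (Suc n)))"
  have a: "0 < a n" "a n \<le> 1" for n by (auto simp: a_def field_simps)
  have a0: "a \<longlonglongrightarrow> 0" unfolding a_def by (rule LIMSEQ_inverse_real_of_nat)
  define q where "q = (\<lambda>n x. (\<phi> (x + a n *\<^sub>R e) - \<phi> x) / a n)"
  have [measurable]: "\<phi> \<in> borel_measurable borel" "g \<in> borel_measurable borel"
    using test_fun_D[OF t] by (auto intro: borel_measurable_continuous_onI)
  \<comment> \<open>The mean value inequality bounds every difference quotient by C * |e|; on the
    bounded set B this is an integrable majorant.\<close>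
  have lip: "\<bar>\<phi> (x + y) - \<phi> x\<bar> \<le> C * norm y" for x y
  proof -
    have "norm (\<phi> (x + y) - \<phi> x) \<le> C * norm (x + y - x)"
    proof (rule differentiable_bound[of UNIV \<phi> "\<lambda>x v. g x \<bullet> v"])
      show "onorm (\<lambda>v. g z \<bullet> v) \<le> C" for z
      proof (rule onorm_le)
        fix v
        show "norm (g z \<bullet> v) \<le> C * norm v"
          using order_trans[OF Cauchy_Schwarz_ineq2[of "g z" v] mult_right_mono[OF C(3) norm_ge_zero]] by simp
      qed
    qed (use test_fun_D(3)[OF t] in auto)
    then show ?thesis by simp
  qed
  have "(\<lambda>n. \<integral>x. q n x \<partial>lborel) \<longlonglongrightarrow> (\<integral>x. g x \<bullet> e \<partial>lborel)"
  proof (rule integral_dominated_convergence[where w="\<lambda>x. indicator B x * (C * norm e)"])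
    show "AE x in lborel. (\<lambda>n. q n x) \<longlonglongrightarrow> g x \<bullet> e"
    proof (intro always_eventually allI)
      fix x
      have "((\<lambda>s. \<phi> (x + s *\<^sub>R e)) has_derivative (\<lambda>s. g (x + 0 *\<^sub>R e) \<bullet> (s *\<^sub>R e))) (at 0)"
        by (rule has_derivative_compose[OF _ test_fun_D(3)[OF t], of "\<lambda>s. x + s *\<^sub>R e"])
           (auto intro!: derivative_eq_intros)
      then have "((\<lambda>s. \<phi> (x + s *\<^sub>R e)) has_field_derivative (g x \<bullet> e)) (at 0)"
        by (simp add: has_field_derivative_def mult.commute[of "g x \<bullet> e"] mult_commute_abs)
      then have "((\<lambda>s. (\<phi> (x + s *\<^sub>R e) - \<phi> x) / s) \<longlongrightarrow> g x \<bullet> e) (at 0)"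
        by (simp add: has_field_derivative_iff)
      then show "(\<lambda>n. q n x) \<longlonglongrightarrow> g x \<bullet> e"
        unfolding q_def
      proof (rule filterlim_compose)
        show "filterlim a (at 0) sequentially"
          using a0 a(1) by (auto simp: filterlim_at intro!: always_eventually less_imp_neq[THEN not_sym])
      qed
    qed
    show "AE x in lborel. norm (q n x) \<le> indicator B x * (C * norm e)" for n
    proof (intro always_eventually allI)
      fix x
      show "norm (q n x) \<le> indicator B x * (C * norm e)"
      proof (cases "x \<in> B")
        case True
        have "\<bar>\<phi> (x + a n *\<^sub>R e) - \<phi> x\<bar> \<le> a n * (C * norm e)"
          using lip[of x "a n *\<^sub>R e"] a[of n] by (simp add: mult_ac)
        then show ?thesis using True a[of n] by (simp add: q_def field_simps)
      next
        case False
        then have n: "norm x > R + norm e" by (simp add: B_def)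
        have 1: "x \<notin> ?K" using n R[of x] norm_ge_zero[of e] by linarith
        have "norm (a n *\<^sub>R e) \<le> norm e" using a[of n] by (simp add: mult_left_le_one_le)
        moreover have "norm x \<le> norm (x + a n *\<^sub>R e) + norm (a n *\<^sub>R e)"
          using norm_triangle_ineq4[of "x + a n *\<^sub>R e" "a n *\<^sub>R e"] by simp
        ultimately have 2: "x + a n *\<^sub>R e \<notin> ?K" using n R[of "x + a n *\<^sub>R e"] by linarith
        show ?thesis using test_fun_outside(1)[OF t 1] test_fun_outside(1)[OF t 2] by (simp add: q_def C)
      qed
    qed
    show "integrable lborel (\<lambda>x. indicator B x * (C * norm e))"
      by (intro integrable_mult_left impI integrable_real_indicator)
         (use emeasure_bounded_finite[of B] in \<open>auto simp: B_def less_top\<close>)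
  qed (auto simp: q_def)
  moreover have "(\<integral>x. q n x \<partial>lborel) = 0" for n
  proof -
    have i: "integrable lborel \<phi>" by (rule test_fun_integrable_grad[OF t])
    then have "integrable lborel (\<lambda>x. \<phi> (x + a n *\<^sub>R e))"
      using integrable_distr_eq[of "(+) (a n *\<^sub>R e)" lborel borel \<phi>]
      by (simp add: lborel_distr_plus add.commute)
    then show ?thesis
      using i lborel_integral_translate[of \<phi> "a n *\<^sub>R e"] by (simp add: q_def)
  qed
  ultimately show ?thesis by (simp add: LIMSEQ_const_iff)
qed

text \<open>The product u v is again a test function, so its gradient has integral zero in the
  direction \<open>axis i 1\<close>; the product rule splits this integral in two.\<close>

lemma test_fun_integration_by_parts:
  assumes "open \<Omega>" "bounded \<Omega>" and u: "test_fun \<Omega> u k" and v: "test_fun \<Omega> v g"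
  shows "(\<integral>x. u x * (g x $ i) \<partial>lebesgue_on \<Omega>) = - (\<integral>x. (k x $ i) * v x \<partial>lebesgue_on \<Omega>)"
proof -
  let ?\<mu> = "lebesgue_on \<Omega>"
  note lu = test_fun_L2[OF assms(1,2) u] and lv = test_fun_L2[OF assms(1,2) v]
  have comp: "L2 ?\<mu> (\<lambda>x. w x $ i)" if "L2 ?\<mu> w" for w :: "real^'a \<Rightarrow> real^'a"
  proof -
    have [measurable]: "w \<in> borel_measurable ?\<mu>" using that by (rule L2_measurable)
    have "(\<lambda>x. w x $ i) = (\<lambda>x. w x \<bullet> axis i 1)" by (simp add: inner_axis)
    then have [measurable]: "(\<lambda>x. w x $ i) \<in> borel_measurable ?\<mu>" by simp
    have "integrable ?\<mu> (\<lambda>x. (norm (w x $ i))^2)"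
      by (rule Bochner_Integration.integrable_bound[OF L2_integrable_square[OF that]])
         (auto simp: abs_le_square_iff[symmetric] intro: component_le_norm_cart)
    then show ?thesis by (simp add: L2_def)
  qed
  have t: "test_fun \<Omega> (\<lambda>x. u x * v x) (\<lambda>x. u x *\<^sub>R g x + v x *\<^sub>R k x)"
    by (rule test_fun_mult_C1[OF u test_fun_D(3)[OF v] test_fun_D(2)[OF v]])
  have "(\<integral>x. (u x *\<^sub>R g x + v x *\<^sub>R k x) \<bullet> axis i 1 \<partial>?\<mu>) = 0"
  proof (subst integral_lebesgue_on_eq_lborel(1)[OF assms(1)])
    show "(\<lambda>x. (u x *\<^sub>R g x + v x *\<^sub>R k x) \<bullet> axis i 1) \<in> borel_measurable borel"
      by (intro borel_measurable_continuous_onI continuous_intros test_fun_D[OF u] test_fun_D[OF v])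
    show "(u x *\<^sub>R g x + v x *\<^sub>R k x) \<bullet> axis i 1 = 0" if "x \<notin> \<Omega>" for x
      using test_fun_outside_domain[OF t that] by (metis inner_zero_left)
    show "(\<integral>x. (u x *\<^sub>R g x + v x *\<^sub>R k x) \<bullet> axis i 1 \<partial>lborel) = 0"
      by (rule integral_test_fun_grad_eq_0[OF t])
  qed
  moreover have "(u x *\<^sub>R g x + v x *\<^sub>R k x) \<bullet> axis i 1 = u x * (g x $ i) + (k x $ i) * v x" for x
    by (simp add: inner_axis)
  ultimately have "(\<integral>x. u x * (g x $ i) + (k x $ i) * v x \<partial>?\<mu>) = 0" by simp
  then show ?thesis
    using L2_inner_integrable[OF lu(1) comp[OF lv(2)]] L2_inner_integrable[OF comp[OF lu(2)] lv(1)]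
    by simp
qed


section \<open>The closure of the test functions\<close>

text \<open>\<open>weak_grad\<close> is inherited from the approximating test functions: integration
  by parts holds for each of them, and both sides converge because they are L^2 pairings with a
  fixed function. Membership can therefore be established by exhibiting an approximating
  sequence.\<close>

lemma H10_iff:
  assumes \<Omega>: "open \<Omega>" "bounded \<Omega>"
  defines "\<mu> \<equiv> lebesgue_on \<Omega>"
  shows "H10 \<Omega> u G \<longleftrightarrow> L2 \<mu> u \<and> L2 \<mu> G \<and>
    (\<exists>\<phi> g. (\<forall>k. test_fun \<Omega> (\<phi> k) (g k)) \<and>
       L2_tendsto \<mu> \<phi> u \<and>
       L2_tendsto \<mu> g G)"
proof -
  have "weak_grad \<Omega> u G"
    if u: "L2 \<mu> u" and G: "L2 \<mu> G" and t: "\<And>k. test_fun \<Omega> (\<phi> k) (g k)"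
      and c1: "L2_tendsto \<mu> \<phi> u"
      and c2: "L2_tendsto \<mu> g G" for \<phi> g
    unfolding weak_grad_def set_integral_lebesgue_on[OF \<Omega>(1)]
  proof (intro allI impI)
    fix \<eta> k i assume tc: "test_fun \<Omega> \<eta> k"
    note L2t = test_fun_L2[OF \<Omega> t, folded \<mu>_def]
    have cont: "continuous_on UNIV (\<lambda>x. k x \<bullet> axis i 1)" "continuous_on UNIV (\<lambda>x. \<eta> x *\<^sub>R axis i (1::real) :: real^'a)"
      by (intro continuous_intros test_fun_D[OF tc])+
    have n: "norm (axis i (1::real) :: real^'a) = 1" by simp
    have k: "L2 \<mu> (\<lambda>x. k x \<bullet> axis i 1)"
      unfolding L2_def
    proof (intro conjI)
      show m: "(\<lambda>x. k x \<bullet> axis i 1) \<in> borel_measurable \<mu>"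
        unfolding \<mu>_def by (rule continuous_measurable_lebesgue_on[OF cont(1)])
      show "integrable \<mu> (\<lambda>x. (norm (k x \<bullet> axis i 1))^2)"
      proof (rule Bochner_Integration.integrable_bound)
        show "integrable \<mu> (\<lambda>x. (norm (k x))^2)"
          using test_fun_L2(2)[OF \<Omega> tc] unfolding \<mu>_def by (rule L2_integrable_square)
        show "AE x in \<mu>. norm ((norm (k x \<bullet> axis i 1))^2) \<le> norm ((norm (k x))^2)"
          using Cauchy_Schwarz_ineq2[of _ "axis i (1::real) :: real^'a"]
          by (intro always_eventually allI) (simp add: abs_le_square_iff[symmetric])
      qed (use m in measurable)
    qed
    have \<eta>: "L2 \<mu> (\<lambda>x. \<eta> x *\<^sub>R axis i (1::real) :: real^'a)"
      using test_fun_L2(1)[OF \<Omega> tc] continuous_measurable_lebesgue_on[OF cont(2), of \<Omega>]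
      unfolding \<mu>_def L2_def by simp
    have lim1: "(\<lambda>n. \<integral>x. \<phi> n x \<bullet> (k x \<bullet> axis i 1) \<partial>\<mu>) \<longlonglongrightarrow> (\<integral>x. u x \<bullet> (k x \<bullet> axis i 1) \<partial>\<mu>)"
      by (rule tendsto_L2_inner[OF L2t(1) u k k c1]) simp
    have lim2: "(\<lambda>n. \<integral>x. g n x \<bullet> (\<eta> x *\<^sub>R axis i 1) \<partial>\<mu>) \<longlonglongrightarrow> (\<integral>x. G x \<bullet> (\<eta> x *\<^sub>R axis i 1) \<partial>\<mu>)"
      by (rule tendsto_L2_inner[OF L2t(2) G \<eta> \<eta> c2]) simp
    have eq: "(\<integral>x. \<phi> n x \<bullet> (k x \<bullet> axis i 1) \<partial>\<mu>) = - (\<integral>x. g n x \<bullet> (\<eta> x *\<^sub>R axis i 1) \<partial>\<mu>)" for n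
      using test_fun_integration_by_parts[OF \<Omega> t tc, of n i] unfolding \<mu>_def by (simp add: inner_axis mult.commute)
    have "(\<integral>x. u x \<bullet> (k x \<bullet> axis i 1) \<partial>\<mu>) = - (\<integral>x. G x \<bullet> (\<eta> x *\<^sub>R axis i 1) \<partial>\<mu>)"
      by (rule LIMSEQ_unique[OF lim1]) (unfold eq, rule tendsto_minus[OF lim2])
    then show "(\<integral>x. u x * (k x $ i) \<partial>lebesgue_on \<Omega>) = - (\<integral>x. (G x $ i) * \<eta> x \<partial>lebesgue_on \<Omega>)"
      unfolding \<mu>_def by (simp add: inner_axis mult.commute)
  qed
  then show ?thesis
    unfolding H10_def L2_on_iff[OF \<Omega>(1)] set_integral_lebesgue_on[OF \<Omega>(1)] \<mu>_def by auto
qed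

lemma H10I:
  assumes "open \<Omega>" "bounded \<Omega>" "L2 (lebesgue_on \<Omega>) u" "L2 (lebesgue_on \<Omega>) G"
    "\<And>k. test_fun \<Omega> (\<phi> k) (g k)"
    "L2_tendsto (lebesgue_on \<Omega>) \<phi> u"
    "L2_tendsto (lebesgue_on \<Omega>) g G"
  shows "H10 \<Omega> u G"
  unfolding H10_iff[OF assms(1,2)]
  by (intro conjI exI[of _ \<phi>] exI[of _ g] allI assms)

lemma H10E:
  assumes "open \<Omega>" "bounded \<Omega>" "H10 \<Omega> u G"
  obtains \<phi> g where "L2 (lebesgue_on \<Omega>) u" "L2 (lebesgue_on \<Omega>) G" "\<And>k. test_fun \<Omega> (\<phi> k) (g k)"
    "L2_tendsto (lebesgue_on \<Omega>) \<phi> u"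
    "L2_tendsto (lebesgue_on \<Omega>) g G"
  using assms(3) unfolding H10_iff[OF assms(1,2)] by blast

lemma H10_L2:
  assumes "open \<Omega>" "bounded \<Omega>" "H10 \<Omega> u G"
  shows "L2 (lebesgue_on \<Omega>) u" "L2 (lebesgue_on \<Omega>) G"
  using assms(3) unfolding H10_iff[OF assms(1,2)] by blast+

lemma H10_test_fun:
  assumes "open \<Omega>" "bounded \<Omega>" "test_fun \<Omega> u g"
  shows "H10 \<Omega> u g"
  by (rule H10I[OF assms(1,2) test_fun_L2[OF assms] assms(3)]) simp_all

lemma tendsto_L2_add:
  assumes "\<And>n. L2 M (f n)" "L2 M f'" "\<And>n. L2 M (g n)" "L2 M g'"
    and "L2_tendsto M f f'"
    and "L2_tendsto M g g'"
  shows "L2_tendsto M (\<lambda>n x. f n x + g n x) (\<lambda>x. f' x + g' x)"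
proof (rule tendsto_sandwich[OF always_eventually always_eventually, of "\<lambda>_. 0"])
  note df = L2_diff[OF assms(1,2)] and dg = L2_diff[OF assms(3,4)]
  show "\<forall>n. L2sq M (\<lambda>x. (f n x + g n x) - (f' x + g' x))
      \<le> 2 * L2sq M (\<lambda>x. f n x - f' x) + 2 * L2sq M (\<lambda>x. g n x - g' x)"
  proof
    fix n
    have "L2sq M (\<lambda>x. (f n x - f' x) + (g n x - g' x))
        \<le> (\<integral>x. 2 * (norm (f n x - f' x))^2 + 2 * (norm (g n x - g' x))^2 \<partial>M)"
      by (intro integral_mono L2_integrable_square L2_add Bochner_Integration.integrable_add
          integrable_mult_right df dg norm_add_square_le)
    then show "L2sq M (\<lambda>x. (f n x + g n x) - (f' x + g' x))
      \<le> 2 * L2sq M (\<lambda>x. f n x - f' x) + 2 * L2sq M (\<lambda>x. g n x - g' x)"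
      using L2_integrable_square[OF df] L2_integrable_square[OF dg]
      by (simp add: add_diff_add)
  qed
  show "(\<lambda>n. 2 * L2sq M (\<lambda>x. f n x - f' x) + 2 * L2sq M (\<lambda>x. g n x - g' x)) \<longlonglongrightarrow> 0"
    using tendsto_add[OF tendsto_mult_right_zero[OF assms(5), of 2] tendsto_mult_right_zero[OF assms(6), of 2]] by simp
qed auto

lemma tendsto_L2_scaleR:
  assumes "L2_tendsto M f f'"
  shows "L2_tendsto M (\<lambda>n x. c *\<^sub>R f n x) (\<lambda>x. c *\<^sub>R f' x)"
  using tendsto_mult_right_zero[OF assms, of "c^2"]
  by (simp add: scaleR_diff_right[symmetric] power_mult_distrib)

lemma H10_add_scaled:
  assumes \<Omega>: "open \<Omega>" "bounded \<Omega>" and u: "H10 \<Omega> u G" and v: "H10 \<Omega> v K"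
  shows "H10 \<Omega> (\<lambda>x. u x + c * v x) (\<lambda>x. G x + c *\<^sub>R K x)"
proof -
  obtain \<phi> g where 1: "\<And>k. test_fun \<Omega> (\<phi> k) (g k)"
      "L2_tendsto (lebesgue_on \<Omega>) \<phi> u"
      "L2_tendsto (lebesgue_on \<Omega>) g G"
    and L1: "L2 (lebesgue_on \<Omega>) u" "L2 (lebesgue_on \<Omega>) G"
    using u unfolding H10_iff[OF \<Omega>] by blast
  obtain \<eta> k where 2: "\<And>n. test_fun \<Omega> (\<eta> n) (k n)"
      "L2_tendsto (lebesgue_on \<Omega>) \<eta> v"
      "L2_tendsto (lebesgue_on \<Omega>) k K"
    and L2: "L2 (lebesgue_on \<Omega>) v" "L2 (lebesgue_on \<Omega>) K"
    using v unfolding H10_iff[OF \<Omega>] by blast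
  note t1 = test_fun_L2[OF \<Omega> 1(1)] and t2 = test_fun_L2[OF \<Omega> 2(1)]
  have "L2_tendsto (lebesgue_on \<Omega>) (\<lambda>n x. \<phi> n x + c *\<^sub>R \<eta> n x) (\<lambda>x. u x + c *\<^sub>R v x)"
    by (rule tendsto_L2_add[OF t1(1) L1(1) L2_scaleR[OF t2(1)] L2_scaleR[OF L2(1)] 1(2) tendsto_L2_scaleR[OF 2(2)]])
  moreover have "L2_tendsto (lebesgue_on \<Omega>) (\<lambda>n x. g n x + c *\<^sub>R k n x) (\<lambda>x. G x + c *\<^sub>R K x)"
    by (rule tendsto_L2_add[OF t1(2) L1(2) L2_scaleR[OF t2(2)] L2_scaleR[OF L2(2)] 1(3) tendsto_L2_scaleR[OF 2(3)]])
  moreover have "test_fun \<Omega> (\<lambda>x. \<phi> n x + c *\<^sub>R \<eta> n x) (\<lambda>x. g n x + c *\<^sub>R k n x)" for n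
    using test_fun_add[OF 1(1) test_fun_scale[OF 2(1)]] by simp
  moreover have "L2 (lebesgue_on \<Omega>) (\<lambda>x. u x + c *\<^sub>R v x)" "L2 (lebesgue_on \<Omega>) (\<lambda>x. G x + c *\<^sub>R K x)"
    by (intro L2_add L2_scaleR L1 L2)+
  ultimately have "H10 \<Omega> (\<lambda>x. u x + c *\<^sub>R v x) (\<lambda>x. G x + c *\<^sub>R K x)"
    by (intro H10I[OF \<Omega>])
  then show ?thesis by simp
qed

section \<open>Ball averages of test functions\<close>

text \<open>With c the mean of F' on the unit interval, the integral of (F' - c)^2 is nonnegative
  and equals the integral of (F')^2 minus c^2.\<close>

lemma integral_square_ge_unit_interval:
  fixes F' :: "real \<Rightarrow> real"
  assumes F: "\<And>t. t \<in> {0..1} \<Longrightarrow> (F has_vector_derivative F' t) (at t within {0..1})"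
    and F': "continuous_on {0..1} F'"
  shows "(F 1 - F 0)^2 \<le> integral {0..1} (\<lambda>t. (F' t)^2)"
proof -
  define c where "c = F 1 - F 0"
  have 1: "(F' has_integral c) {0..1}"
    unfolding c_def by (rule fundamental_theorem_of_calculus) (auto intro: F)
  have 2: "(\<lambda>t. (F' t)^2) integrable_on {0..1}"
    by (intro integrable_continuous_real continuous_intros F')
  have "((\<lambda>t. (F' t)^2 - 2 * c * F' t + c^2) has_integral (integral {0..1} (\<lambda>t. (F' t)^2) - 2 * c * c + c^2)) {0..1}"
    using has_integral_const_real[of "c^2" 0 1]
    by (intro has_integral_add has_integral_diff has_integral_mult_right integrable_integral 1 2) simp
  then have "0 \<le> integral {0..1} (\<lambda>t. (F' t)^2) - 2 * c * c + c^2"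
  proof (rule has_integral_nonneg)
    show "0 \<le> (F' t)^2 - 2 * c * F' t + c^2" for t
      using zero_le_power2[of "F' t - c"] by (simp add: power2_diff mult_ac)
  qed
  then show ?thesis by (simp add: c_def[symmetric] power2_eq_square)
qed

text \<open>Parametrising the segment by \<open>x + t\<^sup>m z\<close> makes the weight \<open>t\<^sup>2\<^sup>m\<^sup>-\<^sup>2\<close> appear; for large \<open>m\<close> it
  absorbs the singularity in \<open>t\<close> that a weight function in \<open>L\<^sup>p\<close> produces.\<close>
lemma test_fun_increment_square_le:
  assumes t: "test_fun \<Omega> v g" and m: "m \<ge> 1"
  shows "ennreal ((v (x + z) - v x)^2) \<le>
    (\<integral>\<^sup>+s\<in>{0..1}. ennreal ((norm z)^2 * (real m)^2 * s^(2*m-2)) * ennreal ((norm (g (x + s^m *\<^sub>R z)))^2) \<partial>lborel)"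
proof -
  define F where "F = (\<lambda>s. v (x + s^m *\<^sub>R z))"
  define F' where "F' = (\<lambda>s. g (x + s^m *\<^sub>R z) \<bullet> ((real m * s^(m-1)) *\<^sub>R z))"
  define k where "k = (\<lambda>s. (norm z)^2 * (real m)^2 * s^(2*m-2) * (norm (g (x + s^m *\<^sub>R z)))^2)"
  have cg: "continuous_on S (\<lambda>s. g (x + s^m *\<^sub>R z))" for S
    by (intro continuous_on_compose2[OF test_fun_D(2)[OF t]] continuous_intros) auto
  have kc: "continuous_on S k" for S
    unfolding k_def by (intro continuous_intros cg)
  have kp: "0 \<le> k s" if "s \<in> {0..1}" for s using that by (simp add: k_def)
  have d: "(F has_vector_derivative F' s) (at s within {0..1})" for s
  proof -
    have "((\<lambda>s. x + s^m *\<^sub>R z) has_derivative (\<lambda>y. y *\<^sub>R ((real m * s^(m-1)) *\<^sub>R z))) (at s within {0..1})"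
      by (auto intro!: derivative_eq_intros simp: fun_eq_iff mult_ac)
    from has_derivative_compose[OF this test_fun_D(3)[OF t]]
    show ?thesis unfolding F_def F'_def has_vector_derivative_def by (simp add: mult.assoc)
  qed
  have F'k: "(F' s)^2 \<le> k s" for s
  proof -
    have "(F' s)^2 \<le> (norm (g (x + s^m *\<^sub>R z)))^2 * (norm ((real m * s^(m-1)) *\<^sub>R z))^2"
      unfolding F'_def power2_norm_eq_inner by (rule Cauchy_Schwarz_ineq)
    also have "\<dots> = k s"
    proof -
      have "(s^(m-1))^2 = s^(2*m-2)" by (simp add: power_mult[symmetric] diff_mult_distrib2 mult.commute)
      then show ?thesis by (simp add: k_def power_mult_distrib mult_ac)
    qed
    finally show ?thesis .
  qed
  have "(v (x + z) - v x)^2 = (F 1 - F 0)^2"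
    using m by (simp add: F_def power_0_left)
  also have "\<dots> \<le> integral {0..1} (\<lambda>t. (F' t)^2)"
    by (rule integral_square_ge_unit_interval[OF d]) (auto simp: F'_def intro!: continuous_intros cg)
  also have "\<dots> \<le> integral {0..1} k"
    by (intro integral_le integrable_continuous_real kc F'k) (auto simp: F'_def intro!: continuous_intros cg)
  finally have "ennreal ((v (x + z) - v x)^2) \<le> ennreal (integral {0..1} k)" by (rule ennreal_leI)
  \<comment> \<open>From the gauge integral to a nonnegative Lebesgue integral, for which Tonelli
    asks for measurability only.\<close>
  also have "\<dots> = (\<integral>\<^sup>+s. ennreal (indicator {0..1} s * k s) \<partial>lborel)"
  proof (rule nn_integral_has_integral_lborel[symmetric])
    show "(\<lambda>s. indicator {0..1} s * k s) \<in> borel_measurable borel"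
      using borel_measurable_continuous_onI[OF kc] by measurable
    show "0 \<le> indicator {0..1} s * k s" for s using kp by (auto simp: indicator_def)
    have "(k has_integral integral {0..1} k) {0..1}"
      by (intro integrable_integral integrable_continuous_real kc)
    then have "((\<lambda>s. if s \<in> {0..1} then k s else 0) has_integral integral {0..1} k) UNIV"
      by (simp only: has_integral_restrict_UNIV)
    then show "((\<lambda>s. indicator {0..1} s * k s) has_integral integral {0..1} k) UNIV"
      by (rule has_integral_eq[rotated]) (auto simp: indicator_def)
  qed
  also have "\<dots> = (\<integral>\<^sup>+s\<in>{0..1}. ennreal ((norm z)^2 * (real m)^2 * s^(2*m-2)) * ennreal ((norm (g (x + s^m *\<^sub>R z)))^2) \<partial>lborel)"
    by (intro nn_integral_cong) (auto simp: indicator_def k_def ennreal_mult[symmetric])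
  finally show ?thesis .
qed

section \<open>Change of variables and uniform averages over balls\<close>

lemma nn_integral_lborel_translate:
  fixes V :: "'a::euclidean_space \<Rightarrow> ennreal"
  assumes "V \<in> borel_measurable borel"
  shows "(\<integral>\<^sup>+x. V (x + z) \<partial>lborel) = (\<integral>\<^sup>+x. V x \<partial>lborel)"
proof -
  have "(\<integral>\<^sup>+x. V x \<partial>lborel) = (\<integral>\<^sup>+x. V x \<partial>distr lborel borel ((+) z))"
    by (simp add: lborel_distr_plus)
  also have "\<dots> = (\<integral>\<^sup>+x. V (z + x) \<partial>lborel)"
    using assms by (intro nn_integral_distr) auto
  finally show ?thesis by (simp add: add.commute)
qed

lemma nn_integral_lborel_affine:
  fixes V :: "'a::euclidean_space \<Rightarrow> ennreal"
  assumes [measurable]: "V \<in> borel_measurable borel" and s: "s > 0"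
  shows "(\<integral>\<^sup>+y. V (c + s *\<^sub>R y) \<partial>lborel) = ennreal (1 / s ^ DIM('a)) * (\<integral>\<^sup>+y. V y \<partial>lborel)"
proof -
  have "(\<integral>\<^sup>+y. V y \<partial>lborel) = (\<integral>\<^sup>+y. V y \<partial>density (distr lborel borel (\<lambda>x. c + s *\<^sub>R x)) (\<lambda>_. ennreal (\<bar>s\<bar> ^ DIM('a))))"
    using lborel_affine[of s c] s by simp
  also have "\<dots> = ennreal (s ^ DIM('a)) * (\<integral>\<^sup>+y. V (c + s *\<^sub>R y) \<partial>lborel)"
    using s by (subst nn_integral_density) (auto simp: nn_integral_distr nn_integral_cmult)
  finally have "(\<integral>\<^sup>+y. V y \<partial>lborel) = ennreal (s ^ DIM('a)) * (\<integral>\<^sup>+y. V (c + s *\<^sub>R y) \<partial>lborel)" .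
  moreover have "ennreal (1 / s ^ DIM('a)) * ennreal (s ^ DIM('a)) = 1"
    using s by (simp add: ennreal_mult[symmetric])
  ultimately show ?thesis by (simp add: mult.assoc[symmetric])
qed

text \<open>A single probability measure serves for all balls: the mean over the ball of radius r
  around x is the integral of \<open>v (x + r *\<^sub>R y)\<close> in y. Centre and radius enter
  through the integrand alone, so orders of integration can be exchanged freely.\<close>

definition ball_uniform :: "'a::euclidean_space measure" where
  "ball_uniform = uniform_measure lborel (ball 0 1)"

abbreviation unit_ball_volume :: "'a::euclidean_space itself \<Rightarrow> real" where
  "unit_ball_volume _ \<equiv> measure lborel (ball (0::'a) 1)"

abbreviation nn_ball_avg :: "real \<Rightarrow> ('a::euclidean_space \<Rightarrow> ennreal) \<Rightarrow> 'a \<Rightarrow> ennreal" where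
  "nn_ball_avg s V x \<equiv> (\<integral>\<^sup>+y. V (x + s *\<^sub>R y) \<partial>ball_uniform)"

lemma sets_ball_uniform [measurable_cong]: "sets ball_uniform = sets borel"
  by (simp add: ball_uniform_def)

lemma space_ball_uniform [simp]: "space ball_uniform = UNIV"
  by (simp add: ball_uniform_def)

lemma unit_ball_volume_pos: "unit_ball_volume TYPE('a::euclidean_space) > 0"
  using content_ball_pos[of 1 "0::'a"] by simp

lemma emeasure_unit_ball: "emeasure lborel (ball (0::'a::euclidean_space) 1) = ennreal (unit_ball_volume TYPE('a))"
  by (intro emeasure_eq_ennreal_measure) (use emeasure_bounded_finite[of "ball (0::'a) 1"] in auto)

lemma emeasure_ball_uniform: "emeasure (ball_uniform :: 'a::euclidean_space measure) UNIV = 1"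
proof -
  have "emeasure lborel (ball (0::'a) 1) \<noteq> 0" "emeasure lborel (ball (0::'a) 1) \<noteq> \<infinity>"
    using unit_ball_volume_pos[where 'a='a] by (auto simp: emeasure_unit_ball)
  then show ?thesis
    unfolding ball_uniform_def using emeasure_uniform_measure_1[of lborel "ball (0::'a) 1"] by simp
qed

interpretation ball_uniform: finite_measure "ball_uniform :: 'a::euclidean_space measure"
  by standard (simp add: emeasure_ball_uniform)

lemma measure_ball_uniform: "measure (ball_uniform :: 'a::euclidean_space measure) UNIV = 1"
  by (simp add: measure_def emeasure_ball_uniform)

lemma AE_ball_uniform: "AE y in ball_uniform. norm y < 1"
  unfolding ball_uniform_def by (rule AE_uniform_measureI) auto

text \<open>The supremum bound for averages: enlarging the ball to the whole space leaves only the
  normalisation, of order s^(-N).\<close>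

lemma nn_integral_ball_uniform_affine_le:
  fixes V :: "'a::euclidean_space \<Rightarrow> ennreal"
  assumes [measurable]: "V \<in> borel_measurable borel" and s: "s > 0"
  shows "nn_ball_avg s V c
    \<le> ennreal (1 / (unit_ball_volume TYPE('a) * s ^ DIM('a))) * (\<integral>\<^sup>+y. V y \<partial>lborel)"
proof -
  let ?b = "unit_ball_volume TYPE('a)"
  note b = unit_ball_volume_pos[where 'a='a]
  have "nn_ball_avg s V c
      = (\<integral>\<^sup>+y. V (c + s *\<^sub>R y) * indicator (ball 0 1) y \<partial>lborel) / ennreal ?b"
    unfolding ball_uniform_def by (subst nn_integral_uniform_measure) (auto simp: emeasure_unit_ball)
  also have "\<dots> \<le> (\<integral>\<^sup>+y. V (c + s *\<^sub>R y) \<partial>lborel) / ennreal ?b"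
    by (intro divide_right_mono_ennreal nn_integral_mono) (auto simp: indicator_def)
  also have "\<dots> = ennreal (1 / ?b) * (ennreal (1 / s ^ DIM('a)) * (\<integral>\<^sup>+y. V y \<partial>lborel))"
    unfolding nn_integral_lborel_affine[OF assms]
    using b by (simp add: divide_ennreal_def inverse_ennreal inverse_eq_divide mult_ac)
  also have "\<dots> = ennreal (1 / (?b * s ^ DIM('a))) * (\<integral>\<^sup>+y. V y \<partial>lborel)"
    using b s by (simp add: mult.assoc[symmetric] ennreal_mult[symmetric])
  finally show ?thesis .
qed

text \<open>Averaging preserves total mass, by Tonelli and translation invariance. Together with the
  supremum bound this supplies the two endpoints that \<open>weighted_ball_average_le\<close>
  interpolates.\<close>

lemma nn_integral_ball_uniform_translate:
  fixes V :: "'a::euclidean_space \<Rightarrow> ennreal"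
  assumes [measurable]: "V \<in> borel_measurable borel"
  shows "(\<integral>\<^sup>+x. nn_ball_avg s V x \<partial>lborel) = (\<integral>\<^sup>+x. V x \<partial>lborel)"
proof -
  interpret pair_sigma_finite "ball_uniform :: 'a measure" "lborel :: 'a measure"
    by unfold_locales
  have "(\<integral>\<^sup>+x. nn_ball_avg s V x \<partial>lborel)
      = (\<integral>\<^sup>+y. (\<integral>\<^sup>+x. V (x + s *\<^sub>R y) \<partial>lborel) \<partial>ball_uniform)"
    by (rule Fubini') measurable
  also have "\<dots> = (\<integral>\<^sup>+x. V x \<partial>lborel)"
    by (simp add: nn_integral_lborel_translate emeasure_ball_uniform)
  finally show ?thesis .
qed

text \<open>Above the level t one has a = a^(1-p) a^p, and the exponent 1 - p is at most 0.
  Splitting a weight in this way takes the place of Hoelder's inequality.\<close>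

lemma le_add_powr:
  fixes a t p :: real
  assumes "0 \<le> a" "0 < t" "1 \<le> p"
  shows "a \<le> t + t powr (1 - p) * a powr p"
proof (cases "a \<le> t")
  case True
  then show ?thesis using assms by (simp add: add_increasing2)
next
  case False
  then have a: "a > 0" "t < a" using assms by auto
  have "a = a powr (1 - p) * a powr p"
    using a by (simp add: powr_add[symmetric])
  also have "\<dots> \<le> t powr (1 - p) * a powr p"
    using assms a by (intro mult_right_mono powr_mono2') auto
  finally show ?thesis using assms by simp
qed

text \<open>Split the weight at a level t by \<open>le_add_powr\<close>. The bounded part is paired
  with the average through conservation of mass, the part with w^p through the supremum
  bound.\<close>

lemma weighted_ball_average_le:
  fixes V :: "'a::euclidean_space \<Rightarrow> ennreal" and w :: "'a \<Rightarrow> real"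
  assumes [measurable]: "V \<in> borel_measurable borel" "w \<in> borel_measurable borel"
    and w: "\<And>x. 0 \<le> w x" and p: "1 \<le> p" and s: "s > 0" and F: "(\<integral>\<^sup>+x. ennreal (w x powr p) \<partial>lborel) \<le> ennreal F" "0 \<le> F"
  shows "(\<integral>\<^sup>+x. ennreal (w x) * nn_ball_avg s V x \<partial>lborel)
    \<le> ennreal (s powr (- real DIM('a) / p) * (1 + F / unit_ball_volume TYPE('a))) * (\<integral>\<^sup>+x. V x \<partial>lborel)"
proof -
  let ?N = "real DIM('a)" and ?b = "unit_ball_volume TYPE('a)"
  note b = unit_ball_volume_pos[where 'a='a]
  \<comment> \<open>The level that balances both parts: t^(1-p) s^(-N) = t.\<close>
  define t where "t = s powr (- ?N / p)"
  have t: "t > 0" using s by (simp add: t_def)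
  define U where "U = (\<lambda>x. \<integral>\<^sup>+y. V (x + s *\<^sub>R y) \<partial>ball_uniform)"
  have [measurable]: "U \<in> borel_measurable borel" unfolding U_def by measurable
  define A where "A = (\<integral>\<^sup>+x. V x \<partial>lborel)"
  have U: "U x \<le> ennreal (1 / (?b * s ^ DIM('a))) * A" for x
    unfolding U_def A_def by (rule nn_integral_ball_uniform_affine_le) (use s in auto)
  have "(\<integral>\<^sup>+x. ennreal (w x) * U x \<partial>lborel)
      \<le> (\<integral>\<^sup>+x. ennreal t * U x + ennreal (t powr (1 - p)) * (ennreal (w x powr p) * (ennreal (1 / (?b * s ^ DIM('a))) * A)) \<partial>lborel)"
  proof (rule nn_integral_mono)
    fix x
    have "ennreal (w x) * U x \<le> ennreal (t + t powr (1 - p) * w x powr p) * U x"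
      by (intro mult_right_mono ennreal_leI le_add_powr w t p) auto
    also have "\<dots> = ennreal t * U x + ennreal (t powr (1 - p)) * (ennreal (w x powr p) * U x)"
      using t by (simp add: ennreal_mult distrib_right mult.assoc)
    also have "\<dots> \<le> ennreal t * U x + ennreal (t powr (1 - p)) * (ennreal (w x powr p) * (ennreal (1 / (?b * s ^ DIM('a))) * A))"
      by (intro add_left_mono mult_left_mono U) auto
    finally show "ennreal (w x) * U x \<le> \<dots>" .
  qed
  also have "\<dots> = ennreal t * A + ennreal (t powr (1 - p)) * ((\<integral>\<^sup>+x. ennreal (w x powr p) \<partial>lborel) * (ennreal (1 / (?b * s ^ DIM('a))) * A))"
  proof -
    have "(\<integral>\<^sup>+x. U x \<partial>lborel) = A"
      unfolding U_def A_def by (rule nn_integral_ball_uniform_translate) measurable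
    then show ?thesis
      by (simp add: nn_integral_add nn_integral_cmult nn_integral_multc)
  qed
  also have "\<dots> \<le> ennreal t * A + ennreal (t powr (1 - p)) * (ennreal F * (ennreal (1 / (?b * s ^ DIM('a))) * A))"
    by (intro add_left_mono mult_left_mono mult_right_mono F) auto
  also have "\<dots> = ennreal (t + t powr (1 - p) * (F * (1 / (?b * s ^ DIM('a))))) * A"
  proof -
    define q where "q = 1 / (?b * s ^ DIM('a))"
    have "0 \<le> q" using s by (simp add: q_def)
    then show ?thesis
      unfolding q_def[symmetric] using t F by (simp add: ennreal_mult distrib_right mult.assoc)
  qed
  also have "t + t powr (1 - p) * (F * (1 / (?b * s ^ DIM('a)))) = t * (1 + F / ?b)"
  proof -
    have "t powr (1 - p) = s powr (?N - ?N / p)"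
    proof -
      have "- ?N / p * (1 - p) = ?N - ?N / p" using p by (simp add: field_simps)
      then show ?thesis unfolding t_def powr_powr by simp
    qed
    also have "\<dots> = s ^ DIM('a) * t"
      using s by (simp add: t_def powr_diff powr_minus powr_realpow divide_inverse)
    finally show ?thesis using s b by (simp add: field_simps)
  qed
  finally show ?thesis unfolding U_def A_def t_def .
qed


section \<open>Boundedness, equicontinuity and oscillation of averages\<close>

definition ball_avg :: "real \<Rightarrow> ('a::euclidean_space \<Rightarrow> real) \<Rightarrow> 'a \<Rightarrow> real" where
  "ball_avg r v x = (\<integral>y. v (x + r *\<^sub>R y) \<partial>ball_uniform)"

text \<open>Cauchy-Schwarz against 1 for a probability measure; the bound B secures
  integrability.\<close>

lemma ball_uniform_Jensen_square:
  assumes [measurable]: "k \<in> borel_measurable borel" and B: "\<And>y. \<bar>k y\<bar> \<le> B"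
  shows "ennreal ((\<integral>y. k y \<partial>ball_uniform)^2) \<le> (\<integral>\<^sup>+y. ennreal ((k y)^2) \<partial>ball_uniform)"
proof -
  have i: "integrable ball_uniform (\<lambda>y. (k y)^2)"
  proof (rule ball_uniform.integrable_const_bound[of _ "B^2"])
    show "AE y in ball_uniform. norm ((k y)^2) \<le> B^2"
      using power_mono[OF B abs_ge_zero, where n=2] by (intro always_eventually allI) simp
  qed measurable
  then have "L2 ball_uniform k" by (simp add: L2_def)
  from ball_uniform.L2_integrable_norm_bound[OF this]
  have "(\<integral>y. \<bar>k y\<bar> \<partial>ball_uniform)^2 \<le> (\<integral>y. (k y)^2 \<partial>ball_uniform)"
    by (simp add: measure_ball_uniform)
  moreover have "(\<integral>y. k y \<partial>ball_uniform)^2 \<le> (\<integral>y. \<bar>k y\<bar> \<partial>ball_uniform)^2"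
    using integral_abs_bound[of ball_uniform k] by (simp add: abs_le_square_iff[symmetric])
  ultimately have "ennreal ((\<integral>y. k y \<partial>ball_uniform)^2) \<le> ennreal (\<integral>y. (k y)^2 \<partial>ball_uniform)"
    by (intro ennreal_leI) linarith
  also have "\<dots> = (\<integral>\<^sup>+y. ennreal ((k y)^2) \<partial>ball_uniform)"
    by (rule nn_integral_eq_integral[symmetric, OF i]) simp
  finally show ?thesis .
qed

lemma test_fun_borel:
  assumes "test_fun \<Omega> v g"
  shows "v \<in> borel_measurable borel" "g \<in> borel_measurable borel"
  using test_fun_D[OF assms] by (auto intro: borel_measurable_continuous_onI)

lemma test_fun_integrable_ball_uniform:
  assumes t: "test_fun \<Omega> v g"
  shows "integrable ball_uniform (\<lambda>y. v (x + r *\<^sub>R y))"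
proof -
  note [measurable] = test_fun_borel[OF t]
  obtain B where B: "B \<ge> 0" "\<And>x. \<bar>v x\<bar> \<le> B" "\<And>x. norm (g x) \<le> B"
    by (rule test_fun_bounded[OF t]) blast
  show ?thesis
    by (rule ball_uniform.integrable_const_bound[of _ B]) (use B in auto)
qed

lemma ball_avg_square_le:
  fixes v :: "real^'n \<Rightarrow> real"
  assumes t: "test_fun \<Omega> v g" and r: "r > 0"
  shows "ennreal ((ball_avg r v x)^2)
    \<le> ennreal (1 / (unit_ball_volume TYPE(real^'n) * r ^ CARD('n))) * (\<integral>\<^sup>+y. ennreal ((v y)^2) \<partial>lborel)"
proof -
  note [measurable] = test_fun_borel[OF t]
  obtain B where B: "B \<ge> 0" "\<And>x. \<bar>v x\<bar> \<le> B" "\<And>x. norm (g x) \<le> B"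
    by (rule test_fun_bounded[OF t]) blast
  have "ennreal ((ball_avg r v x)^2) \<le> (\<integral>\<^sup>+y. ennreal ((v (x + r *\<^sub>R y))^2) \<partial>ball_uniform)"
    unfolding ball_avg_def by (rule ball_uniform_Jensen_square) (use B in auto)
  also have "\<dots> \<le> ennreal (1 / (unit_ball_volume TYPE(real^'n) * r ^ DIM(real^'n))) * (\<integral>\<^sup>+y. ennreal ((v y)^2) \<partial>lborel)"
    by (rule nn_integral_ball_uniform_affine_le[of "\<lambda>y. ennreal ((v y)^2)"]) (use r in auto)
  finally show ?thesis by simp
qed

text \<open>The increment of the average is the average of increments along z. After exchanging the
  integrals, the squared gradient is averaged over a ball around the moving centre
  \<open>x + s *\<^sub>R z\<close>, and the supremum bound is uniform in that centre.\<close>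

lemma ball_avg_increment_square_le:
  fixes v :: "real^'n \<Rightarrow> real"
  assumes t: "test_fun \<Omega> v g" and r: "r > 0"
  shows "ennreal ((ball_avg r v (x + z) - ball_avg r v x)^2)
    \<le> ennreal ((norm z)^2 / (unit_ball_volume TYPE(real^'n) * r ^ CARD('n))) * (\<integral>\<^sup>+y. ennreal ((norm (g y))^2) \<partial>lborel)"
proof -
  note [measurable] = test_fun_borel[OF t]
  obtain B where B: "B \<ge> 0" "\<And>x. \<bar>v x\<bar> \<le> B" "\<And>x. norm (g x) \<le> B"
    by (rule test_fun_bounded[OF t]) blast
  let ?V = "\<lambda>y. ennreal ((norm (g y))^2)"
  let ?q = "1 / (unit_ball_volume TYPE(real^'n) * r ^ CARD('n))"
  define k where "k = (\<lambda>y. v (x + z + r *\<^sub>R y) - v (x + r *\<^sub>R y))"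
  have "ball_avg r v (x + z) - ball_avg r v x = (\<integral>y. k y \<partial>ball_uniform)"
    unfolding ball_avg_def k_def
    by (intro Bochner_Integration.integral_diff[symmetric] test_fun_integrable_ball_uniform[OF t])
  then have "ennreal ((ball_avg r v (x + z) - ball_avg r v x)^2) = ennreal ((\<integral>y. k y \<partial>ball_uniform)^2)" by simp
  also have "\<dots> \<le> (\<integral>\<^sup>+y. ennreal ((k y)^2) \<partial>ball_uniform)"
  proof (rule ball_uniform_Jensen_square)
    show "k \<in> borel_measurable borel" unfolding k_def by measurable
    show "\<bar>k y\<bar> \<le> 2 * B" for y
      unfolding k_def using B(2)[of "x + z + r *\<^sub>R y"] B(2)[of "x + r *\<^sub>R y"] by linarith
  qed
  also have "\<dots> \<le> (\<integral>\<^sup>+y. (\<integral>\<^sup>+s. ennreal ((norm z)^2) * ?V (x + s *\<^sub>R z + r *\<^sub>R y) * indicator {0..1} s \<partial>lborel) \<partial>ball_uniform)"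
  proof (rule nn_integral_mono)
    fix y
    show "ennreal ((k y)^2) \<le> (\<integral>\<^sup>+s. ennreal ((norm z)^2) * ?V (x + s *\<^sub>R z + r *\<^sub>R y) * indicator {0..1} s \<partial>lborel)"
      using test_fun_increment_square_le[OF t, of 1 "x + r *\<^sub>R y" z] by (simp add: k_def add_ac)
  qed
  also have "\<dots> = (\<integral>\<^sup>+s. (\<integral>\<^sup>+y. ennreal ((norm z)^2) * ?V (x + s *\<^sub>R z + r *\<^sub>R y) * indicator {0..1} s \<partial>ball_uniform) \<partial>lborel)"
  proof -
    interpret pair_sigma_finite "lborel :: real measure" "ball_uniform :: (real^'n) measure" by unfold_locales
    show ?thesis by (rule Fubini') measurable
  qed
  also have "\<dots> \<le> (\<integral>\<^sup>+s. ennreal ((norm z)^2) * (ennreal ?q * (\<integral>\<^sup>+y. ?V y \<partial>lborel)) * indicator {0..1} s \<partial>(lborel::real measure))"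
  proof (rule nn_integral_mono)
    fix s :: real
    have "(\<integral>\<^sup>+y. ?V (x + s *\<^sub>R z + r *\<^sub>R y) \<partial>ball_uniform) \<le> ennreal (1 / (unit_ball_volume TYPE(real^'n) * r ^ DIM(real^'n))) * (\<integral>\<^sup>+y. ?V y \<partial>lborel)"
      by (rule nn_integral_ball_uniform_affine_le[of ?V]) (use r in auto)
    then show "(\<integral>\<^sup>+y. ennreal ((norm z)^2) * ?V (x + s *\<^sub>R z + r *\<^sub>R y) * indicator {0..1} s \<partial>ball_uniform)
      \<le> ennreal ((norm z)^2) * (ennreal ?q * (\<integral>\<^sup>+y. ?V y \<partial>lborel)) * indicator {0..1} s"
      by (simp add: nn_integral_cmult nn_integral_multc mult_left_mono mult_right_mono)
  qed
  also have "\<dots> = ennreal ((norm z)^2) * (ennreal ?q * (\<integral>\<^sup>+y. ?V y \<partial>lborel))"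
    by (subst nn_integral_cmult_indicator) auto
  also have "\<dots> = ennreal ((norm z)^2 * ?q) * (\<integral>\<^sup>+y. ?V y \<partial>lborel)"
    using r by (subst ennreal_mult) (auto simp: mult.assoc)
  finally show ?thesis by simp
qed

text \<open>If \<Omega> lies in the ball of radius R, translation by a vector of length 3R carries
  each of its points outside, where v vanishes. Hence v(x) is an increment up to sign, and
  integrating in x removes the shift; the constant is (3R)^2.\<close>

lemma test_fun_Poincare:
  fixes \<Omega> :: "(real^'n) set"
  assumes "bounded \<Omega>"
  obtains D where "D > 0" "\<And>v g. test_fun \<Omega> v g \<Longrightarrow>
    (\<integral>\<^sup>+x. ennreal ((v x)^2) \<partial>lborel) \<le> ennreal D * (\<integral>\<^sup>+x. ennreal ((norm (g x))^2) \<partial>lborel)"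
proof -
  obtain R where R: "R > 0" "\<And>x. x \<in> \<Omega> \<Longrightarrow> norm x \<le> R"
    using assms bounded_pos by metis
  obtain e :: "real^'n" where e: "norm e = 3 * R"
    using vector_choose_size[of "3 * R"] R by auto
  show thesis
  proof (rule that[of "(3 * R)^2"])
    fix v :: "real^'n \<Rightarrow> real" and g assume t: "test_fun \<Omega> v g"
    note [measurable] = test_fun_borel[OF t]
    let ?V = "\<lambda>y. ennreal ((norm (g y))^2)"
    have "(\<integral>\<^sup>+x. ennreal ((v x)^2) \<partial>lborel) \<le> (\<integral>\<^sup>+x. (\<integral>\<^sup>+s. ennreal ((norm e)^2) * ?V (x + s *\<^sub>R e) * indicator {0..1} s \<partial>lborel) \<partial>lborel)"
    proof (rule nn_integral_mono)
      fix x
      show "ennreal ((v x)^2) \<le> (\<integral>\<^sup>+s. ennreal ((norm e)^2) * ?V (x + s *\<^sub>R e) * indicator {0..1} s \<partial>lborel)"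
      proof (cases "x \<in> \<Omega>")
        case True
        have "norm e \<le> norm (x + e) + norm x"
          using norm_triangle_ineq4[of "x + e" x] by simp
        then have "x + e \<notin> \<Omega>" using R(1) R(2)[OF True] R(2)[of "x + e"] e by auto
        then have "v (x + e) = 0" using test_fun_outside_domain(1)[OF t] by blast
        then show ?thesis using test_fun_increment_square_le[OF t, of 1 x e] by simp
      qed (use test_fun_outside_domain(1)[OF t] in simp)
    qed
    also have "\<dots> = (\<integral>\<^sup>+s. (\<integral>\<^sup>+x. ennreal ((norm e)^2) * ?V (x + s *\<^sub>R e) * indicator {0..1} s \<partial>lborel) \<partial>lborel)"
      by (rule lborel_pair.Fubini') measurable
    also have "\<dots> = (\<integral>\<^sup>+s. ennreal ((norm e)^2) * (\<integral>\<^sup>+x. ?V x \<partial>lborel) * indicator {0..1} (s::real) \<partial>lborel)"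
      by (intro nn_integral_cong) (simp add: nn_integral_cmult nn_integral_multc nn_integral_lborel_translate[of ?V])
    also have "\<dots> = ennreal ((3 * R)^2) * (\<integral>\<^sup>+x. ?V x \<partial>lborel)"
      unfolding e by (subst nn_integral_cmult_indicator) auto
    finally show "(\<integral>\<^sup>+x. ennreal ((v x)^2) \<partial>lborel) \<le> ennreal ((3 * R)^2) * (\<integral>\<^sup>+x. ?V x \<partial>lborel)" .
  qed (use R in simp)
qed

text \<open>Each segment from x to \<open>x + r *\<^sub>R y\<close> is run through with parameter
  s^m. Averaging over y turns the gradient term into a ball average at radius r s^m, whose weighted
  integral costs (r s^m)^(-N/p). The second condition on m says that the resulting power of s is
  nonnegative.\<close>

lemma weighted_oscillation_le:
  fixes v :: "real^'n \<Rightarrow> real" and w :: "real^'n \<Rightarrow> real"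
  assumes t: "test_fun \<Omega> v g" and [measurable]: "w \<in> borel_measurable borel"
    and w: "\<And>x. 0 \<le> w x" and p: "1 \<le> p" and m: "m \<ge> 1" "2 \<le> real m * (2 - real CARD('n) / p)"
    and r: "r > 0" and F: "(\<integral>\<^sup>+x. ennreal (w x powr p) \<partial>lborel) \<le> ennreal F" "0 \<le> F"
  shows "(\<integral>\<^sup>+x. ennreal (w x) * ennreal ((v x - ball_avg r v x)^2) \<partial>lborel)
    \<le> ennreal (r powr (2 - real CARD('n) / p) * (real m)^2 * (1 + F / unit_ball_volume TYPE(real^'n)))
        * (\<integral>\<^sup>+x. ennreal ((norm (g x))^2) \<partial>lborel)"
proof -
  let ?N = "real CARD('n)" and ?b = "unit_ball_volume TYPE(real^'n)"
  define V where "V = (\<lambda>y. ennreal ((norm (g y))^2))"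
  define A where "A = (\<integral>\<^sup>+y. V y \<partial>lborel)"
  define c where "c = 1 + F / ?b"
  have c: "c \<ge> 0" using F unit_ball_volume_pos[where 'a="real^'n"] by (simp add: c_def)
  define k where "k = (\<lambda>s::real. ennreal (r^2 * (real m)^2 * s^(2*m-2)) * indicator {0..1} s)"
  note [measurable] = test_fun_borel[OF t]
  have [measurable]: "V \<in> borel_measurable borel" unfolding V_def by measurable
  have [measurable]: "k \<in> borel_measurable borel" unfolding k_def by measurable
  obtain B where B: "B \<ge> 0" "\<And>x. \<bar>v x\<bar> \<le> B" "\<And>x. norm (g x) \<le> B"
    by (rule test_fun_bounded[OF t]) blast
  interpret P: pair_sigma_finite "lborel :: real measure" "ball_uniform :: (real^'n) measure" by unfold_locales
  have osc: "ennreal ((v x - ball_avg r v x)^2)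
      \<le> (\<integral>\<^sup>+s. k s * nn_ball_avg (r * s^m) V x \<partial>lborel)" for x
  proof -
    define d where "d = (\<lambda>y. v (x + r *\<^sub>R y) - v x)"
    have "ball_avg r v x - v x = (\<integral>y. d y \<partial>ball_uniform)"
      unfolding ball_avg_def d_def
      by (subst Bochner_Integration.integral_diff[OF test_fun_integrable_ball_uniform[OF t]])
         (auto simp: measure_ball_uniform)
    then have "ennreal ((v x - ball_avg r v x)^2) = ennreal ((\<integral>y. d y \<partial>ball_uniform)^2)"
      by (simp add: power2_commute[of "v x"])
    also have "\<dots> \<le> (\<integral>\<^sup>+y. ennreal ((d y)^2) \<partial>ball_uniform)"
    proof (rule ball_uniform_Jensen_square)
      show "d \<in> borel_measurable borel" unfolding d_def by measurable
      show "\<bar>d y\<bar> \<le> 2 * B" for y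
        unfolding d_def using B(2)[of "x + r *\<^sub>R y"] B(2)[of x] by linarith
    qed
    also have "\<dots> \<le> (\<integral>\<^sup>+y. (\<integral>\<^sup>+s. k s * V (x + (r * s^m) *\<^sub>R y) \<partial>lborel) \<partial>ball_uniform)"
    proof (rule nn_integral_mono_AE, use AE_ball_uniform in eventually_elim)
      case (elim y)
      have le: "(norm (r *\<^sub>R y))^2 \<le> r^2"
        using elim r by (simp add: power_mult_distrib power_le_one mult_left_le)
      have "ennreal ((d y)^2) \<le> (\<integral>\<^sup>+s\<in>{0..1}. ennreal ((norm (r *\<^sub>R y))^2 * (real m)^2 * s^(2*m-2)) * V (x + s^m *\<^sub>R (r *\<^sub>R y)) \<partial>lborel)"
        unfolding d_def V_def by (rule test_fun_increment_square_le[OF t m(1)])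
      also have "\<dots> \<le> (\<integral>\<^sup>+s. k s * V (x + (r * s^m) *\<^sub>R y) \<partial>lborel)"
        unfolding k_def
        by (intro nn_integral_mono)
           (use le in \<open>auto simp: indicator_def mult.commute[of r] intro!: mult_right_mono ennreal_leI\<close>)
      finally show ?case .
    qed
    also have "\<dots> = (\<integral>\<^sup>+s. (\<integral>\<^sup>+y. k s * V (x + (r * s^m) *\<^sub>R y) \<partial>ball_uniform) \<partial>lborel)"
      by (rule P.Fubini') measurable
    also have "\<dots> = (\<integral>\<^sup>+s. k s * nn_ball_avg (r * s^m) V x \<partial>lborel)"
      by (intro nn_integral_cong nn_integral_cmult) measurable
    finally show ?thesis .
  qed
  have "(\<integral>\<^sup>+x. ennreal (w x) * ennreal ((v x - ball_avg r v x)^2) \<partial>lborel)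
      \<le> (\<integral>\<^sup>+x. (\<integral>\<^sup>+s. k s * (ennreal (w x) * nn_ball_avg (r * s^m) V x) \<partial>lborel) \<partial>lborel)"
  proof (rule nn_integral_mono)
    fix x
    have "ennreal (w x) * ennreal ((v x - ball_avg r v x)^2)
        \<le> ennreal (w x) * (\<integral>\<^sup>+s. k s * nn_ball_avg (r * s^m) V x \<partial>lborel)"
      by (intro mult_left_mono osc) auto
    also have "\<dots> = (\<integral>\<^sup>+s. ennreal (w x) * (k s * nn_ball_avg (r * s^m) V x) \<partial>lborel)"
      by (rule nn_integral_cmult[symmetric]) measurable
    finally show "ennreal (w x) * ennreal ((v x - ball_avg r v x)^2)
      \<le> (\<integral>\<^sup>+s. k s * (ennreal (w x) * nn_ball_avg (r * s^m) V x) \<partial>lborel)"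
      by (simp add: mult_ac)
  qed
  also have "\<dots> = (\<integral>\<^sup>+s. (\<integral>\<^sup>+x. k s * (ennreal (w x) * nn_ball_avg (r * s^m) V x) \<partial>lborel) \<partial>lborel)"
    by (rule lborel_pair.Fubini') measurable
  also have "\<dots> = (\<integral>\<^sup>+s. k s * (\<integral>\<^sup>+x. ennreal (w x) * nn_ball_avg (r * s^m) V x \<partial>lborel) \<partial>lborel)"
    by (intro nn_integral_cong nn_integral_cmult) measurable
  also have "\<dots> \<le> (\<integral>\<^sup>+s. ennreal (r powr (2 - ?N / p) * (real m)^2 * c) * A * indicator {0..1} (s::real) \<partial>lborel)"
  \<comment> \<open>The null set s = 0 is discarded because the estimate for averages requires a
    positive radius.\<close>
  proof (rule nn_integral_mono_AE, use AE_lborel_singleton[of "0::real"] in eventually_elim)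
    case (elim s)
    show ?case
    proof (cases "s \<in> {0..1}")
      case False then show ?thesis by (simp add: k_def)
    next
      case True
      with elim have s: "0 < s" "s \<le> 1" by auto
      have "(\<integral>\<^sup>+x. ennreal (w x) * nn_ball_avg (r * s^m) V x \<partial>lborel)
          \<le> ennreal ((r * s^m) powr (- ?N / p) * c) * A"
        unfolding c_def A_def
        using weighted_ball_average_le[of V w p "r * s^m" F] w p r s F by simp
      then have "k s * (\<integral>\<^sup>+x. ennreal (w x) * nn_ball_avg (r * s^m) V x \<partial>lborel)
          \<le> k s * (ennreal ((r * s^m) powr (- ?N / p) * c) * A)"
        by (rule mult_left_mono) simp
      also have "\<dots> = ennreal (r^2 * (real m)^2 * s^(2*m-2) * ((r * s^m) powr (- ?N / p) * c)) * A"
        using True s c r by (subst ennreal_mult) (auto simp: k_def mult.assoc)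
      also have "\<dots> \<le> ennreal (r powr (2 - ?N / p) * (real m)^2 * c) * A"
      proof (intro mult_right_mono ennreal_leI)
        \<comment> \<open>The exponent is m (2 - N/p) - 2, nonnegative by the choice of m, so on the
          unit interval this factor is at most 1.\<close>
        have "s^(2*m-2) * (s^m) powr (- ?N / p) = s powr (real (2*m-2) + real m * (- ?N / p))"
          using s by (simp add: powr_realpow[symmetric] powr_powr powr_add[symmetric])
        also have "\<dots> \<le> 1"
        proof -
          have "0 \<le> real (2*m-2) + real m * (- ?N / p)"
            using m by (simp add: of_nat_diff algebra_simps)
          then have "s powr (real (2*m-2) + real m * (- ?N / p)) \<le> 1 powr (real (2*m-2) + real m * (- ?N / p))"
            using s by (intro powr_mono2) auto
          then show ?thesis by simp
        qed
        finally have le: "s^(2*m-2) * (s^m) powr (- ?N / p) \<le> 1" .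
        have "r^2 * (real m)^2 * s^(2*m-2) * ((r * s^m) powr (- ?N / p) * c)
            = (r^2 * r powr (- ?N / p)) * (real m)^2 * c * (s^(2*m-2) * (s^m) powr (- ?N / p))"
          using r s by (simp add: powr_mult mult_ac)
        also have "\<dots> \<le> (r^2 * r powr (- ?N / p)) * (real m)^2 * c"
          using le c by (intro mult_left_le) auto
        also have "r^2 * r powr (- ?N / p) = r powr (2 - ?N / p)"
          using r by (simp add: powr_diff powr_minus powr_numeral divide_inverse)
        finally show "r^2 * (real m)^2 * s^(2*m-2) * ((r * s^m) powr (- ?N / p) * c) \<le> r powr (2 - ?N / p) * (real m)^2 * c" .
      qed simp
      finally show ?thesis using True by simp
    qed
  qed
  also have "\<dots> = ennreal (r powr (2 - ?N / p) * (real m)^2 * c) * A"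
    by (subst nn_integral_cmult_indicator) auto
  finally show ?thesis unfolding A_def V_def c_def .
qed

section \<open>Compactness with respect to an \<open>L\<^sup>p\<close> weight\<close>

lemma nn_integral_test_fun:
  assumes "open \<Omega>" and t: "test_fun \<Omega> v g"
  shows "(\<integral>\<^sup>+x. ennreal ((norm (g x))^2) \<partial>lborel) = ennreal (L2sq (lebesgue_on \<Omega>) g)"
    and "(\<integral>\<^sup>+x. ennreal ((v x)^2) \<partial>lborel) = ennreal (\<integral>x. (v x)^2 \<partial>lebesgue_on \<Omega>)"
proof -
  note i = test_fun_integrable_grad[OF t] and [measurable] = test_fun_borel[OF t]
  have g: "L2sq (lebesgue_on \<Omega>) g = (\<integral>x. (norm (g x))^2 \<partial>lborel)"
    by (rule integral_lebesgue_on_eq_lborel(1)[OF assms(1)])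
       (measurable, use test_fun_outside_domain(2)[OF t] in simp)
  have v: "(\<integral>x. (v x)^2 \<partial>lebesgue_on \<Omega>) = (\<integral>x. (v x)^2 \<partial>lborel)"
    by (rule integral_lebesgue_on_eq_lborel(1)[OF assms(1)])
       (measurable, use test_fun_outside_domain(1)[OF t] in simp)
  show "(\<integral>\<^sup>+x. ennreal ((norm (g x))^2) \<partial>lborel) = ennreal (L2sq (lebesgue_on \<Omega>) g)"
    unfolding g by (rule nn_integral_eq_integral[OF i(2)]) simp
  show "(\<integral>\<^sup>+x. ennreal ((v x)^2) \<partial>lborel) = ennreal (\<integral>x. (v x)^2 \<partial>lebesgue_on \<Omega>)"
    unfolding v by (rule nn_integral_eq_integral[OF i(4)]) simp
qed

lemma measurable_ball_avg:
  assumes [measurable]: "v \<in> borel_measurable borel"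
  shows "ball_avg r v \<in> borel_measurable borel"
  unfolding ball_avg_def[abs_def]
  by (rule ball_uniform.borel_measurable_lebesgue_integral) measurable

lemma ball_avg_diff:
  assumes "test_fun \<Omega> u g" "test_fun \<Omega> v k"
  shows "ball_avg r (\<lambda>x. u x - v x) x = ball_avg r u x - ball_avg r v x"
  unfolding ball_avg_def
  by (intro Bochner_Integration.integral_diff test_fun_integrable_ball_uniform[OF assms(1)] test_fun_integrable_ball_uniform[OF assms(2)])

section \<open>Estimates for a fixed domain and weight\<close>

locale weighted_domain =
  fixes \<Omega> :: "(real^'n) set" and f :: "real^'n \<Rightarrow> real" and p :: real
  assumes open_domain: "open \<Omega>" and bounded_domain: "bounded \<Omega>"
    and p: "1 \<le> p" "real CARD('n) / 2 < p"
    and f_measurable: "f \<in> borel_measurable lebesgue"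
    and f_powr: "set_integrable lebesgue \<Omega> (\<lambda>x. \<bar>f x\<bar> powr p)"
    and f_nonneg: "AE x in lebesgue. x \<in> \<Omega> \<longrightarrow> 0 \<le> f x"
begin

abbreviation "\<mu> \<equiv> lebesgue_on \<Omega>"

lemmas domain = open_domain bounded_domain

sublocale finite_measure \<mu>
  by (rule finite_measure_lebesgue_on_bounded[OF domain])

lemma f_nonneg_AE: "AE x in \<mu>. 0 \<le> f x"
  using f_nonneg by (simp add: AE_lebesgue_on_iff[OF open_domain])

lemma f_meas [measurable]: "f \<in> borel_measurable \<mu>"
  by (rule measurable_restrict_space1[OF f_measurable])

lemma f_powr_integrable: "integrable \<mu> (\<lambda>x. \<bar>f x\<bar> powr p)"
  using f_powr by (simp add: set_integrable_lebesgue_on_iff[OF open_domain])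

text \<open>\<open>le_add_powr\<close> at level 1, on a domain of finite measure.\<close>

lemma f_integrable: "integrable \<mu> f"
proof (rule Bochner_Integration.integrable_bound)
  show "integrable \<mu> (\<lambda>x. 1 + \<bar>f x\<bar> powr p)"
    using f_powr_integrable by simp
  have "\<bar>f x\<bar> \<le> 1 + \<bar>f x\<bar> powr p" for x
    using le_add_powr[of "\<bar>f x\<bar>" 1 p] p by simp
  then show "AE x in \<mu>. norm (f x) \<le> norm (1 + \<bar>f x\<bar> powr p)" by simp
qed measurable

text \<open>The averaging estimates live on the whole space with Borel weights, whereas f is
  Lebesgue measurable and of known sign on \<Omega> alone. The weight w is the positive part of a
  Borel version of f, cut off outside \<Omega>.\<close>

lemma borel_weight:
  obtains w F where "w \<in> borel_measurable borel" "\<And>x. 0 \<le> w x"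
    "(\<integral>\<^sup>+x. ennreal (w x powr p) \<partial>lborel) \<le> ennreal F" "0 \<le> F"
    "\<And>k. k \<in> borel_measurable borel \<Longrightarrow>
       (\<integral>\<^sup>+x. ennreal (f x) * k x \<partial>\<mu>) = (\<integral>\<^sup>+x. ennreal (w x) * k x \<partial>lborel)"
proof -
  obtain f' where f' [measurable]: "f' \<in> borel_measurable lborel" and eq: "AE x in lborel. f x = f' x"
    using completion_ex_borel_measurable_real[OF f_measurable] by blast
  have [measurable]: "\<Omega> \<in> sets borel" using open_domain by (rule borel_open)
  define w where "w = (\<lambda>x. max 0 (f' x) * indicator \<Omega> x)"
  have w [measurable]: "w \<in> borel_measurable borel" unfolding w_def using f' by measurable
  have w0: "0 \<le> w x" for x by (simp add: w_def)
  have eq': "AE x in lebesgue. f x = f' x" using eq by (rule AE_completion)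
  have pull: "(\<integral>\<^sup>+x. h x \<partial>\<mu>) = (\<integral>\<^sup>+x. h x * indicator \<Omega> x \<partial>lebesgue)" for h :: "real^'n \<Rightarrow> ennreal"
    by (rule nn_integral_restrict_space) (auto simp: borel_open open_domain)
  have *: "(\<integral>\<^sup>+x. ennreal (f x) * k x \<partial>\<mu>) = (\<integral>\<^sup>+x. ennreal (w x) * k x \<partial>lborel)"
    if [measurable]: "k \<in> borel_measurable borel" for k
  proof -
    have "(\<integral>\<^sup>+x. ennreal (f x) * k x \<partial>\<mu>) = (\<integral>\<^sup>+x. ennreal (w x) * k x \<partial>lebesgue)"
      unfolding pull
    proof (rule nn_integral_cong_AE, use eq' f_nonneg in eventually_elim)
      case (elim x)
      then show ?case by (cases "x \<in> \<Omega>") (auto simp: w_def max_def)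
    qed
    then show ?thesis by (simp add: nn_integral_completion)
  qed
  define F where "F = (\<integral>x. \<bar>f x\<bar> powr p \<partial>\<mu>)"
  have "(\<integral>\<^sup>+x. ennreal (w x powr p) \<partial>lborel) = (\<integral>\<^sup>+x. ennreal (w x powr p) \<partial>lebesgue)"
    by (simp add: nn_integral_completion)
  also have "\<dots> = (\<integral>\<^sup>+x. ennreal (\<bar>f x\<bar> powr p) \<partial>\<mu>)"
    unfolding pull
  proof (rule nn_integral_cong_AE, use eq' f_nonneg in eventually_elim)
    case (elim x)
    then show ?case by (cases "x \<in> \<Omega>") (auto simp: w_def max_def)
  qed
  also have "\<dots> = ennreal F"
    unfolding F_def by (rule nn_integral_eq_integral[OF f_powr_integrable]) simp
  finally show thesis
    using that[OF w w0 _ _ *, of F] by (simp add: F_def)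
qed

text \<open>Here p > N/2 enters: the exponent is \<gamma> = 2 - N/p.\<close>

lemma oscillation_bound:
  obtains C \<gamma> where "C > 0" "\<gamma> > 0" "\<And>v g r. test_fun \<Omega> v g \<Longrightarrow> r > 0 \<Longrightarrow>
    (\<integral>\<^sup>+x. ennreal (f x) * ennreal ((v x - ball_avg r v x)^2) \<partial>\<mu>)
      \<le> ennreal (C * r powr \<gamma> * L2sq \<mu> g)"
proof -
  obtain w F where w: "w \<in> borel_measurable borel" "\<And>x. 0 \<le> w x"
    "(\<integral>\<^sup>+x. ennreal (w x powr p) \<partial>lborel) \<le> ennreal F" "0 \<le> F"
    "\<And>k. k \<in> borel_measurable borel \<Longrightarrow>
       (\<integral>\<^sup>+x. ennreal (f x) * k x \<partial>\<mu>) = (\<integral>\<^sup>+x. ennreal (w x) * k x \<partial>lborel)"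
    by (rule borel_weight) blast
  define \<gamma> where "\<gamma> = 2 - real CARD('n) / p"
  have \<gamma>: "\<gamma> > 0" using p by (simp add: \<gamma>_def field_simps)
  \<comment> \<open>m * \<gamma> >= 2 is the condition that \<open>weighted_oscillation_le\<close>
    puts on the parametrisation.\<close>
  obtain m :: nat where m: "2 / \<gamma> \<le> real m" using real_arch_simple by blast
  have m1: "m \<ge> 1" using m \<gamma> by (cases m) (auto simp: divide_le_0_iff)
  have m2: "2 \<le> real m * (2 - real CARD('n) / p)" using m \<gamma> unfolding \<gamma>_def[symmetric] by (simp add: field_simps)
  define c where "c = (real m)^2 * (1 + F / unit_ball_volume TYPE(real^'n))"
  have c: "c > 0" using m1 w(4) unit_ball_volume_pos[where 'a="real^'n"] by (simp add: c_def add_pos_nonneg)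
  show thesis
  proof (rule that[OF c \<gamma>])
    fix v g and r :: real assume t: "test_fun \<Omega> v g" and r: "r > 0"
    note [measurable] = test_fun_borel[OF t] measurable_ball_avg[OF test_fun_borel(1)[OF t]]
    have "(\<integral>\<^sup>+x. ennreal (f x) * ennreal ((v x - ball_avg r v x)^2) \<partial>\<mu>)
        = (\<integral>\<^sup>+x. ennreal (w x) * ennreal ((v x - ball_avg r v x)^2) \<partial>lborel)"
      by (rule w(5)) measurable
    also have "\<dots> \<le> ennreal (r powr \<gamma> * (real m)^2 * (1 + F / unit_ball_volume TYPE(real^'n)))
        * (\<integral>\<^sup>+x. ennreal ((norm (g x))^2) \<partial>lborel)"
      unfolding \<gamma>_def by (rule weighted_oscillation_le[OF t w(1,2) p(1) m1 m2 r w(3,4)])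
    also have "\<dots> = ennreal (c * r powr \<gamma> * L2sq \<mu> g)"
      unfolding nn_integral_test_fun[OF open_domain t]
      using c by (subst ennreal_mult[symmetric]) (auto simp: c_def mult_ac)
    finally show "(\<integral>\<^sup>+x. ennreal (f x) * ennreal ((v x - ball_avg r v x)^2) \<partial>\<mu>)
      \<le> ennreal (c * r powr \<gamma> * L2sq \<mu> g)" .
  qed
qed

lemma Poincare:
  obtains D where "D > 0" "\<And>v g. test_fun \<Omega> v g \<Longrightarrow> (\<integral>x. (v x)^2 \<partial>\<mu>) \<le> D * L2sq \<mu> g"
proof -
  obtain D where D: "D > 0" "\<And>v g. test_fun \<Omega> v g \<Longrightarrow>
    (\<integral>\<^sup>+x. ennreal ((v x)^2) \<partial>lborel) \<le> ennreal D * (\<integral>\<^sup>+x. ennreal ((norm (g x))^2) \<partial>lborel)"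
    by (rule test_fun_Poincare[OF bounded_domain]) blast
  show thesis
  proof (rule that[OF D(1)])
    fix v g assume t: "test_fun \<Omega> v g"
    show "(\<integral>x. (v x)^2 \<partial>\<mu>) \<le> D * L2sq \<mu> g"
      using D(2)[OF t] D(1) unfolding nn_integral_test_fun[OF open_domain t]
      by (simp add: ennreal_mult[symmetric])
  qed
qed

lemma test_fun_weight_integrable:
  assumes "test_fun \<Omega> v g"
  shows "integrable \<mu> (\<lambda>x. f x * (v x)^2)"
proof -
  obtain B where B: "B \<ge> 0" "\<And>x. \<bar>v x\<bar> \<le> B" "\<And>x. norm (g x) \<le> B"
    by (rule test_fun_bounded[OF assms]) blast
  note [measurable] = continuous_measurable_lebesgue_on[OF test_fun_D(1)[OF assms]]
  show ?thesis
  proof (rule Bochner_Integration.integrable_bound)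
    show "integrable \<mu> (\<lambda>x. f x * B^2)" using f_integrable by simp
    show "AE x in \<mu>. norm (f x * (v x)^2) \<le> norm (f x * B^2)"
      using power_mono[OF B(2) abs_ge_zero, where n=2]
      by (intro always_eventually allI) (simp add: abs_mult mult_left_mono)
  qed measurable
qed

text \<open>From v^2 <= 2 (v - avg)^2 + 2 avg^2: the oscillation is controlled through the weighted
  integral J, the average through its uniform bound K and the integral of f.\<close>

lemma weight_split_bound:
  assumes t: "test_fun \<Omega> v g" and r: "r > 0" and s: "\<And>x. x \<in> \<Omega> \<Longrightarrow> (ball_avg r v x)^2 \<le> K"
    and o: "(\<integral>\<^sup>+x. ennreal (f x) * ennreal ((v x - ball_avg r v x)^2) \<partial>\<mu>) \<le> ennreal J" "0 \<le> J" "0 \<le> K"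
  shows "(\<integral>x. f x * (v x)^2 \<partial>\<mu>) \<le> 2 * J + 2 * K * (\<integral>x. f x \<partial>\<mu>)"
proof -
  note [measurable] = continuous_measurable_lebesgue_on[OF test_fun_D(1)[OF t]]
  have [measurable]: "ball_avg r v \<in> borel_measurable \<mu>"
    by (intro measurable_restrict_space1 measurable_completion)
       (simp add: measurable_ball_avg test_fun_borel(1)[OF t])
  have I: "0 \<le> (\<integral>x. f x \<partial>\<mu>)" by (rule integral_nonneg_AE[OF f_nonneg_AE])
  have "ennreal (\<integral>x. f x * (v x)^2 \<partial>\<mu>) = (\<integral>\<^sup>+x. ennreal (f x * (v x)^2) \<partial>\<mu>)"
    by (rule nn_integral_eq_integral[symmetric, OF test_fun_weight_integrable[OF t]])
       (use f_nonneg_AE in eventually_elim, simp)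
  also have "\<dots> \<le> (\<integral>\<^sup>+x. 2 * (ennreal (f x) * ennreal ((v x - ball_avg r v x)^2)) + ennreal (2 * K) * ennreal (f x) \<partial>\<mu>)"
  proof (rule nn_integral_mono_AE, use f_nonneg_AE AE_space in eventually_elim)
    case (elim x)
    have "(v x)^2 \<le> 2 * (v x - ball_avg r v x)^2 + 2 * (ball_avg r v x)^2"
      using norm_add_square_le[of "v x - ball_avg r v x" "ball_avg r v x"] by simp
    also have "\<dots> \<le> 2 * (v x - ball_avg r v x)^2 + 2 * K" using s[of x] elim by simp
    finally have "f x * (v x)^2 \<le> f x * (2 * (v x - ball_avg r v x)^2 + 2 * K)"
      using elim by (intro mult_left_mono)
    then have "ennreal (f x * (v x)^2) \<le> ennreal (2 * (f x * (v x - ball_avg r v x)^2) + 2 * K * f x)"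
      by (intro ennreal_leI) (simp add: algebra_simps)
    also have "\<dots> = 2 * (ennreal (f x) * ennreal ((v x - ball_avg r v x)^2)) + ennreal (2 * K) * ennreal (f x)"
      using elim o(3) by (simp add: ennreal_plus ennreal_mult ennreal_numeral)
    finally show ?case .
  qed
  also have "\<dots> = 2 * (\<integral>\<^sup>+x. ennreal (f x) * ennreal ((v x - ball_avg r v x)^2) \<partial>\<mu>) + ennreal (2 * K) * (\<integral>\<^sup>+x. ennreal (f x) \<partial>\<mu>)"
    by (simp add: nn_integral_add nn_integral_cmult)
  also have "\<dots> \<le> 2 * ennreal J + ennreal (2 * K) * ennreal (\<integral>x. f x \<partial>\<mu>)"
    unfolding nn_integral_eq_integral[OF f_integrable f_nonneg_AE]
    by (intro add_mono mult_left_mono o) auto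
  also have "\<dots> = ennreal (2 * J + 2 * K * (\<integral>x. f x \<partial>\<mu>))"
    using o I by (simp add: ennreal_plus ennreal_mult ennreal_numeral)
  finally show ?thesis
    by (subst (asm) ennreal_le_iff) (use o I in auto)
qed

lemma ball_avg_bound_real:
  assumes t: "test_fun \<Omega> v g" and r: "r > 0"
  shows "(ball_avg r v x)^2 \<le> (\<integral>x. (v x)^2 \<partial>\<mu>) / (unit_ball_volume TYPE(real^'n) * r ^ CARD('n))"
    and "(ball_avg r v y - ball_avg r v x)^2
      \<le> (norm (y - x))^2 * L2sq \<mu> g / (unit_ball_volume TYPE(real^'n) * r ^ CARD('n))"
proof -
  let ?b = "unit_ball_volume TYPE(real^'n) * r ^ CARD('n)"
  have b: "?b > 0" using r unit_ball_volume_pos[where 'a="real^'n"] by simp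
  show "(ball_avg r v x)^2 \<le> (\<integral>x. (v x)^2 \<partial>\<mu>) / ?b"
    using ball_avg_square_le[OF t r, of x] b unfolding nn_integral_test_fun[OF open_domain t]
    by (simp add: ennreal_mult[symmetric])
  show "(ball_avg r v y - ball_avg r v x)^2 \<le> (norm (y - x))^2 * L2sq \<mu> g / ?b"
    using ball_avg_increment_square_le[OF t r, of x "y - x"] b unfolding nn_integral_test_fun[OF open_domain t]
    by (simp add: ennreal_mult[symmetric])
qed

text \<open>The splitting at radius 1: the oscillation is bounded by the gradient, and the average
  by the L^2 norm, hence by the gradient through the Poincare inequality.\<close>

lemma weight_bound_test_fun:
  obtains C where "C > 0" "\<And>v g. test_fun \<Omega> v g \<Longrightarrow> (\<integral>x. f x * (v x)^2 \<partial>\<mu>) \<le> C * L2sq \<mu> g"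
proof -
  obtain C \<gamma> where C: "C > 0" "\<gamma> > 0" "\<And>v g r. test_fun \<Omega> v g \<Longrightarrow> r > 0 \<Longrightarrow>
    (\<integral>\<^sup>+x. ennreal (f x) * ennreal ((v x - ball_avg r v x)^2) \<partial>\<mu>)
      \<le> ennreal (C * r powr \<gamma> * L2sq \<mu> g)"
    by (rule oscillation_bound) blast
  obtain D where D: "D > 0" "\<And>v g. test_fun \<Omega> v g \<Longrightarrow> (\<integral>x. (v x)^2 \<partial>\<mu>) \<le> D * L2sq \<mu> g"
    by (rule Poincare) blast
  let ?b = "unit_ball_volume TYPE(real^'n)" and ?I = "\<integral>x. f x \<partial>\<mu>"
  note b = unit_ball_volume_pos[where 'a="real^'n"]
  have I: "0 \<le> ?I" by (rule integral_nonneg_AE[OF f_nonneg_AE])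
  show thesis
  proof (rule that[of "2 * C + 2 * (D / ?b) * ?I"])
    show "0 < 2 * C + 2 * (D / ?b) * ?I" using C D I b by (simp add: add_pos_nonneg)
    fix v g assume t: "test_fun \<Omega> v g"
    let ?A = "\<integral>x. (norm (g x))^2 \<partial>\<mu>"
    have "(\<integral>x. f x * (v x)^2 \<partial>\<mu>) \<le> 2 * (C * ?A) + 2 * (D * ?A / ?b) * ?I"
    proof (rule weight_split_bound[OF t, of 1])
      show "(ball_avg 1 v x)^2 \<le> D * ?A / ?b" for x
        using ball_avg_bound_real(1)[OF t, of 1 x] divide_right_mono[OF D(2)[OF t] less_imp_le[OF b]] by simp
      show "(\<integral>\<^sup>+x. ennreal (f x) * ennreal ((v x - ball_avg 1 v x)^2) \<partial>\<mu>) \<le> ennreal (C * ?A)"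
        using C(3)[OF t, of 1] by simp
    qed (use C(1) D(1) b in auto)
    then show "(\<integral>x. f x * (v x)^2 \<partial>\<mu>) \<le> (2 * C + 2 * (D / ?b) * ?I) * ?A"
      by (simp add: algebra_simps)
  qed
qed

text \<open>Averages at scale \<open>r\<close> of functions of bounded energy are uniformly bounded and equi-Lipschitz.\<close>
lemma ball_avg_subseq:
  assumes t: "\<And>n::nat. test_fun \<Omega> (v n) (g n)" and A: "\<And>n. L2sq \<mu> (g n) \<le> A"
    and r: "r > 0" and e: "e > 0"
  obtains k :: "nat \<Rightarrow> nat" where "strict_mono k"
    "\<exists>N. \<forall>i\<ge>N. \<forall>j\<ge>N. \<forall>x\<in>\<Omega>. \<bar>ball_avg r (v (k i)) x - ball_avg r (v (k j)) x\<bar> < e"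
proof -
  obtain D where D: "D > 0" "\<And>v g. test_fun \<Omega> v g \<Longrightarrow> (\<integral>x. (v x)^2 \<partial>\<mu>) \<le> D * L2sq \<mu> g"
    by (rule Poincare) blast
  let ?b = "unit_ball_volume TYPE(real^'n) * r ^ CARD('n)"
  have b: "?b > 0" using r unit_ball_volume_pos[where 'a="real^'n"] by simp
  have A0: "0 \<le> A" using order_trans[OF integral_nonneg_AE A] by auto
  \<comment> \<open>The summand 1 makes L positive even when A = 0, so that e / L can serve as
    modulus of continuity.\<close>
  define L where "L = sqrt (A / ?b) + 1"
  have L: "L > 0" unfolding L_def using A0 b by (simp add: add_nonneg_pos)
  have bnd: "norm (ball_avg r (v n) x) \<le> sqrt (D * A / ?b)" for n x
  proof -
    have "(ball_avg r (v n) x)^2 \<le> (\<integral>x. (v n x)^2 \<partial>\<mu>) / ?b" by (rule ball_avg_bound_real[OF t r])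
    also have "\<dots> \<le> D * A / ?b"
      using order_trans[OF D(2)[OF t] mult_left_mono[OF A less_imp_le[OF D(1)]]] b by (intro divide_right_mono) auto
    finally show ?thesis by (simp add: real_le_rsqrt)
  qed
  have lip: "norm (ball_avg r (v n) x - ball_avg r (v n) y) \<le> L * norm (x - y)" for n x y
  proof -
    have "(ball_avg r (v n) x - ball_avg r (v n) y)^2 \<le> (norm (x - y))^2 * L2sq \<mu> (g n) / ?b"
      by (rule ball_avg_bound_real[OF t r])
    also have "\<dots> \<le> (norm (x - y))^2 * A / ?b"
      using A[of n] b by (intro divide_right_mono mult_left_mono) auto
    also have "\<dots> = (sqrt (A / ?b) * norm (x - y))^2"
      using A0 b by (simp add: power_mult_distrib)
    finally have "\<bar>ball_avg r (v n) x - ball_avg r (v n) y\<bar> \<le> \<bar>sqrt (A / ?b) * norm (x - y)\<bar>"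
      by (simp only: abs_le_square_iff)
    also have "\<dots> \<le> L * norm (x - y)" using A0 b by (simp add: L_def abs_mult algebra_simps)
    finally show ?thesis by simp
  qed
  obtain h k where k: "strict_mono (k :: nat \<Rightarrow> nat)"
    and lim: "\<And>e. 0 < e \<Longrightarrow> \<exists>N. \<forall>n x. n \<ge> N \<and> x \<in> closure \<Omega> \<longrightarrow> norm (ball_avg r (v (k n)) x - h x) < e"
  proof (rule Arzela_Ascoli[of "closure \<Omega>" "\<lambda>n. ball_avg r (v n)" "sqrt (D * A / ?b)"])
    show "compact (closure \<Omega>)" using bounded_domain by (simp add: compact_closure)
    show "\<exists>d. 0 < d \<and> (\<forall>n y. y \<in> closure \<Omega> \<and> norm (x - y) < d \<longrightarrow> norm (ball_avg r (v n) x - ball_avg r (v n) y) < e)"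
      if "0 < e" for x e
    proof (intro exI[of _ "e / L"] conjI allI impI)
      show "0 < e / L" using that L by simp
      fix n y assume "y \<in> closure \<Omega> \<and> norm (x - y) < e / L"
      then have "L * norm (x - y) < e" using L by (simp add: field_simps)
      then show "norm (ball_avg r (v n) x - ball_avg r (v n) y) < e"
        using lip[of n x y] by linarith
    qed
  qed (use bnd in blast)+
  show thesis
  proof (rule that[OF k])
    obtain N where N: "\<And>n x. n \<ge> N \<Longrightarrow> x \<in> closure \<Omega> \<Longrightarrow> norm (ball_avg r (v (k n)) x - h x) < e / 2"
      using lim[of "e/2"] e by auto
    have "\<bar>ball_avg r (v (k i)) x - ball_avg r (v (k j)) x\<bar> < e" if "i \<ge> N" "j \<ge> N" "x \<in> \<Omega>" for i j x
      using N[OF that(1), of x] N[OF that(2), of x] closure_subset[of \<Omega>] that(3)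
      unfolding real_norm_def by (smt (verit) in_mono field_sum_of_halves)
    then show "\<exists>N. \<forall>i\<ge>N. \<forall>j\<ge>N. \<forall>x\<in>\<Omega>. \<bar>ball_avg r (v (k i)) x - ball_avg r (v (k j)) x\<bar> < e" by blast
  qed
qed

text \<open>A diagonal sequence handles all radii 1/(n+1) at once. For a given tolerance a radius is
  fixed that makes the oscillation term small; at that radius the averages of two late members
  differ by little, uniformly on \<Omega>.\<close>

lemma weight_compact:
  assumes t: "\<And>n::nat. test_fun \<Omega> (v n) (g n)" and A: "\<And>n. L2sq \<mu> (g n) \<le> A"
  obtains k :: "nat \<Rightarrow> nat" where "strict_mono k"
    "\<And>e. e > 0 \<Longrightarrow> \<exists>N. \<forall>i\<ge>N. \<forall>j\<ge>N. (\<integral>x. f x * (v (k i) x - v (k j) x)^2 \<partial>\<mu>) < e"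
proof -
  obtain C \<gamma> where C: "C > 0" "\<gamma> > 0" "\<And>v g r. test_fun \<Omega> v g \<Longrightarrow> r > 0 \<Longrightarrow>
    (\<integral>\<^sup>+x. ennreal (f x) * ennreal ((v x - ball_avg r v x)^2) \<partial>\<mu>)
      \<le> ennreal (C * r powr \<gamma> * L2sq \<mu> g)"
    by (rule oscillation_bound) blast
  let ?I = "\<integral>x. f x \<partial>\<mu>"
  have I: "0 \<le> ?I" by (rule integral_nonneg_AE[OF f_nonneg_AE])
  have A0: "0 \<le> A" using order_trans[OF integral_nonneg_AE A] by auto
  define r where "r = (\<lambda>n::nat. inverse (real (Suc n)))"
  have r: "r n > 0" for n by (simp add: r_def)
  \<comment> \<open>At stage n the averages have to agree up to r n only, not up to every tolerance:
    radius and tolerance shrink together.\<close>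
  define P where "P = (\<lambda>n (s::nat\<Rightarrow>nat). \<exists>N. \<forall>i\<ge>N. \<forall>j\<ge>N. \<forall>x\<in>\<Omega>. \<bar>ball_avg (r n) (v (s i)) x - ball_avg (r n) (v (s j)) x\<bar> < r n)"
  interpret subseqs P
  proof
    fix n and s :: "nat \<Rightarrow> nat"
    obtain k :: "nat \<Rightarrow> nat" where "strict_mono k"
      "\<exists>N. \<forall>i\<ge>N. \<forall>j\<ge>N. \<forall>x\<in>\<Omega>. \<bar>ball_avg (r n) (v (s (k i))) x - ball_avg (r n) (v (s (k j))) x\<bar> < r n"
      by (rule ball_avg_subseq[of "\<lambda>i. v (s i)" "\<lambda>i. g (s i)" A "r n" "r n"]) (use t A r in blast)+
    then show "\<exists>r'. strict_mono r' \<and> P n (s \<circ> r')" unfolding P_def comp_def by blast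
  qed
  \<comment> \<open>The diagonal sequence is a subsequence of the n-th refinement only from index
    \<open>Suc n\<close> on, hence the shift. \<open>P n\<close> passes to further subsequences, as
    the diagonal argument requires.\<close>
  have P: "P n (diagseq \<circ> (+) (Suc n))" for n
  proof (rule diagseq_holds)
    fix k s :: "nat \<Rightarrow> nat" and n assume k: "strict_mono k" and "P n s"
    then obtain N where N: "\<And>i j x. i \<ge> N \<Longrightarrow> j \<ge> N \<Longrightarrow> x \<in> \<Omega> \<Longrightarrow> \<bar>ball_avg (r n) (v (s i)) x - ball_avg (r n) (v (s j)) x\<bar> < r n"
      unfolding P_def by blast
    have "k i \<ge> N" if "i \<ge> N" for i using seq_suble[OF k, of i] that by linarith
    then show "P n (s \<circ> k)" unfolding P_def comp_def using N by blast
  qed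
  show thesis
  proof (rule that[OF subseq_diagseq])
    fix e :: real assume e: "e > 0"
    \<comment> \<open>The right side of \<open>weight_split_bound\<close> with J = C r^\<gamma> (4
      A) and K = r^2; the factor 4 comes from the gradient of a difference of two members.\<close>
    define q where "q = (\<lambda>n. 2 * (C * r n powr \<gamma> * (4 * A)) + 2 * (r n)^2 * ?I)"
    have "r \<longlonglongrightarrow> 0" unfolding r_def by (rule LIMSEQ_inverse_real_of_nat)
    moreover have "(\<lambda>n. r n powr \<gamma>) \<longlonglongrightarrow> 0"
    proof -
      have "(\<lambda>n. r n powr \<gamma>) \<longlonglongrightarrow> 0 powr \<gamma>"
        by (rule tendsto_powr2[OF \<open>r \<longlonglongrightarrow> 0\<close> tendsto_const]) (use C r in \<open>auto intro!: always_eventually less_imp_le\<close>)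
      then show ?thesis by simp
    qed
    ultimately have "q \<longlonglongrightarrow> 2 * (C * 0 * (4 * A)) + 2 * 0^2 * ?I"
      unfolding q_def by (intro tendsto_intros)
    then have "q \<longlonglongrightarrow> 0" by simp
    then have "\<forall>\<^sub>F n in sequentially. q n < e" using e by (rule order_tendstoD)
    then obtain n where n: "q n < e" by (rule eventually_sequentially[THEN iffD1, THEN exE]) blast
    obtain N where N: "\<And>i j x. i \<ge> N \<Longrightarrow> j \<ge> N \<Longrightarrow> x \<in> \<Omega> \<Longrightarrow>
        \<bar>ball_avg (r n) (v (diagseq (Suc n + i))) x - ball_avg (r n) (v (diagseq (Suc n + j))) x\<bar> < r n"
      using P[of n] unfolding P_def comp_def by blast
    have "(\<integral>x. f x * (v (diagseq i) x - v (diagseq j) x)^2 \<partial>\<mu>) < e" if ij: "i \<ge> Suc n + N" "j \<ge> Suc n + N" for i j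
    proof -
      let ?i = "diagseq i" and ?j = "diagseq j"
      have td: "test_fun \<Omega> (\<lambda>x. v ?i x - v ?j x) (\<lambda>x. g ?i x - g ?j x)" by (rule test_fun_diff[OF t t])
      note L = test_fun_L2(2)[OF domain t]
      have "L2sq \<mu> (\<lambda>x. g ?i x - g ?j x) \<le> (\<integral>x. 2 * (norm (g ?i x))^2 + 2 * (norm (g ?j x))^2 \<partial>\<mu>)"
        by (intro integral_mono L2_integrable_square L2_diff L Bochner_Integration.integrable_add integrable_mult_right norm_diff_square_le)
      also have "\<dots> = 2 * L2sq \<mu> (g ?i) + 2 * L2sq \<mu> (g ?j)"
        using L2_integrable_square[OF L] by simp
      also have "\<dots> \<le> 4 * A" using A[of ?i] A[of ?j] by simp
      finally have g4: "L2sq \<mu> (\<lambda>x. g ?i x - g ?j x) \<le> 4 * A" .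
      have "(\<integral>x. f x * (v ?i x - v ?j x)^2 \<partial>\<mu>) \<le> q n"
        unfolding q_def
      proof (rule weight_split_bound[OF td r[of n]])
        fix x assume x: "x \<in> \<Omega>"
        have "\<bar>ball_avg (r n) (v ?i) x - ball_avg (r n) (v ?j) x\<bar> < r n"
          using N[of "i - Suc n" "j - Suc n" x] ij x by simp
        then show "(ball_avg (r n) (\<lambda>x. v ?i x - v ?j x) x)^2 \<le> (r n)^2"
          unfolding ball_avg_diff[OF t t] using r[of n] by (simp add: abs_le_square_iff[symmetric])
      next
        have "C * r n powr \<gamma> * L2sq \<mu> (\<lambda>x. g ?i x - g ?j x) \<le> C * r n powr \<gamma> * (4 * A)"
          using C by (intro mult_left_mono g4) auto
        then show "(\<integral>\<^sup>+x. ennreal (f x) * ennreal ((v ?i x - v ?j x - ball_avg (r n) (\<lambda>x. v ?i x - v ?j x) x)^2) \<partial>\<mu>)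
            \<le> ennreal (C * r n powr \<gamma> * (4 * A))"
          by (intro order_trans[OF C(3)[OF td r] ennreal_leI])
      qed (use A0 C in auto)
      then show ?thesis using n by simp
    qed
    then show "\<exists>N. \<forall>i\<ge>N. \<forall>j\<ge>N. (\<integral>x. f x * (v (diagseq i) x - v (diagseq j) x)^2 \<partial>\<mu>) < e" by blast
  qed
qed

end

section \<open>The first eigenvalue\<close>

text \<open>Squaring smooths the kink of the positive part: at 0 the difference quotient is bounded
  by |y|.\<close>

lemma has_derivative_max_0_square:
  "((\<lambda>s::real. (max 0 s)^2) has_field_derivative 2 * max 0 s) (at s)"
proof -
  consider "s > 0" | "s < 0" | "s = 0" by linarith
  then show ?thesis
  proof cases
    case 1
    have "((\<lambda>s::real. s^2) has_field_derivative 2 * max 0 s) (at s)"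
      using 1 by (auto intro!: derivative_eq_intros)
    then show ?thesis
      by (rule has_field_derivative_transform_within_open[of _ _ _ "{0<..}"]) (use 1 in auto)
  next
    case 2
    have "((\<lambda>s::real. 0) has_field_derivative 2 * max 0 s) (at s)"
      using 2 by (auto intro!: derivative_eq_intros)
    then show ?thesis
      by (rule has_field_derivative_transform_within_open[of _ _ _ "{..<0}"]) (use 2 in auto)
  next
    case 3
    have "((\<lambda>y::real. (max 0 y)^2 / y) \<longlongrightarrow> 0) (at 0)"
    proof (rule Lim_null_comparison)
      have "norm ((max 0 y)^2 / y) \<le> \<bar>y\<bar>" for y :: real
        by (auto simp: max_def power2_eq_square)
      then show "\<forall>\<^sub>F y in at 0. norm ((max 0 y)^2 / y) \<le> \<bar>y::real\<bar>" by simp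
      show "((\<lambda>y::real. \<bar>y\<bar>) \<longlongrightarrow> 0) (at 0)" by (auto intro!: tendsto_eq_intros)
    qed
    then show ?thesis using 3 by (simp add: has_field_derivative_iff)
  qed
qed

lemma test_fun_bump:
  fixes c :: "real^'n"
  assumes r: "r > 0" and sub: "cball c r \<subseteq> \<Omega>"
  shows "test_fun \<Omega> (\<lambda>x. (max 0 (r^2 - (norm (x - c))^2))^2)
    (\<lambda>x. (-4 * max 0 (r^2 - (norm (x - c))^2)) *\<^sub>R (x - c))"
proof -
  let ?v = "\<lambda>x. (max 0 (r^2 - (norm (x - c))^2))^2"
  have "{x. ?v x \<noteq> 0} \<subseteq> cball c r"
  proof
    fix x assume "x \<in> {x. ?v x \<noteq> 0}"
    then have "(norm (x - c))^2 < r^2" by (auto simp: max_def split: if_splits)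
    then have "norm (x - c) < r" using r by (simp add: power2_less_imp_less)
    then show "x \<in> cball c r" by (simp add: dist_norm norm_minus_commute)
  qed
  then have cl: "closure {x. ?v x \<noteq> 0} \<subseteq> cball c r"
    by (intro closure_minimal) auto
  have "(?v has_derivative (\<lambda>y. ((-4 * max 0 (r^2 - (norm (x - c))^2)) *\<^sub>R (x - c)) \<bullet> y)) (at x)" for x
  proof -
    have "((\<lambda>x. r^2 - (norm (x - c))^2) has_derivative (\<lambda>y. - 2 * ((x - c) \<bullet> y))) (at x)"
      unfolding power2_norm_eq_inner
      by (auto intro!: derivative_eq_intros simp: inner_commute)
    from has_derivative_compose[OF this, of "\<lambda>s. (max 0 s)^2", OF has_derivative_max_0_square[unfolded has_field_derivative_def]]
    show ?thesis by (rule has_derivative_eq_rhs) (auto simp: fun_eq_iff)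
  qed
  moreover have "continuous_on UNIV (\<lambda>x. (-4 * max 0 (r^2 - (norm (x - c))^2)) *\<^sub>R (x - c))"
    by (intro continuous_intros)
  moreover have "compact (closure {x. ?v x \<noteq> 0})"
    using bounded_subset[OF bounded_cball, of _ c r] cl closure_subset by (subst compact_closure) blast
  ultimately show ?thesis using cl sub unfolding test_fun_def by blast
qed

lemma borel_measurable_matrix_vector:
  fixes G :: "'a \<Rightarrow> real^'n" and A :: "'a \<Rightarrow> real^'n^'m"
  assumes A: "\<And>i j. (\<lambda>x. A x $ i $ j) \<in> borel_measurable N" and G: "G \<in> borel_measurable N"
  shows "(\<lambda>x. A x *v G x) \<in> borel_measurable N"
proof -
  have Gj: "(\<lambda>x. G x $ j) \<in> borel_measurable N" for j
  proof -
    have "(\<lambda>x. G x \<bullet> axis j 1) \<in> borel_measurable N" using G by measurable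
    then show ?thesis by (simp add: inner_axis)
  qed
  show ?thesis
  proof (subst borel_measurable_euclidean_space, intro ballI)
    fix b :: "real^'m" assume "b \<in> Basis"
    then obtain i where b: "b = axis i 1" by (auto simp: Basis_vec_def)
    have "(\<lambda>x. \<Sum>j\<in>UNIV. A x $ i $ j * G x $ j) \<in> borel_measurable N"
      by (intro borel_measurable_sum borel_measurable_times A Gj)
    then show "(\<lambda>x. (A x *v G x) \<bullet> b) \<in> borel_measurable N"
      by (simp add: b inner_axis matrix_vector_mult_def)
  qed
qed

lemma symmetric_matrix_inner:
  fixes A :: "real^'n^'n"
  assumes "transpose A = A"
  shows "(A *v x) \<bullet> y = (A *v y) \<bullet> x"
proof -
  have "(A *v x) \<bullet> y = (transpose A *v x) \<bullet> y" using assms by simp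
  also have "\<dots> = x \<bullet> (A *v y)" by (simp add: transpose_matrix_vector dot_lmul_matrix)
  finally show ?thesis by (simp add: inner_commute)
qed

section \<open>The energy form and the weighted mass form\<close>

locale elliptic_problem = weighted_domain \<Omega> f p
  for \<Omega> :: "(real^'n) set" and f :: "real^'n \<Rightarrow> real" and p :: real +
  fixes M :: "real^'n \<Rightarrow> real^'n^'n" and \<alpha> \<beta> :: real
  assumes \<alpha>: "0 < \<alpha>"
    and M_measurable: "\<And>i j. (\<lambda>x. M x $ i $ j) \<in> borel_measurable lebesgue"
    and M_symmetric: "AE x in lebesgue. x \<in> \<Omega> \<longrightarrow> transpose (M x) = M x"
    and M_elliptic: "AE x in lebesgue. x \<in> \<Omega> \<longrightarrow>
           (\<forall>\<xi>. \<alpha> * (norm \<xi>)^2 \<le> (M x *v \<xi>) \<bullet> \<xi> \<and> norm (M x *v \<xi>) \<le> \<beta> * norm \<xi>)"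
    and f_nonzero: "\<not> (AE x in lebesgue. x \<in> \<Omega> \<longrightarrow> f x = 0)"
begin

lemma M_symmetric_AE: "AE x in \<mu>. \<forall>\<xi> \<eta>. (M x *v \<xi>) \<bullet> \<eta> = (M x *v \<eta>) \<bullet> \<xi>"
proof -
  have "AE x in \<mu>. transpose (M x) = M x"
    using M_symmetric by (simp add: AE_lebesgue_on_iff[OF open_domain])
  then show ?thesis by eventually_elim (intro allI symmetric_matrix_inner)
qed

lemma M_elliptic_AE: "AE x in \<mu>. \<forall>\<xi>. \<alpha> * (norm \<xi>)^2 \<le> (M x *v \<xi>) \<bullet> \<xi> \<and> norm (M x *v \<xi>) \<le> \<beta> * norm \<xi>"
  using M_elliptic by (simp add: AE_lebesgue_on_iff[OF open_domain])

lemma L2_M: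
  assumes "L2 \<mu> G"
  shows "L2 \<mu> (\<lambda>x. M x *v G x)"
proof -
  have m: "(\<lambda>x. M x *v G x) \<in> borel_measurable \<mu>"
    by (intro borel_measurable_matrix_vector measurable_restrict_space1[OF M_measurable] L2_measurable assms)
  have "integrable \<mu> (\<lambda>x. (norm (M x *v G x))^2)"
  proof (rule Bochner_Integration.integrable_bound)
    show "integrable \<mu> (\<lambda>x. \<beta>^2 * (norm (G x))^2)"
      using L2_integrable_square[OF assms] by simp
    show "AE x in \<mu>. norm ((norm (M x *v G x))^2) \<le> norm (\<beta>^2 * (norm (G x))^2)"
      using M_elliptic_AE
    proof eventually_elim
      case (elim x)
      then have "(norm (M x *v G x))^2 \<le> (\<beta> * norm (G x))^2"
        by (intro power_mono) auto
      then show ?case by (simp add: power_mult_distrib)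
    qed
  qed (use m in measurable)
  with m show ?thesis by (simp add: L2_def)
qed

text \<open>\<open>energy\<close> and \<open>mass\<close> are the two sides of the weak eigenvalue
  equation. \<open>energy\<close> takes gradients as arguments because \<open>H10\<close> relates a
  representative to a gradient instead of computing one.\<close>

definition energy :: "(real^'n \<Rightarrow> real^'n) \<Rightarrow> (real^'n \<Rightarrow> real^'n) \<Rightarrow> real" where
  "energy G K = (\<integral>x. (M x *v G x) \<bullet> K x \<partial>\<mu>)"

definition mass :: "(real^'n \<Rightarrow> real) \<Rightarrow> (real^'n \<Rightarrow> real) \<Rightarrow> real" where
  "mass v w = (\<integral>x. f x * v x * w x \<partial>\<mu>)"

abbreviation "energy_sq G \<equiv> energy G G"

lemma energy_integrable: "L2 \<mu> G \<Longrightarrow> L2 \<mu> K \<Longrightarrow> integrable \<mu> (\<lambda>x. (M x *v G x) \<bullet> K x)"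
  by (intro L2_inner_integrable L2_M)

text \<open>Symmetry of M merges the two mixed terms. Together with \<open>mass_add_scaled\<close>
  it gives both the parallelogram identity and the variation of the Rayleigh quotient.\<close>

lemma energy_add_scaled:
  assumes G: "L2 \<mu> G" and K: "L2 \<mu> K"
  shows "energy_sq (\<lambda>x. G x + t *\<^sub>R K x)
    = energy G G + 2 * energy G K * t + energy K K * t^2"
proof -
  note i = energy_integrable[OF G G] energy_integrable[OF G K] energy_integrable[OF K K]
  have "energy_sq (\<lambda>x. G x + t *\<^sub>R K x)
      = (\<integral>x. (M x *v G x) \<bullet> G x + 2 * t * ((M x *v G x) \<bullet> K x) + t^2 * ((M x *v K x) \<bullet> K x) \<partial>\<mu>)"
    unfolding energy_def
  proof (rule integral_cong_AE)
    show "AE x in \<mu>. (M x *v (G x + t *\<^sub>R K x)) \<bullet> (G x + t *\<^sub>R K x)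
      = (M x *v G x) \<bullet> G x + 2 * t * ((M x *v G x) \<bullet> K x) + t^2 * ((M x *v K x) \<bullet> K x)"
      using M_symmetric_AE
    proof eventually_elim
      case (elim x)
      have s: "(M x *v K x) \<bullet> G x = (M x *v G x) \<bullet> K x" using elim by blast
      show ?case
        by (simp add: matrix_vector_right_distrib matrix_vector_mult_scaleR inner_simps s power2_eq_square algebra_simps)
    qed
    have L: "L2 \<mu> (\<lambda>x. G x + t *\<^sub>R K x)" by (intro L2_add L2_scaleR G K)
    show "(\<lambda>x. (M x *v (G x + t *\<^sub>R K x)) \<bullet> (G x + t *\<^sub>R K x)) \<in> borel_measurable \<mu>"
      by (rule borel_measurable_integrable[OF energy_integrable[OF L L]])
    show "(\<lambda>x. (M x *v G x) \<bullet> G x + 2 * t * ((M x *v G x) \<bullet> K x) + t^2 * ((M x *v K x) \<bullet> K x)) \<in> borel_measurable \<mu>"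
      using i by (auto dest!: borel_measurable_integrable)
  qed
  also have "\<dots> = energy G G + 2 * energy G K * t + energy K K * t^2"
    unfolding energy_def using i by simp
  finally show ?thesis .
qed

lemma energy_ge: "L2 \<mu> G \<Longrightarrow> \<alpha> * L2sq \<mu> G \<le> energy G G"
  unfolding energy_def integral_mult_right_zero[symmetric]
  by (intro integral_mono_AE energy_integrable integrable_mult_right L2_integrable_square)
     (use M_elliptic_AE in auto)

lemma energy_nonneg: "L2 \<mu> G \<Longrightarrow> 0 \<le> energy G G"
  using energy_ge[of G] \<alpha> by (intro order_trans[OF _ energy_ge]) auto

lemma norm_square_le_energy: "L2 \<mu> G \<Longrightarrow> L2sq \<mu> G \<le> energy G G / \<alpha>"
  using energy_ge[of G] \<alpha> by (simp add: field_simps)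

lemma tendsto_L2_M:
  assumes G: "\<And>n. L2 \<mu> (G n)" "L2 \<mu> G'"
    and lim: "L2_tendsto \<mu> G G'"
  shows "L2_tendsto \<mu> (\<lambda>n x. M x *v G n x) (\<lambda>x. M x *v G' x)"
proof (rule tendsto_L2_dominated[OF L2_M[OF G(1)] L2_M[OF G(2)] G _ lim, where c="\<beta>^2"])
  show "AE x in \<mu>. (norm (M x *v G n x - M x *v G' x))^2 \<le> \<beta>^2 * (norm (G n x - G' x))^2" for n
    using M_elliptic_AE
  proof eventually_elim
    case (elim x)
    then have "(norm (M x *v (G n x - G' x)))^2 \<le> (\<beta> * norm (G n x - G' x))^2"
      by (intro power_mono) auto
    then show ?case by (simp add: power_mult_distrib matrix_vector_mult_diff_distrib)
  qed
qed

lemma tendsto_energy: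
  assumes G: "\<And>n. L2 \<mu> (G n)" "L2 \<mu> G'"
    and lim: "L2_tendsto \<mu> G G'"
  shows "(\<lambda>n. energy (G n) (G n)) \<longlonglongrightarrow> energy G' G'"
  unfolding energy_def
  by (rule tendsto_L2_inner[OF L2_M[OF G(1)] L2_M[OF G(2)] G tendsto_L2_M[OF G lim] lim])

section \<open>From test functions to the whole space\<close>

text \<open>Fatou along an almost everywhere convergent subsequence on the side of the mass,
  convergence on the side of the energy. Integrability of f v^2 comes out of the same bound. The
  constant c is arbitrary, so the lemma serves for the embedding, for its optimal constant and for
  the bound on eigenvalues.\<close>

lemma weight_bound_extends:
  assumes test: "\<And>v g. test_fun \<Omega> v g \<Longrightarrow> mass v v \<le> c * energy g g"
    and v: "H10 \<Omega> v G"
  shows "integrable \<mu> (\<lambda>x. f x * (v x)^2)" "mass v v \<le> c * energy G G"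
proof -
  obtain \<phi> g where L: "L2 \<mu> v" "L2 \<mu> G" and t: "\<And>k. test_fun \<Omega> (\<phi> k) (g k)"
    and l1: "L2_tendsto \<mu> \<phi> v"
    and l2: "L2_tendsto \<mu> g G"
    by (rule H10E[OF domain v]) blast
  note Lt = test_fun_L2[OF domain t]
  obtain r :: "nat \<Rightarrow> nat" where r: "strict_mono r" and ae: "AE x in \<mu>. (\<lambda>n. \<phi> (r n) x) \<longlonglongrightarrow> v x"
    by (rule tendsto_L2_AE_subseq[OF Lt(1) L(1) l1]) blast
  have [measurable]: "v \<in> borel_measurable \<mu>" "\<phi> k \<in> borel_measurable \<mu>" for k
    using L Lt by (auto dest: L2_measurable)
  have elim: "(\<lambda>k. c * energy (g (r k)) (g (r k))) \<longlonglongrightarrow> c * energy G G"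
    using LIMSEQ_subseq_LIMSEQ[OF tendsto_energy[OF Lt(2) L(2) l2] r]
    by (intro tendsto_mult_left) (simp add: comp_def)
  \<comment> \<open>No sign of c is assumed, and \<open>ennreal\<close> would truncate a negative
    bound to 0.\<close>
  have nn: "0 \<le> c * energy G G"
  proof (rule LIMSEQ_le_const[OF elim], intro exI allI impI)
    fix n
    have "0 \<le> mass (\<phi> (r n)) (\<phi> (r n))"
      unfolding mass_def by (intro integral_nonneg_AE, use f_nonneg_AE in eventually_elim) (simp add: mult.assoc)
    also have "\<dots> \<le> c * energy (g (r n)) (g (r n))" by (rule test[OF t])
    finally show "0 \<le> c * energy (g (r n)) (g (r n))" .
  qed
  have "(\<integral>\<^sup>+x. ennreal (f x * (v x)^2) \<partial>\<mu>) = (\<integral>\<^sup>+x. liminf (\<lambda>n. ennreal (f x * (\<phi> (r n) x)^2)) \<partial>\<mu>)"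
  proof (rule nn_integral_cong_AE, use ae in eventually_elim)
    case (elim x)
    have "(\<lambda>n. ennreal (f x * (\<phi> (r n) x)^2)) \<longlonglongrightarrow> ennreal (f x * (v x)^2)"
      by (intro tendsto_ennrealI tendsto_intros elim)
    then show ?case by (rule lim_imp_Liminf[OF trivial_limit_sequentially, symmetric])
  qed
  also have "\<dots> \<le> liminf (\<lambda>n. \<integral>\<^sup>+x. ennreal (f x * (\<phi> (r n) x)^2) \<partial>\<mu>)"
    by (rule nn_integral_liminf) measurable
  also have "\<dots> \<le> liminf (\<lambda>n. ennreal (c * energy (g (r n)) (g (r n))))"
  proof (intro Liminf_mono always_eventually allI)
    fix n
    have "(\<integral>\<^sup>+x. ennreal (f x * (\<phi> (r n) x)^2) \<partial>\<mu>) = ennreal (\<integral>x. f x * (\<phi> (r n) x)^2 \<partial>\<mu>)"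
      by (rule nn_integral_eq_integral[OF test_fun_weight_integrable[OF t]]) (use f_nonneg_AE in auto)
    also have "\<dots> \<le> ennreal (c * energy (g (r n)) (g (r n)))"
      using test[OF t, of "r n"] by (intro ennreal_leI) (simp add: mass_def power2_eq_square mult.assoc)
    finally show "(\<integral>\<^sup>+x. ennreal (f x * (\<phi> (r n) x)^2) \<partial>\<mu>) \<le> ennreal (c * energy (g (r n)) (g (r n)))" .
  qed
  also have "\<dots> = ennreal (c * energy G G)"
    by (intro lim_imp_Liminf tendsto_ennrealI elim) simp
  finally have le: "(\<integral>\<^sup>+x. ennreal (f x * (v x)^2) \<partial>\<mu>) \<le> ennreal (c * energy G G)" .
  have nnI: "AE x in \<mu>. 0 \<le> f x * (v x)^2" using f_nonneg_AE by auto
  show i: "integrable \<mu> (\<lambda>x. f x * (v x)^2)"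
    by (rule integrableI_nonneg[OF _ nnI]) (measurable, use le_less_trans[OF le ennreal_less_top] in simp)
  show "mass v v \<le> c * energy G G"
    using le nn unfolding nn_integral_eq_integral[OF i nnI] mass_def
    by (simp add: power2_eq_square mult.assoc)
qed

lemma weight_bound_energy:
  obtains C where "C > 0" "\<And>v g. test_fun \<Omega> v g \<Longrightarrow> mass v v \<le> C * energy g g"
proof -
  obtain C where C: "C > 0" "\<And>v g. test_fun \<Omega> v g \<Longrightarrow> (\<integral>x. f x * (v x)^2 \<partial>\<mu>) \<le> C * L2sq \<mu> g"
    by (rule weight_bound_test_fun) blast
  show thesis
  proof (rule that[of "C / \<alpha>"])
    fix v g assume t: "test_fun \<Omega> v g"
    have "mass v v \<le> C * L2sq \<mu> g"
      using C(2)[OF t] by (simp add: mass_def power2_eq_square mult.assoc)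
    also have "\<dots> \<le> C * (energy g g / \<alpha>)"
      using C(1) by (intro mult_left_mono norm_square_le_energy test_fun_L2(2)[OF domain t]) auto
    finally show "mass v v \<le> C / \<alpha> * energy g g" by simp
  qed (use C \<alpha> in simp)
qed

lemma H10_weight_integrable: "H10 \<Omega> v G \<Longrightarrow> integrable \<mu> (\<lambda>x. f x * (v x)^2)"
  using weight_bound_energy weight_bound_extends(1) by metis

lemma H10_Poincare:
  obtains D where "D > 0" "\<And>v G. H10 \<Omega> v G \<Longrightarrow> (\<integral>x. (v x)^2 \<partial>\<mu>) \<le> D * L2sq \<mu> G"
proof -
  obtain D where D: "D > 0" "\<And>v g. test_fun \<Omega> v g \<Longrightarrow> (\<integral>x. (v x)^2 \<partial>\<mu>) \<le> D * L2sq \<mu> g"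
    by (rule Poincare) blast
  show thesis
  proof (rule that[OF D(1)])
    fix v G assume v: "H10 \<Omega> v G"
    obtain \<phi> g where L: "L2 \<mu> v" "L2 \<mu> G" and t: "\<And>k. test_fun \<Omega> (\<phi> k) (g k)"
      and l1: "L2_tendsto \<mu> \<phi> v"
      and l2: "L2_tendsto \<mu> g G"
      by (rule H10E[OF domain v]) blast
    note Lt = test_fun_L2[OF domain t]
    have "(\<lambda>k. \<integral>x. \<phi> k x \<bullet> \<phi> k x \<partial>\<mu>) \<longlonglongrightarrow> (\<integral>x. v x \<bullet> v x \<partial>\<mu>)"
      by (rule tendsto_L2_inner[OF Lt(1) L(1) Lt(1) L(1) l1 l1])
    moreover have "(\<lambda>k. D * (\<integral>x. g k x \<bullet> g k x \<partial>\<mu>)) \<longlonglongrightarrow> D * (\<integral>x. G x \<bullet> G x \<partial>\<mu>)"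
      by (intro tendsto_mult_left tendsto_L2_inner[OF Lt(2) L(2) Lt(2) L(2) l2 l2])
    moreover have "(\<integral>x. \<phi> k x \<bullet> \<phi> k x \<partial>\<mu>) \<le> D * (\<integral>x. g k x \<bullet> g k x \<partial>\<mu>)" for k
      using D(2)[OF t, of k] unfolding power2_norm_eq_inner by (simp add: power2_eq_square)
    ultimately have "(\<integral>x. v x \<bullet> v x \<partial>\<mu>) \<le> D * (\<integral>x. G x \<bullet> G x \<partial>\<mu>)"
      by (intro LIMSEQ_le) auto
    then show "(\<integral>x. (v x)^2 \<partial>\<mu>) \<le> D * L2sq \<mu> G"
      unfolding power2_norm_eq_inner by (simp add: power2_eq_square)
  qed
qed

text \<open>By ellipticity, vanishing energy forces a vanishing gradient, and the Poincare
  inequality then forces v = 0.\<close>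

lemma energy_pos:
  assumes v: "H10 \<Omega> v G" and nz: "\<not> (AE x in lebesgue. x \<in> \<Omega> \<longrightarrow> v x = 0)"
  shows "energy G G > 0"
proof (rule ccontr)
  assume "\<not> energy G G > 0"
  note L = H10_L2[OF domain v]
  obtain D where D: "D > 0" "\<And>v G. H10 \<Omega> v G \<Longrightarrow> (\<integral>x. (v x)^2 \<partial>\<mu>) \<le> D * L2sq \<mu> G"
    by (rule H10_Poincare) blast
  have "(\<integral>x. (v x)^2 \<partial>\<mu>) \<le> D * (energy G G / \<alpha>)"
    using D(1) by (intro order_trans[OF D(2)[OF v]] mult_left_mono norm_square_le_energy L) auto
  also have "\<dots> \<le> 0" using \<open>\<not> energy G G > 0\<close> D(1) \<alpha> by (simp add: mult_le_0_iff divide_le_0_iff)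
  finally have "(\<integral>x. (v x)^2 \<partial>\<mu>) = 0" by (simp add: antisym)
  moreover have "integrable \<mu> (\<lambda>x. (v x)^2)" using L2_integrable_square[OF L(1)] by simp
  ultimately have "AE x in \<mu>. (v x)^2 = 0"
    by (subst (asm) integral_nonneg_eq_0_iff_AE) auto
  then have "AE x in \<mu>. v x = 0" by simp
  then show False using nz by (simp add: AE_lebesgue_on_iff[OF open_domain])
qed

lemma mass_nonneg: "0 \<le> mass v v"
  unfolding mass_def by (intro integral_nonneg_AE, use f_nonneg_AE in eventually_elim) (simp add: mult.assoc)

text \<open>The eigenfunction tested against itself gives a positive energy equal to m times a
  nonnegative mass.\<close>

lemma eigenvalue_pos:
  assumes "is_eigenvalue \<Omega> M f m"
  shows "m > 0"
proof -
  obtain v G where v: "H10 \<Omega> v G" and nz: "\<not> (AE x in lebesgue. x \<in> \<Omega> \<longrightarrow> v x = 0)"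
    and eq: "\<And>w K. H10 \<Omega> w K \<Longrightarrow> energy G K = m * mass v w"
    using assms unfolding is_eigenvalue_def set_integral_lebesgue_on[OF open_domain] energy_def mass_def by blast
  have "m * mass v v > 0" using eq[OF v] energy_pos[OF v nz] by simp
  then show ?thesis using mass_nonneg[of v] by (simp add: zero_less_mult_iff)
qed

text \<open>The square root of the weight turns the weighted form into an ordinary \<open>L\<^sup>2\<close> inner product.\<close>
lemma L2_sqrt_weight:
  assumes "v \<in> borel_measurable \<mu>" "integrable \<mu> (\<lambda>x. f x * (v x)^2)"
  shows "L2 \<mu> (\<lambda>x. sqrt (f x) * v x)"
proof -
  have [measurable]: "v \<in> borel_measurable \<mu>" by fact
  have "integrable \<mu> (\<lambda>x. (norm (sqrt (f x) * v x))^2)"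
    by (rule iffD2[OF integrable_cong_AE assms(2)])
       (measurable, use f_nonneg_AE in \<open>eventually_elim, simp add: power_mult_distrib\<close>)
  then show ?thesis by (simp add: L2_def)
qed

lemma H10_sqrt_weight: "H10 \<Omega> v G \<Longrightarrow> L2 \<mu> (\<lambda>x. sqrt (f x) * v x)"
  by (intro L2_sqrt_weight H10_weight_integrable L2_measurable H10_L2[OF domain])

lemma mass_eq_inner:
  assumes "v \<in> borel_measurable \<mu>" "w \<in> borel_measurable \<mu>"
  shows "mass v w = (\<integral>x. (sqrt (f x) * v x) \<bullet> (sqrt (f x) * w x) \<partial>\<mu>)"
proof -
  have [measurable]: "v \<in> borel_measurable \<mu>" "w \<in> borel_measurable \<mu>" by fact+
  have "AE x in \<mu>. f x * v x * w x = (sqrt (f x) * v x) \<bullet> (sqrt (f x) * w x)"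
    using f_nonneg_AE
  proof eventually_elim
    case (elim x)
    have "(sqrt (f x) * v x) \<bullet> (sqrt (f x) * w x) = (sqrt (f x) * sqrt (f x)) * (v x * w x)" by simp
    then show ?case using elim by simp
  qed
  then show ?thesis unfolding mass_def by (intro integral_cong_AE) measurable
qed

lemma mass_add_scaled:
  assumes v: "H10 \<Omega> v G" and w: "H10 \<Omega> w K"
  shows "mass (\<lambda>x. v x + t * w x) (\<lambda>x. v x + t * w x) = mass v v + 2 * mass v w * t + mass w w * t^2"
proof -
  note Lv = H10_sqrt_weight[OF v] and Lw = H10_sqrt_weight[OF w]
  have [measurable]: "v \<in> borel_measurable \<mu>" "w \<in> borel_measurable \<mu>"
    using H10_L2[OF domain v] H10_L2[OF domain w] by (auto dest: L2_measurable)
  have "mass (\<lambda>x. v x + t * w x) (\<lambda>x. v x + t * w x)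
      = (\<integral>x. (sqrt (f x) * (v x + t * w x)) \<bullet> (sqrt (f x) * (v x + t * w x)) \<partial>\<mu>)"
    by (rule mass_eq_inner) measurable
  also have "\<dots> = (\<integral>x. (sqrt (f x) * v x) \<bullet> (sqrt (f x) * v x) + 2 * t * ((sqrt (f x) * v x) \<bullet> (sqrt (f x) * w x))
      + t^2 * ((sqrt (f x) * w x) \<bullet> (sqrt (f x) * w x)) \<partial>\<mu>)"
    by (intro Bochner_Integration.integral_cong refl) (simp add: algebra_simps power2_eq_square)
  also have "\<dots> = mass v v + 2 * mass v w * t + mass w w * t^2"
    using L2_inner_integrable[OF Lv Lv] L2_inner_integrable[OF Lv Lw] L2_inner_integrable[OF Lw Lw]
    by (simp add: mass_eq_inner)
  finally show ?thesis .
qed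

section \<open>Existence of an eigenvalue and lower bounds for all eigenvalues\<close>

text \<open>Otherwise the bump functions, positive inside their balls, force f = 0 almost everywhere
  on every closed ball's interior in \<Omega>, hence almost everywhere in \<Omega>.\<close>

lemma exists_test_fun_mass_pos:
  obtains v g where "test_fun \<Omega> v g" "mass v v > 0"
proof (rule ccontr)
  assume neg: "\<not> thesis"
  have zero: "mass v v = 0" if "test_fun \<Omega> v g" for v g
    using that neg \<open>\<And>v g. test_fun \<Omega> v g \<Longrightarrow> mass v v > 0 \<Longrightarrow> thesis\<close> mass_nonneg[of v] by force
  define \<B> where "\<B> = {ball c r |c r. 0 < r \<and> cball c r \<subseteq> \<Omega>}"
  have "\<And>S. S \<in> \<B> \<Longrightarrow> open S" by (auto simp: \<B>_def)
  \<comment> \<open>Only countably many exceptional null sets may be united, so the family of balls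
    is first thinned out.\<close>
  then obtain \<C> where \<C>: "\<C> \<subseteq> \<B>" "countable \<C>" "\<Union>\<C> = \<Union>\<B>" by (rule Lindelof)
  have cover: "\<Omega> \<subseteq> \<Union>\<B>"
  proof
    fix x assume "x \<in> \<Omega>"
    then obtain e where "e > 0" "cball x e \<subseteq> \<Omega>" using open_domain open_contains_cball by blast
    then show "x \<in> \<Union>\<B>" unfolding \<B>_def using centre_in_ball by blast
  qed
  have "AE x in \<mu>. \<forall>S\<in>\<C>. x \<in> S \<longrightarrow> f x = 0"
  proof (subst AE_ball_countable[OF \<C>(2)], intro ballI)
    fix S assume "S \<in> \<C>"
    then obtain c r where S: "S = ball c r" "0 < r" "cball c r \<subseteq> \<Omega>" using \<C>(1) by (auto simp: \<B>_def)
    let ?v = "\<lambda>x. (max 0 (r^2 - (norm (x - c))^2))^2"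
    note t = test_fun_bump[OF S(2,3)]
    have "(\<integral>x. f x * (?v x)^2 \<partial>\<mu>) = 0"
      using zero[OF t] by (simp add: mass_def power2_eq_square mult.assoc)
    then have "AE x in \<mu>. f x * (?v x)^2 = 0"
      by (subst (asm) integral_nonneg_eq_0_iff_AE[OF test_fun_weight_integrable[OF t]])
         (use f_nonneg_AE in auto)
    then show "AE x in \<mu>. x \<in> S \<longrightarrow> f x = 0"
    proof eventually_elim
      case (elim x)
      show ?case
      proof
        assume "x \<in> S"
        then have "norm (x - c) < r" by (simp add: S dist_norm norm_minus_commute)
        then have "(norm (x - c))^2 < r^2" by (intro power_strict_mono) auto
        then show "f x = 0" using elim by auto
      qed
    qed
  qed
  then have "AE x in \<mu>. f x = 0"
    using AE_space
  proof eventually_elim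
    case (elim x)
    then have "x \<in> \<Union>\<C>" using cover \<C>(3) by auto
    then show ?case using elim by blast
  qed
  then show False using f_nonzero by (simp add: AE_lebesgue_on_iff[OF open_domain])
qed

text \<open>On a maximising sequence for the Rayleigh quotient, convergence in the (compact) weighted norm
  upgrades to convergence in energy by the parallelogram identity, so the maximum is attained.\<close>
lemma eigenvalue_exists: "\<exists>m. is_eigenvalue \<Omega> M f m"
proof -
  obtain C where C: "C > 0" "\<And>v g. test_fun \<Omega> v g \<Longrightarrow> mass v v \<le> C * energy g g"
    by (rule weight_bound_energy) blast
  \<comment> \<open>1 / \<Lambda> will be the eigenvalue. The constraint is an inequality so that
    the zero function satisfies it, which makes S nonempty.\<close>
  define S where "S = {mass v v |v g. test_fun \<Omega> v g \<and> energy g g \<le> 1}"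
  define \<Lambda> where "\<Lambda> = Sup S"
  have bdd: "bdd_above S"
  proof (rule bdd_aboveI)
    fix y assume "y \<in> S"
    then obtain v g where "y = mass v v" "test_fun \<Omega> v g" "energy g g \<le> 1" by (auto simp: S_def)
    then show "y \<le> C" using C(2)[of v g] C(1) by (meson mult_left_le order_less_imp_le order_trans)
  qed
  have scale: "mass (\<lambda>x. c * v x) (\<lambda>x. c * v x) = c^2 * mass v v" for c v
    unfolding mass_def integral_mult_right_zero[symmetric]
    by (intro Bochner_Integration.integral_cong refl) (simp add: power2_eq_square mult_ac)
  have scaleE: "energy_sq (\<lambda>x. c *\<^sub>R g x) = c^2 * energy g g" for c g
    unfolding energy_def integral_mult_right_zero[symmetric]
    by (intro Bochner_Integration.integral_cong refl)
       (simp add: matrix_vector_mult_scaleR power2_eq_square mult_ac)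
  have ray: "mass v v \<le> \<Lambda> * energy g g" if t: "test_fun \<Omega> v g" for v g
  proof (cases "energy g g = 0")
    case True then show ?thesis using C(2)[OF t] by simp
  next
    case False
    then have e: "energy g g > 0" using energy_nonneg[OF test_fun_L2(2)[OF domain t]] by simp
    define c where "c = 1 / sqrt (energy g g)"
    have c: "c^2 * energy g g = 1" using e by (simp add: c_def power_divide)
    have "c^2 * mass v v \<in> S"
      unfolding S_def using test_fun_scale[OF t, of c] c scale[of c v] scaleE[of c g]
      by (intro CollectI exI[of _ "\<lambda>x. c * v x"] exI[of _ "\<lambda>x. c *\<^sub>R g x"]) simp
    then have "c^2 * mass v v \<le> \<Lambda>" unfolding \<Lambda>_def by (rule cSup_upper[OF _ bdd])
    then have "(c^2 * mass v v) * energy g g \<le> \<Lambda> * energy g g" using e by (intro mult_right_mono) auto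
    moreover have "(c^2 * mass v v) * energy g g = mass v v" using c by (metis mult.assoc mult.commute mult_1)
    ultimately show ?thesis by simp
  qed
  have \<Lambda>: "\<Lambda> > 0"
  proof -
    obtain v g where t: "test_fun \<Omega> v g" and pos: "mass v v > 0" by (rule exists_test_fun_mass_pos)
    have "0 < \<Lambda> * energy g g" using ray[OF t] pos by simp
    then show ?thesis using energy_nonneg[OF test_fun_L2(2)[OF domain t]] by (simp add: zero_less_mult_iff)
  qed
  have "S \<noteq> {}"
  proof
    assume "S = {}"
    obtain v g where t: "test_fun \<Omega> v g" by (rule exists_test_fun_mass_pos)
    have "0 \<in> S" unfolding S_def
      using test_fun_scale[OF t, of 0] scale[of 0 v] scaleE[of 0 g]
      by (intro CollectI exI[of _ "\<lambda>x. 0 * v x"] exI[of _ "\<lambda>x. 0 *\<^sub>R g x"]) simp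
    then show False using \<open>S = {}\<close> by simp
  qed
  have "\<exists>v g. test_fun \<Omega> v g \<and> energy g g \<le> 1 \<and> \<Lambda> - inverse (real (Suc n)) < mass v v" for n
  proof -
    have "\<Lambda> - inverse (real (Suc n)) < Sup S" by (simp add: \<Lambda>_def)
    then obtain y where "y \<in> S" "\<Lambda> - inverse (real (Suc n)) < y" using less_cSup_iff[OF \<open>S \<noteq> {}\<close> bdd] by blast
    then show ?thesis unfolding S_def by blast
  qed
  then obtain v0 g0 where s0: "\<And>n. test_fun \<Omega> (v0 n) (g0 n)" "\<And>n. energy (g0 n) (g0 n) \<le> 1"
    "\<And>n. \<Lambda> - inverse (real (Suc n)) < mass (v0 n) (v0 n)" by metis
  have bnd: "L2sq \<mu> (g0 n) \<le> 1 / \<alpha>" for n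
    using \<alpha> s0(2)[of n]
    by (intro order_trans[OF norm_square_le_energy[OF test_fun_L2(2)[OF domain s0(1)]]] divide_right_mono) auto
  obtain k :: "nat \<Rightarrow> nat" where k: "strict_mono k"
    and cau: "\<And>e. e > 0 \<Longrightarrow> \<exists>N. \<forall>i\<ge>N. \<forall>j\<ge>N. (\<integral>x. f x * (v0 (k i) x - v0 (k j) x)^2 \<partial>\<mu>) < e"
    by (rule weight_compact[of v0 g0, OF s0(1) bnd]) blast
  define v where "v = (\<lambda>n. v0 (k n))"
  define g where "g = (\<lambda>n. g0 (k n))"
  have t: "test_fun \<Omega> (v n) (g n)" and E1: "energy (g n) (g n) \<le> 1" for n
    unfolding v_def g_def by (rule s0)+
  have mlow: "\<Lambda> - inverse (real (Suc n)) < mass (v n) (v n)" for n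
  proof -
    have "inverse (real (Suc (k n))) \<le> inverse (real (Suc n))"
      using seq_suble[OF k, of n] by (intro le_imp_inverse_le) auto
    then show ?thesis using s0(3)[of "k n"] unfolding v_def by linarith
  qed
  have mupp: "mass (v n) (v n) \<le> \<Lambda>" for n
    using ray[OF t, of n] mult_left_le[OF E1, of \<Lambda> n] \<Lambda> by linarith
  note Lt = test_fun_L2[OF domain t]
  have Ecau: "\<exists>N. \<forall>i\<ge>N. \<forall>j\<ge>N. energy_sq (\<lambda>x. g i x - g j x) < e" if e: "e > 0" for e
  proof -
    have "e * \<Lambda> / 2 > 0" using e \<Lambda> by simp
    from cau[OF this] obtain N1 where N1: "\<And>i j. i \<ge> N1 \<Longrightarrow> j \<ge> N1 \<Longrightarrow>
        mass (\<lambda>x. v i x - v j x) (\<lambda>x. v i x - v j x) < e * \<Lambda> / 2"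
      unfolding v_def mass_def by (auto simp: power2_eq_square mult.assoc)
    \<comment> \<open>The masses of two late members fall short of \<Lambda> by less than e
      \<Lambda> / 8 each and enter with factor 2, so they contribute less than e \<Lambda> / 2. The
      mass of the difference supplies the other half.\<close>
    obtain N2 :: nat where N2: "\<And>n. n \<ge> N2 \<Longrightarrow> inverse (real (Suc n)) < e * \<Lambda> / 8"
      using LIMSEQ_inverse_real_of_nat[THEN order_tendstoD(2), of "e * \<Lambda> / 8"] e \<Lambda>
      by (auto simp: eventually_sequentially)
    have "energy_sq (\<lambda>x. g i x - g j x) < e" if i: "i \<ge> max N1 N2" and j: "j \<ge> max N1 N2" for i j
    proof -
      have plus: "mass (\<lambda>x. v i x + v j x) (\<lambda>x. v i x + v j x) \<le> \<Lambda> * energy_sq (\<lambda>x. g i x + g j x)"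
        by (rule ray[OF test_fun_add[OF t t]])
      note H = H10_test_fun[OF domain t]
      have m1: "mass (\<lambda>x. v i x + v j x) (\<lambda>x. v i x + v j x) = mass (v i) (v i) + 2 * mass (v i) (v j) + mass (v j) (v j)"
        using mass_add_scaled[OF H H, of i 1 j] by simp
      have m2: "mass (\<lambda>x. v i x - v j x) (\<lambda>x. v i x - v j x) = mass (v i) (v i) - 2 * mass (v i) (v j) + mass (v j) (v j)"
        using mass_add_scaled[OF H H, of i "-1" j] by simp
      have e1: "energy_sq (\<lambda>x. g i x + g j x) = energy (g i) (g i) + 2 * energy (g i) (g j) + energy (g j) (g j)"
        using energy_add_scaled[OF Lt(2) Lt(2), of i 1 j] by simp
      have e2: "energy_sq (\<lambda>x. g i x - g j x) = energy (g i) (g i) - 2 * energy (g i) (g j) + energy (g j) (g j)"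
        using energy_add_scaled[OF Lt(2) Lt(2), of i "-1" j] by simp
      have "\<Lambda> * energy_sq (\<lambda>x. g i x - g j x)
          = 2 * (\<Lambda> * energy (g i) (g i)) + 2 * (\<Lambda> * energy (g j) (g j)) - \<Lambda> * energy_sq (\<lambda>x. g i x + g j x)"
        unfolding e1 e2 by (simp add: algebra_simps)
      also have "\<dots> \<le> 4 * \<Lambda> - mass (\<lambda>x. v i x + v j x) (\<lambda>x. v i x + v j x)"
        using plus mult_left_le[OF E1, of \<Lambda> i] mult_left_le[OF E1, of \<Lambda> j] \<Lambda> by linarith
      also have "\<dots> = 4 * \<Lambda> - 2 * mass (v i) (v i) - 2 * mass (v j) (v j) + mass (\<lambda>x. v i x - v j x) (\<lambda>x. v i x - v j x)"
        unfolding m1 m2 by simp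
      also have "\<dots> < \<Lambda> * e"
        using N1[of i j] N2[of i] N2[of j] mlow[of i] mlow[of j] i j by (simp add: mult.commute)
      finally show ?thesis using \<Lambda> by simp
    qed
    then show ?thesis by blast
  qed
  obtain D where D: "D > 0" "\<And>v g. test_fun \<Omega> v g \<Longrightarrow> (\<integral>x. (v x)^2 \<partial>\<mu>) \<le> D * L2sq \<mu> g"
    by (rule Poincare) blast
  have gle: "L2sq \<mu> (\<lambda>x. g i x - g j x) \<le> energy_sq (\<lambda>x. g i x - g j x) / \<alpha>" for i j
    by (rule norm_square_le_energy[OF L2_diff[OF Lt(2) Lt(2)]])
  obtain G where G: "L2 \<mu> G" "L2_tendsto \<mu> g G"
  proof (rule L2_complete[OF Lt(2)])
    fix e :: real assume "e > 0"
    then have "e * \<alpha> > 0" using \<alpha> by simp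
    from Ecau[OF this] obtain N where N: "\<And>i j. i \<ge> N \<Longrightarrow> j \<ge> N \<Longrightarrow> energy_sq (\<lambda>x. g i x - g j x) < e * \<alpha>" by blast
    have "L2sq \<mu> (\<lambda>x. g i x - g j x) < e" if "i \<ge> N" "j \<ge> N" for i j
      using le_less_trans[OF gle[of i j], of e] N[OF that] \<alpha> by (simp add: divide_less_eq)
    then show "\<exists>N. \<forall>i\<ge>N. \<forall>j\<ge>N. L2sq \<mu> (\<lambda>x. g i x - g j x) < e" by blast
  qed blast
  obtain u where u: "L2 \<mu> u" "L2_tendsto \<mu> v u"
  proof (rule L2_complete[OF Lt(1)])
    fix e :: real assume "e > 0"
    then have "e * \<alpha> / D > 0" using \<alpha> D by simp
    from Ecau[OF this] obtain N where N: "\<And>i j. i \<ge> N \<Longrightarrow> j \<ge> N \<Longrightarrow> energy_sq (\<lambda>x. g i x - g j x) < e * \<alpha> / D" by blast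
    have "L2sq \<mu> (\<lambda>x. v i x - v j x) < e" if "i \<ge> N" "j \<ge> N" for i j
    proof -
      have "L2sq \<mu> (\<lambda>x. v i x - v j x) \<le> D * L2sq \<mu> (\<lambda>x. g i x - g j x)"
        using D(2)[OF test_fun_diff[OF t t]] by simp
      also have "\<dots> \<le> D * (energy_sq (\<lambda>x. g i x - g j x) / \<alpha>)"
        using D(1) by (intro mult_left_mono gle) auto
      also have "\<dots> < e" using N[OF that] D(1) \<alpha> by (simp add: field_simps)
      finally show ?thesis .
    qed
    then show "\<exists>N. \<forall>i\<ge>N. \<forall>j\<ge>N. L2sq \<mu> (\<lambda>x. v i x - v j x) < e" by blast
  qed blast
  have H: "H10 \<Omega> u G" by (rule H10I[OF domain u(1) G(1) t u(2) G(2)])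
  have EG: "energy G G \<le> 1"
    by (rule LIMSEQ_le_const2[OF tendsto_energy[OF Lt(2) G]]) (use E1 in blast)
  \<comment> \<open>The embedding constant C bounds the weighted distance from v n to u by the
    energy of g n - G, which tends to 0.\<close>
  have mu: "mass u u = \<Lambda>"
  proof -
    have d: "H10 \<Omega> (\<lambda>x. v n x - u x) (\<lambda>x. g n x - G x)" for n
      using H10_add_scaled[OF domain H10_test_fun[OF domain t] H, of n "-1"] by simp
    have Ld: "L2 \<mu> (\<lambda>x. sqrt (f x) * (v n x - u x))" for n by (rule H10_sqrt_weight[OF d])
    note Lv = H10_sqrt_weight[OF H10_test_fun[OF domain t]] and Lu = H10_sqrt_weight[OF H]
    note mv = L2_measurable[OF Lt(1)] and mu = L2_measurable[OF u(1)]
    have lim: "L2_tendsto \<mu> (\<lambda>n x. sqrt (f x) * v n x) (\<lambda>x. sqrt (f x) * u x)"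
    proof (rule tendsto_sandwich[OF always_eventually always_eventually, of "\<lambda>_. 0"])
      show "\<forall>n. L2sq \<mu> (\<lambda>x. sqrt (f x) * v n x - sqrt (f x) * u x) \<le> C * energy_sq (\<lambda>x. g n x - G x)"
      proof
        fix n
        have "L2sq \<mu> (\<lambda>x. sqrt (f x) * v n x - sqrt (f x) * u x) = mass (\<lambda>x. v n x - u x) (\<lambda>x. v n x - u x)"
          by (subst mass_eq_inner)
             (auto intro!: borel_measurable_diff mv mu Bochner_Integration.integral_cong simp: power2_eq_square algebra_simps)
        also have "\<dots> \<le> C * energy_sq (\<lambda>x. g n x - G x)"
          by (rule weight_bound_extends(2)[OF C(2) d])
        finally show "L2sq \<mu> (\<lambda>x. sqrt (f x) * v n x - sqrt (f x) * u x) \<le> C * energy_sq (\<lambda>x. g n x - G x)" .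
      qed
      have "(\<lambda>n. energy_sq (\<lambda>x. g n x - G x)) \<longlonglongrightarrow> energy_sq (\<lambda>x. 0)"
        by (rule tendsto_energy) (use L2_diff[OF Lt(2) G(1)] G(2) in \<open>auto simp: L2_def\<close>)
      then show "(\<lambda>n. C * energy_sq (\<lambda>x. g n x - G x)) \<longlonglongrightarrow> 0"
        by (intro tendsto_mult_right_zero) (simp add: energy_def)
    qed auto
    have "(\<lambda>n. mass (v n) (v n)) \<longlonglongrightarrow> mass u u"
      unfolding mass_eq_inner[OF mv mv] mass_eq_inner[OF mu mu]
      by (rule tendsto_L2_inner[OF Lv Lu Lv Lu lim lim])
    moreover have "(\<lambda>n. mass (v n) (v n)) \<longlonglongrightarrow> \<Lambda>"
    proof (rule tendsto_sandwich[OF always_eventually always_eventually])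
      show "\<forall>n. \<Lambda> - inverse (real (Suc n)) \<le> mass (v n) (v n)" using mlow less_imp_le by blast
      show "\<forall>n. mass (v n) (v n) \<le> \<Lambda>" using mupp by blast
      show "(\<lambda>n. \<Lambda> - inverse (real (Suc n))) \<longlonglongrightarrow> \<Lambda>"
        using tendsto_diff[OF tendsto_const LIMSEQ_inverse_real_of_nat, of \<Lambda>] by simp
    qed auto
    ultimately show ?thesis by (rule LIMSEQ_unique)
  qed
  have "is_eigenvalue \<Omega> M f (1 / \<Lambda>)"
    unfolding is_eigenvalue_def set_integral_lebesgue_on[OF open_domain]
  proof (intro exI[of _ u] exI[of _ G] conjI allI impI H)
    show "\<not> (AE x in lebesgue. x \<in> \<Omega> \<longrightarrow> u x = 0)"
    proof
      assume "AE x in lebesgue. x \<in> \<Omega> \<longrightarrow> u x = 0"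
      then have "AE x in \<mu>. u x = 0" by (simp add: AE_lebesgue_on_iff[OF open_domain])
      then have "mass u u = 0" unfolding mass_def by (intro integral_eq_zero_AE) auto
      then show False using mu \<Lambda> by simp
    qed
    fix w K assume w: "H10 \<Omega> w K"
    \<comment> \<open>The quadratic in s is \<Lambda> times the energy minus the mass along the
      variation u + s w. Since it vanishes at s = 0, the discriminant bound forces the linear
      coefficient to vanish: this is the Euler equation.\<close>
    have "(\<Lambda> * energy G K - mass u w)^2 \<le> (\<Lambda> * energy G G - mass u u) * (\<Lambda> * energy K K - mass w w)"
    proof (rule quadratic_nonneg_imp_discriminant)
      fix s :: real
      have "mass (\<lambda>x. u x + s * w x) (\<lambda>x. u x + s * w x)
          \<le> \<Lambda> * energy_sq (\<lambda>x. G x + s *\<^sub>R K x)"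
        by (rule weight_bound_extends(2)[OF ray H10_add_scaled[OF domain H w]])
      then show "0 \<le> (\<Lambda> * energy G G - mass u u) + 2 * (\<Lambda> * energy G K - mass u w) * s + (\<Lambda> * energy K K - mass w w) * s^2"
        unfolding mass_add_scaled[OF H w] energy_add_scaled[OF H10_L2(2)[OF domain H] H10_L2(2)[OF domain w]]
        by (simp add: algebra_simps)
    qed
    \<comment> \<open>\<Lambda> = mass u u <= \<Lambda> * energy G G <= \<Lambda>.\<close>
    moreover have "\<Lambda> * energy G G - mass u u = 0"
      using mu EG \<Lambda> weight_bound_extends(2)[OF ray H] mult_left_le[OF EG, of \<Lambda>] by simp
    ultimately have "\<Lambda> * energy G K = mass u w" by simp
    then show "(\<integral>x. (M x *v G x) \<bullet> K x \<partial>\<mu>) = 1 / \<Lambda> * (\<integral>x. f x * u x * w x \<partial>\<mu>)"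
      unfolding energy_def mass_def using \<Lambda> by (simp add: field_simps)
  qed
  then show ?thesis by blast
qed

text \<open>The inequality extends to the eigenfunction v, whose energy is m times its mass. This
  mass is positive because the energy is, and it cancels.\<close>

lemma eigenvalue_ge:
  assumes test: "\<And>v g. test_fun \<Omega> v g \<Longrightarrow> c * mass v v \<le> energy g g" and c: "c > 0"
    and m: "is_eigenvalue \<Omega> M f m"
  shows "c \<le> m"
proof -
  obtain v G where v: "H10 \<Omega> v G" and nz: "\<not> (AE x in lebesgue. x \<in> \<Omega> \<longrightarrow> v x = 0)"
    and eq: "\<And>w K. H10 \<Omega> w K \<Longrightarrow> energy G K = m * mass v w"
    using m unfolding is_eigenvalue_def set_integral_lebesgue_on[OF open_domain] energy_def mass_def by blast
  have "mass v v \<le> 1 / c * energy G G"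
  proof (rule weight_bound_extends(2)[OF _ v])
    show "mass v v \<le> 1 / c * energy g g" if "test_fun \<Omega> v g" for v g
      using test[OF that] c by (simp add: field_simps)
  qed
  then have le: "c * mass v v \<le> m * mass v v" using eq[OF v] c by (simp add: field_simps)
  have "m * mass v v > 0" using eq[OF v] energy_pos[OF v nz] by simp
  then have "mass v v > 0" using mass_nonneg[of v] by (cases "mass v v = 0") auto
  then show ?thesis using le by simp
qed

end

section \<open>The absorption term\<close>

text \<open>\<open>Hfun\<close> and \<open>psifun\<close> are Lebesgue set integrals; for continuous
  integrands they agree with gauge integrals, to which the fundamental theorem of calculus
  applies.\<close>

lemma set_integral_from_0:
  fixes q :: "real \<Rightarrow> real"
  assumes q: "continuous_on {0..\<sigma>} q"
  shows set_integral_from_0_eq: "\<And>s. s \<in> {0..\<sigma>} \<Longrightarrow> (LINT t:{0..s}|lborel. q t) = integral {0..s} q"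
    and set_integral_from_0_deriv: "\<And>s. s \<in> {0..\<sigma>} \<Longrightarrow>
      ((\<lambda>s. LINT t:{0..s}|lborel. q t) has_real_derivative q s) (at s within {0..\<sigma>})"
    and set_integral_from_0_mono: "\<And>s t. (\<And>x. x \<in> {0..\<sigma>} \<Longrightarrow> 0 \<le> q x) \<Longrightarrow> 0 \<le> s \<Longrightarrow> s \<le> t \<Longrightarrow> t \<le> \<sigma> \<Longrightarrow>
      (LINT t:{0..s}|lborel. q t) \<le> (LINT t:{0..t}|lborel. q t)"
proof -
  have cs: "continuous_on {0..s} q" if "s \<in> {0..\<sigma>}" for s
    using that by (intro continuous_on_subset[OF q]) auto
  show eq: "(LINT t:{0..s}|lborel. q t) = integral {0..s} q" if "s \<in> {0..\<sigma>}" for s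
    by (rule set_borel_integral_eq_integral(2)[OF borel_integrable_atLeastAtMost'[OF cs[OF that]]])
  show "((\<lambda>s. LINT t:{0..s}|lborel. q t) has_real_derivative q s) (at s within {0..\<sigma>})" if s: "s \<in> {0..\<sigma>}" for s
    by (rule has_field_derivative_transform_within[OF integral_has_real_derivative[OF q s], of 1])
       (use s eq in auto)
  show "(LINT t:{0..s}|lborel. q t) \<le> (LINT t:{0..t}|lborel. q t)"
    if "\<And>x. x \<in> {0..\<sigma>} \<Longrightarrow> 0 \<le> q x" "0 \<le> s" "s \<le> t" "t \<le> \<sigma>" for s t
  proof -
    have "integral {0..s} q \<le> integral {0..t} q"
      using that by (intro integral_subset_le integrable_continuous_real cs) auto
    then show ?thesis using that by (simp add: eq)
  qed
qed

text \<open>Approximants of u may take values outside [0, \<sigma>], so the chain rule wants a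
  function on the whole line with bounded continuous derivative. The derivative is continued by its
  boundary values; an antiderivative differs from \<open>\<theta>\<close> by a constant on the
  interval.\<close>

lemma C1_extension:
  fixes \<theta> \<kappa> :: "real \<Rightarrow> real"
  assumes \<sigma>: "0 \<le> \<sigma>" and d: "\<And>s. s \<in> {0..\<sigma>} \<Longrightarrow> (\<theta> has_real_derivative \<kappa> s) (at s within {0..\<sigma>})"
    and c: "continuous_on {0..\<sigma>} \<kappa>"
  obtains \<Theta> k B where "\<And>s. (\<Theta> has_real_derivative k s) (at s)" "continuous_on UNIV k" "\<And>s. \<bar>k s\<bar> \<le> B"
    "\<And>s. s \<in> {0..\<sigma>} \<Longrightarrow> \<Theta> s = \<theta> s" "\<And>s. s \<in> {0..\<sigma>} \<Longrightarrow> k s = \<kappa> s"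
proof -
  define k where "k = (\<lambda>s. \<kappa> (max 0 (min s \<sigma>)))"
  have k: "continuous_on UNIV k"
    unfolding k_def by (rule continuous_on_compose2[OF c]) (use \<sigma> in \<open>auto intro!: continuous_intros\<close>)
  have keq: "k s = \<kappa> s" if "s \<in> {0..\<sigma>}" for s using that by (simp add: k_def)
  have "compact (\<kappa> ` {0..\<sigma>})" by (intro compact_continuous_image c) simp
  then obtain B where "\<forall>y\<in>\<kappa> ` {0..\<sigma>}. norm y \<le> B"
    using compact_imp_bounded[of "\<kappa> ` {0..\<sigma>}"] unfolding bounded_iff by blast
  then have B: "\<bar>\<kappa> s\<bar> \<le> B" if "s \<in> {0..\<sigma>}" for s using that by auto
  have kB: "\<bar>k s\<bar> \<le> B" for s unfolding k_def using \<sigma> by (intro B) auto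
  have "\<exists>F. \<forall>x::real. (-\<infinity>::ereal) < x \<longrightarrow> x < (\<infinity>::ereal) \<longrightarrow> (F has_vector_derivative k x) (at x)"
    by (rule einterval_antiderivative) (use k in \<open>auto simp: continuous_on_eq_continuous_at\<close>)
  then obtain F where F: "\<And>x. (F has_real_derivative k x) (at x)"
    by (auto simp: has_real_derivative_iff_has_vector_derivative)
  have "\<exists>C. \<forall>s\<in>{0..\<sigma>}. \<theta> s - F s = C"
  proof (rule has_field_derivative_zero_constant)
    fix s assume s: "s \<in> {0..\<sigma>}"
    have "((\<lambda>s. \<theta> s - F s) has_real_derivative \<kappa> s - k s) (at s within {0..\<sigma>})"
      by (intro DERIV_diff d s has_field_derivative_at_within[OF F])
    then show "((\<lambda>s. \<theta> s - F s) has_real_derivative 0) (at s within {0..\<sigma>})" using keq[OF s] by simp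
  qed simp
  then obtain C where C: "\<And>s. s \<in> {0..\<sigma>} \<Longrightarrow> \<theta> s - F s = C" by blast
  have "((\<lambda>s. F s + C) has_real_derivative k s) (at s)" for s
    using DERIV_add[OF F DERIV_const, of C s] by simp
  then show thesis
    by (rule that[of "\<lambda>s. F s + C" k B]) (use k kB keq C in \<open>auto simp: algebra_simps\<close>)
qed

section \<open>The truncated absorption and its integrals\<close>

locale absorption =
  fixes h :: "real \<Rightarrow> real" and \<sigma> \<alpha> :: real
  assumes \<alpha>0: "0 < \<alpha>" and \<sigma>: "0 < \<sigma>"
    and h_cont: "continuous_on {0..<\<sigma>} h" and h_nonneg: "\<forall>s\<in>{0..<\<sigma>}. 0 \<le> h s"
    and h_mono: "strict_mono_on {0..<\<sigma>} h"
    and h_int: "set_integrable lborel {0<..<\<sigma>} h"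
begin

text \<open>Clamping below at 0 as well makes the truncation continuous on the whole line.\<close>

definition trunc :: "real \<Rightarrow> real \<Rightarrow> real" where
  "trunc c s = h (max 0 (min s c))"

lemma trunc_cont:
  assumes "0 \<le> c" "c < \<sigma>"
  shows "continuous_on S (trunc c)"
  unfolding trunc_def
  by (rule continuous_on_compose2[OF h_cont]) (use assms in \<open>auto intro!: continuous_intros\<close>)

lemma trunc_nonneg: "0 \<le> c \<Longrightarrow> c < \<sigma> \<Longrightarrow> 0 \<le> trunc c s"
  unfolding trunc_def using h_nonneg by simp

lemma trunc_eq: "0 \<le> s \<Longrightarrow> s \<le> c \<Longrightarrow> trunc c s = h s"
  by (simp add: trunc_def)

lemma trunc_le: "0 \<le> c \<Longrightarrow> 0 \<le> s \<Longrightarrow> s < \<sigma> \<Longrightarrow> trunc c s \<le> h s"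
  unfolding trunc_def
  using strict_mono_on_leD[OF h_mono, of "max 0 (min s c)" s] by simp

text \<open>The closed interval used in \<open>Hfun\<close> contains \<sigma>, where h has an
  arbitrary value; the endpoints form a null set.\<close>

lemma set_integrable_h: "set_integrable lborel {0..\<sigma>} h"
proof -
  have "set_integrable lborel {0<..<\<sigma>} h \<longleftrightarrow> set_integrable lborel {0..\<sigma>} h"
    unfolding set_integrable_def
  proof (rule integrable_cong_AE)
    show "(\<lambda>x. indicator {0<..<\<sigma>} x *\<^sub>R h x) \<in> borel_measurable lborel"
      using h_int unfolding set_integrable_def by (rule borel_measurable_integrable)
    then have "(\<lambda>x. indicator {0<..<\<sigma>} x *\<^sub>R h x + indicator {0} x * h 0 + indicator {\<sigma>} x * h \<sigma>) \<in> borel_measurable lborel"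
      by measurable
    then show "(\<lambda>x. indicator {0..\<sigma>} x *\<^sub>R h x) \<in> borel_measurable lborel"
      by (rule measurable_cong[THEN iffD1, rotated]) (use \<sigma> in \<open>auto simp: indicator_def\<close>)
    show "AE x in lborel. indicator {0<..<\<sigma>} x *\<^sub>R h x = indicator {0..\<sigma>} x *\<^sub>R h x"
      using AE_lborel_singleton[of 0] AE_lborel_singleton[of \<sigma>] by eventually_elim (auto simp: indicator_def)
  qed
  then show ?thesis using h_int by simp
qed

context
  fixes c :: real
  assumes c: "0 \<le> c" "c < \<sigma>"
begin

lemma Hfun_trunc_deriv:
  "s \<in> {0..\<sigma>} \<Longrightarrow> (Hfun \<alpha> (trunc c) has_real_derivative trunc c s / \<alpha>) (at s within {0..\<sigma>})"
  unfolding Hfun_def[abs_def]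
  using DERIV_cmult[OF set_integral_from_0_deriv[OF trunc_cont[OF c]], of s \<sigma> "1 / \<alpha>"] by simp

lemma Hfun_trunc_mono: "0 \<le> s \<Longrightarrow> s \<le> t \<Longrightarrow> t \<le> \<sigma> \<Longrightarrow> Hfun \<alpha> (trunc c) s \<le> Hfun \<alpha> (trunc c) t"
  unfolding Hfun_def using \<alpha>0
  by (intro mult_left_mono set_integral_from_0_mono[OF trunc_cont[OF c]] trunc_nonneg[OF c]) auto

lemma Hfun_trunc_nonneg: "s \<in> {0..\<sigma>} \<Longrightarrow> 0 \<le> Hfun \<alpha> (trunc c) s"
  using Hfun_trunc_mono[of 0 s] set_integral_from_0_eq[OF trunc_cont[OF c], of 0 \<sigma>] \<sigma> by (simp add: Hfun_def)

lemma Hfun_trunc_le: "Hfun \<alpha> (trunc c) \<sigma> \<le> Hfun \<alpha> h \<sigma>"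
proof -
  have "(LINT t:{0..\<sigma>}|lborel. trunc c t) \<le> (LINT t:{0..\<sigma>}|lborel. h t)"
    unfolding set_lebesgue_integral_def
  proof (rule integral_mono_AE)
    show "integrable lborel (\<lambda>t. indicator {0..\<sigma>} t *\<^sub>R trunc c t)"
      using borel_integrable_atLeastAtMost'[OF trunc_cont[OF c], of 0 \<sigma>] by (simp add: set_integrable_def)
    show "integrable lborel (\<lambda>t. indicator {0..\<sigma>} t *\<^sub>R h t)"
      using set_integrable_h by (simp add: set_integrable_def)
    show "AE t in lborel. indicator {0..\<sigma>} t *\<^sub>R trunc c t \<le> indicator {0..\<sigma>} t *\<^sub>R h t"
      using AE_lborel_singleton[of \<sigma>] by eventually_elim (use trunc_le[OF c(1)] in \<open>auto simp: indicator_def\<close>)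
  qed
  then show ?thesis unfolding Hfun_def using \<alpha>0 by (intro mult_left_mono) auto
qed

lemma exp_Hfun_cont: "continuous_on {0..\<sigma>} (\<lambda>s. exp (- Hfun \<alpha> (trunc c) s))"
  by (intro continuous_on_exp continuous_on_minus, rule DERIV_continuous_on, rule Hfun_trunc_deriv)

lemma psifun_trunc_deriv:
  "s \<in> {0..\<sigma>} \<Longrightarrow> (psifun \<alpha> (trunc c) has_real_derivative exp (- Hfun \<alpha> (trunc c) s)) (at s within {0..\<sigma>})"
  unfolding psifun_def[abs_def] by (rule set_integral_from_0_deriv[OF exp_Hfun_cont])

lemma psifun_trunc_mono: "0 \<le> s \<Longrightarrow> s \<le> t \<Longrightarrow> t \<le> \<sigma> \<Longrightarrow> psifun \<alpha> (trunc c) s \<le> psifun \<alpha> (trunc c) t"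
  unfolding psifun_def by (intro set_integral_from_0_mono[OF exp_Hfun_cont]) auto

lemma psifun_trunc_nonneg: "s \<in> {0..\<sigma>} \<Longrightarrow> 0 \<le> psifun \<alpha> (trunc c) s"
  using psifun_trunc_mono[of 0 s] set_integral_from_0_eq[OF exp_Hfun_cont, of 0] \<sigma> by (simp add: psifun_def)

text \<open>The integrand decreases to its value at \<sigma>, which \<open>Hfun_trunc_le\<close>
  bounds below. The bound does not depend on c, so it survives the limit and yields
  \<open>psifun_pos\<close>.\<close>

lemma psifun_trunc_ge: "\<sigma> * exp (- Hfun \<alpha> h \<sigma>) \<le> psifun \<alpha> (trunc c) \<sigma>"
proof -
  have "integral {0..\<sigma>} (\<lambda>s. exp (- Hfun \<alpha> h \<sigma>)) \<le> integral {0..\<sigma>} (\<lambda>s. exp (- Hfun \<alpha> (trunc c) s))"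
  proof (intro integral_le integrable_continuous_real exp_Hfun_cont)
    fix s assume "s \<in> {0..\<sigma>}"
    then show "exp (- Hfun \<alpha> h \<sigma>) \<le> exp (- Hfun \<alpha> (trunc c) s)"
      using Hfun_trunc_mono[of s \<sigma>] Hfun_trunc_le by simp
  qed simp
  then show ?thesis
    unfolding psifun_def using set_integral_from_0_eq[OF exp_Hfun_cont, of \<sigma>] \<sigma> by simp
qed

text \<open>The logarithmic derivative of \<open>\<psi> + \<epsilon>\<close>. Its Riccati equation makes the test function \<open>v\<^sup>2 \<Theta>(u)\<close> cancel
  the truncated absorption term and leave a complete square (Picone's identity).\<close>
lemma Picone_function:
  assumes \<epsilon>: "\<epsilon> > 0"
  obtains \<Theta> k B where "\<And>s. (\<Theta> has_real_derivative k s) (at s)" "continuous_on UNIV k" "\<And>s. \<bar>k s\<bar> \<le> B"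
    "\<And>s. s \<in> {0..\<sigma>} \<Longrightarrow> \<Theta> s \<le> 1 / \<epsilon>"
    "\<And>s. s \<in> {0..\<sigma>} \<Longrightarrow> exp (- Hfun \<alpha> h \<sigma>) / (psifun \<alpha> (trunc c) \<sigma> + \<epsilon>) \<le> \<Theta> s"
    "\<And>s. s \<in> {0..\<sigma>} \<Longrightarrow> k s = - (trunc c s / \<alpha>) * \<Theta> s - (\<Theta> s)^2"
proof -
  define E where "E = (\<lambda>s. exp (- Hfun \<alpha> (trunc c) s))"
  \<comment> \<open>\<psi> vanishes at 0; \<epsilon> bounds the denominator away from zero.\<close>
  define W where "W = (\<lambda>s. psifun \<alpha> (trunc c) s + \<epsilon>)"
  define \<theta> where "\<theta> = (\<lambda>s. E s / W s)"
  \<comment> \<open>The quotient rule for E / W, with E' = - (\<open>trunc c s\<close> / \<alpha>) E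
    and W' = E.\<close>
  define \<kappa> where "\<kappa> = (\<lambda>s. - (trunc c s / \<alpha>) * \<theta> s - (\<theta> s)^2)"
  have W: "\<epsilon> \<le> W s" "W s > 0" if "s \<in> {0..\<sigma>}" for s
    using psifun_trunc_nonneg[OF that] \<epsilon> by (auto simp: W_def)
  have dE: "(E has_real_derivative - (trunc c s / \<alpha>) * E s) (at s within {0..\<sigma>})" if "s \<in> {0..\<sigma>}" for s
    unfolding E_def by (rule derivative_eq_intros Hfun_trunc_deriv[OF that] refl | simp)+
  have dW: "(W has_real_derivative E s) (at s within {0..\<sigma>})" if "s \<in> {0..\<sigma>}" for s
    unfolding W_def E_def by (rule derivative_eq_intros psifun_trunc_deriv[OF that] refl | simp)+
  have d\<theta>: "(\<theta> has_real_derivative \<kappa> s) (at s within {0..\<sigma>})" if "s \<in> {0..\<sigma>}" for s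
  proof -
    have "((\<lambda>s. E s / W s) has_real_derivative ((- (trunc c s / \<alpha>) * E s) * W s - E s * E s) / (W s * W s)) (at s within {0..\<sigma>})"
      by (rule DERIV_divide[OF dE[OF that] dW[OF that]]) (use W[OF that] in simp)
    moreover have "((- (trunc c s / \<alpha>) * E s) * W s - E s * E s) / (W s * W s) = \<kappa> s"
      using W(2)[OF that] by (simp add: \<kappa>_def \<theta>_def field_simps power2_eq_square)
    ultimately show ?thesis unfolding \<theta>_def by simp
  qed
  have c\<theta>: "continuous_on {0..\<sigma>} \<theta>" by (rule DERIV_continuous_on[OF d\<theta>])
  have "continuous_on {0..\<sigma>} \<kappa>"
    unfolding \<kappa>_def using \<alpha>0 by (intro continuous_intros c\<theta> trunc_cont[OF c]) auto
  then obtain \<Theta> k B where ext: "\<And>s. (\<Theta> has_real_derivative k s) (at s)" "continuous_on UNIV k" "\<And>s. \<bar>k s\<bar> \<le> B"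
    "\<And>s. s \<in> {0..\<sigma>} \<Longrightarrow> \<Theta> s = \<theta> s" "\<And>s. s \<in> {0..\<sigma>} \<Longrightarrow> k s = \<kappa> s"
    by (rule C1_extension[OF less_imp_le[OF \<sigma>] d\<theta>, rotated]) blast+
  show thesis
  proof (rule that[OF ext(1-3)])
    fix s assume s: "s \<in> {0..\<sigma>}"
    have E1: "E s \<le> 1" using Hfun_trunc_nonneg[OF s] by (simp add: E_def)
    show "\<Theta> s \<le> 1 / \<epsilon>"
      unfolding ext(4)[OF s] \<theta>_def using W[OF s] E1 \<epsilon> by (intro frac_le) auto
    have "exp (- Hfun \<alpha> h \<sigma>) \<le> E s"
      using Hfun_trunc_mono[of s \<sigma>] Hfun_trunc_le s by (simp add: E_def)
    moreover have "W s \<le> psifun \<alpha> (trunc c) \<sigma> + \<epsilon>" using psifun_trunc_mono[of s \<sigma>] s by (simp add: W_def)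
    ultimately show "exp (- Hfun \<alpha> h \<sigma>) / (psifun \<alpha> (trunc c) \<sigma> + \<epsilon>) \<le> \<Theta> s"
      unfolding ext(4)[OF s] \<theta>_def using W[OF s] by (intro frac_le) (auto simp: E_def)
    show "k s = - (trunc c s / \<alpha>) * \<Theta> s - (\<Theta> s)^2"
      unfolding ext(4,5)[OF s] \<kappa>_def ..
  qed
qed

end

section \<open>Removal of the truncation\<close>

definition cut :: "nat \<Rightarrow> real" where
  "cut n = \<sigma> * (1 - inverse (real (Suc n)))"

lemma cut_bounds: "0 \<le> cut n" "cut n < \<sigma>"
  using \<sigma> by (auto simp: cut_def field_simps)

lemma eventually_cut_ge: "s < \<sigma> \<Longrightarrow> \<forall>\<^sub>F n in sequentially. s \<le> cut n"
proof -
  assume "s < \<sigma>"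
  have "cut \<longlonglongrightarrow> \<sigma> * (1 - 0)"
    unfolding cut_def by (intro tendsto_intros LIMSEQ_inverse_real_of_nat)
  then have "\<forall>\<^sub>F n in sequentially. s < cut n" using \<open>s < \<sigma>\<close> by (intro order_tendstoD) auto
  then show ?thesis by eventually_elim simp
qed

text \<open>For fixed t < \<sigma> the truncation is inactive on [0, t] once the cut has passed t,
  so the integrands are eventually equal to their limit; they are bounded by 1.\<close>

lemma psifun_trunc_tendsto:
  "(\<lambda>n. psifun \<alpha> (trunc (cut n)) \<sigma>) \<longlonglongrightarrow> psifun \<alpha> h \<sigma>"
proof -
  define e where "e = (\<lambda>n t. exp (- Hfun \<alpha> (trunc (cut n)) t))"
  define e' where "e' = (\<lambda>t. exp (- Hfun \<alpha> h t))"
  have lim: "(\<lambda>n. e n t) \<longlonglongrightarrow> e' t" if t: "0 \<le> t" "t < \<sigma>" for t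
  proof (rule tendsto_eventually)
    show "\<forall>\<^sub>F n in sequentially. e n t = e' t"
      using eventually_cut_ge[OF t(2)]
    proof eventually_elim
      case (elim n)
      have "(LINT s:{0..t}|lborel. trunc (cut n) s) = (LINT s:{0..t}|lborel. h s)"
        by (rule set_lebesgue_integral_cong) (use elim trunc_eq in auto)
      then show ?case by (simp add: e_def e'_def Hfun_def)
    qed
  qed
  have int: "set_integrable lborel {0..\<sigma>} (e n)" for n
    unfolding e_def by (rule borel_integrable_atLeastAtMost'[OF exp_Hfun_cont[OF cut_bounds]])
  have em: "(\<lambda>t. indicator {0..\<sigma>} t * e n t) \<in> borel_measurable lborel" for n
    using borel_measurable_integrable[OF int[unfolded set_integrable_def]] by simp
  \<comment> \<open>The point \<sigma> is removed because pointwise convergence is known only below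
    it; its value is restored afterwards.\<close>
  have m1: "(\<lambda>t. indicator {0..<\<sigma>} t * (indicator {0..\<sigma>} t * e n t)) \<in> borel_measurable lborel" for n
    using em by measurable
  have "(\<lambda>t. indicator {0..<\<sigma>} t * e' t) \<in> borel_measurable lborel"
  proof (rule borel_measurable_LIMSEQ_real[OF _ m1])
    show "(\<lambda>n. indicator {0..<\<sigma>} t * (indicator {0..\<sigma>} t * e n t)) \<longlonglongrightarrow> indicator {0..<\<sigma>} t * e' t" for t
      using lim[of t] by (auto simp: indicator_def)
  qed
  then have "(\<lambda>t. indicator {0..<\<sigma>} t * e' t + indicator {\<sigma>} t * e' \<sigma>) \<in> borel_measurable lborel"
    by measurable
  then have m2: "(\<lambda>t. indicator {0..\<sigma>} t *\<^sub>R e' t) \<in> borel_measurable lborel"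
    by (rule measurable_cong[THEN iffD1, rotated]) (use \<sigma> in \<open>auto simp: indicator_def\<close>)
  have "(\<lambda>n. \<integral>t. indicator {0..\<sigma>} t *\<^sub>R e n t \<partial>lborel) \<longlonglongrightarrow> (\<integral>t. indicator {0..\<sigma>} t *\<^sub>R e' t \<partial>lborel)"
  proof (rule integral_dominated_convergence[where w="\<lambda>t. indicator {0..\<sigma>} t"])
    show "AE t in lborel. (\<lambda>n. indicator {0..\<sigma>} t *\<^sub>R e n t) \<longlonglongrightarrow> indicator {0..\<sigma>} t *\<^sub>R e' t"
      using AE_lborel_singleton[of \<sigma>]
      by eventually_elim (use lim in \<open>auto simp: indicator_def\<close>)
    show "AE t in lborel. norm (indicator {0..\<sigma>} t *\<^sub>R e n t) \<le> indicator {0..\<sigma>} t" for n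
      using Hfun_trunc_nonneg[OF cut_bounds, of _ n] by (auto simp: indicator_def e_def)
    show "integrable lborel (indicator {0..\<sigma>} :: real \<Rightarrow> real)"
      by (rule integrable_real_indicator) (auto simp: emeasure_lborel_Icc_eq)
  qed (use m2 em in auto)
  then show ?thesis by (simp add: psifun_def set_lebesgue_integral_def e_def e'_def)
qed

lemma psifun_pos: "psifun \<alpha> h \<sigma> > 0"
proof -
  have "0 < \<sigma> * exp (- Hfun \<alpha> h \<sigma>)" using \<sigma> by simp
  also have "\<dots> \<le> psifun \<alpha> h \<sigma>"
    by (rule LIMSEQ_le_const[OF psifun_trunc_tendsto]) (use psifun_trunc_ge[OF cut_bounds] in blast)
  finally show ?thesis .
qed

end

section \<open>A chain rule in \<open>H\<^sub>0\<^sup>1\<close>\<close>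

text \<open>\<Theta>(u) alone need not vanish on the boundary, hence the factor \<eta>. The products
  of \<eta> with \<Theta>(\<phi>_n) are test functions. As k is bounded, \<Theta> is Lipschitz,
  which settles the values and the term with e. The remaining term is split as k(\<phi>_n)(g_n - G)
  + k(\<phi>_n) G: a bounded multiple of a null sequence, and a sequence with an integrable
  majorant.\<close>

lemma H10_mult_compose:
  fixes \<Omega> :: "(real^'n) set"
  assumes \<Omega>: "open \<Omega>" "bounded \<Omega>" and \<eta>: "test_fun \<Omega> \<eta> e" and u: "H10 \<Omega> u G"
    and d: "\<And>s. (\<Theta> has_real_derivative k s) (at s)" and k: "continuous_on UNIV k" and B: "\<And>s. \<bar>k s\<bar> \<le> B"
  shows "H10 \<Omega> (\<lambda>x. \<eta> x * \<Theta> (u x)) (\<lambda>x. (\<eta> x * k (u x)) *\<^sub>R G x + \<Theta> (u x) *\<^sub>R e x)"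
proof -
  let ?\<mu> = "lebesgue_on \<Omega>"
  interpret finite_measure ?\<mu> by (rule finite_measure_lebesgue_on_bounded[OF \<Omega>])
  obtain \<phi>0 g0 where L: "L2 ?\<mu> u" "L2 ?\<mu> G" and t0: "\<And>k. test_fun \<Omega> (\<phi>0 k) (g0 k)"
    and l01: "L2_tendsto ?\<mu> \<phi>0 u"
    and l02: "L2_tendsto ?\<mu> g0 G"
    by (rule H10E[OF \<Omega> u]) blast
  \<comment> \<open>Since k is merely continuous, the convergence of k(\<phi>_n) to k(u) is obtained
    pointwise, along this subsequence.\<close>
  obtain r :: "nat \<Rightarrow> nat" where r: "strict_mono r" and ae: "AE x in ?\<mu>. (\<lambda>n. \<phi>0 (r n) x) \<longlonglongrightarrow> u x"
    by (rule tendsto_L2_AE_subseq[OF test_fun_L2(1)[OF \<Omega> t0] L(1) l01]) blast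
  define \<phi> where "\<phi> = (\<lambda>n. \<phi>0 (r n))"
  define g where "g = (\<lambda>n. g0 (r n))"
  have t: "test_fun \<Omega> (\<phi> n) (g n)" for n unfolding \<phi>_def g_def by (rule t0)
  have l1: "L2_tendsto ?\<mu> \<phi> u"
    using LIMSEQ_subseq_LIMSEQ[OF l01 r] by (simp add: \<phi>_def comp_def)
  have l2: "L2_tendsto ?\<mu> g G"
    using LIMSEQ_subseq_LIMSEQ[OF l02 r] by (simp add: g_def comp_def)
  note Lt = test_fun_L2[OF \<Omega> t] and Le = test_fun_L2[OF \<Omega> \<eta>]
  obtain C where C: "C \<ge> 0" "\<And>x. \<bar>\<eta> x\<bar> \<le> C" "\<And>x. norm (e x) \<le> C"
    by (rule test_fun_bounded[OF \<eta>]) blast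
  have B0: "0 \<le> B" using B[of 0] by linarith
  have lip: "\<bar>\<Theta> a - \<Theta> b\<bar> \<le> B * \<bar>a - b\<bar>" for a b
  proof -
    have "norm (\<Theta> a - \<Theta> b) \<le> B * norm (a - b)"
      by (rule field_differentiable_bound[of UNIV \<Theta> k]) (use d B in auto)
    then show ?thesis by simp
  qed
  have c\<Theta>: "continuous_on UNIV \<Theta>"
    by (intro continuous_at_imp_continuous_on ballI DERIV_isCont[OF d])
  have [measurable]: "k \<in> borel_measurable borel" "\<Theta> \<in> borel_measurable borel"
    using k c\<Theta> by (auto intro: borel_measurable_continuous_onI)
  have [measurable]: "u \<in> borel_measurable ?\<mu>" "G \<in> borel_measurable ?\<mu>" "\<eta> \<in> borel_measurable ?\<mu>" "e \<in> borel_measurable ?\<mu>"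
    "\<phi> n \<in> borel_measurable ?\<mu>" "g n \<in> borel_measurable ?\<mu>" for n
    using L Lt Le by (auto dest: L2_measurable)
  have L\<Theta>: "L2 ?\<mu> (\<lambda>x. \<Theta> (w x))" if w: "L2 ?\<mu> w" for w
  proof -
    have [measurable]: "w \<in> borel_measurable ?\<mu>" using w by (rule L2_measurable)
    have "integrable ?\<mu> (\<lambda>x. (norm (\<Theta> (w x)))^2)"
    proof (rule Bochner_Integration.integrable_bound)
      show "integrable ?\<mu> (\<lambda>x. 2 * (B^2 * (norm (w x))^2) + 2 * (\<Theta> 0)^2)"
        using L2_integrable_square[OF w] by simp
      show "AE x in ?\<mu>. norm ((norm (\<Theta> (w x)))^2) \<le> norm (2 * (B^2 * (norm (w x))^2) + 2 * (\<Theta> 0)^2)"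
      proof (intro always_eventually allI)
        fix x
        have "(\<Theta> (w x))^2 \<le> 2 * (\<Theta> (w x) - \<Theta> 0)^2 + 2 * (\<Theta> 0)^2"
          using norm_add_square_le[of "\<Theta> (w x) - \<Theta> 0" "\<Theta> 0"] by simp
        also have "(\<Theta> (w x) - \<Theta> 0)^2 \<le> (B * \<bar>w x\<bar>)^2"
          using lip[of "w x" 0] B0 by (simp add: abs_le_square_iff[symmetric] abs_mult)
        finally show "norm ((norm (\<Theta> (w x)))^2) \<le> norm (2 * (B^2 * (norm (w x))^2) + 2 * (\<Theta> 0)^2)"
          by (simp add: power_mult_distrib)
      qed
    qed measurable
    then show ?thesis by (simp add: L2_def)
  qed
  have L\<eta>: "L2 ?\<mu> (\<lambda>x. \<eta> x *\<^sub>R \<Theta> (w x))" if w: "L2 ?\<mu> w" for w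
    by (rule L2_mult_bounded[OF L\<Theta>[OF w], of _ C]) (use C in auto)
  have Le': "L2 ?\<mu> (\<lambda>x. \<Theta> (w x) *\<^sub>R e x)" if w: "L2 ?\<mu> w" for w
  proof -
    have [measurable]: "w \<in> borel_measurable ?\<mu>" using w by (rule L2_measurable)
    have "integrable ?\<mu> (\<lambda>x. (norm (\<Theta> (w x) *\<^sub>R e x))^2)"
    proof (rule Bochner_Integration.integrable_bound)
      show "integrable ?\<mu> (\<lambda>x. (norm (\<Theta> (w x)))^2 * C^2)"
        using L2_integrable_square[OF L\<Theta>[OF w]] by simp
      show "AE x in ?\<mu>. norm ((norm (\<Theta> (w x) *\<^sub>R e x))^2) \<le> norm ((norm (\<Theta> (w x)))^2 * C^2)"
        using power_mono[OF C(3) norm_ge_zero, where n=2]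
        by (intro always_eventually allI) (simp add: power_mult_distrib mult_left_mono)
    qed measurable
    then show ?thesis by (simp add: L2_def)
  qed
  have Lk: "L2 ?\<mu> (\<lambda>x. (\<eta> x * k (w x)) *\<^sub>R K x)" if w: "w \<in> borel_measurable ?\<mu>" and K: "L2 ?\<mu> K" for w and K :: "real^'n \<Rightarrow> real^'n"
  proof (rule L2_mult_bounded[OF K, of _ "C * B"])
    show "(\<lambda>x. \<eta> x * k (w x)) \<in> borel_measurable ?\<mu>" using w by measurable
    show "AE x in ?\<mu>. \<bar>\<eta> x * k (w x)\<bar> \<le> C * B"
      using C B by (intro always_eventually allI) (simp add: abs_mult mult_mono)
  qed
  have tT: "test_fun \<Omega> (\<lambda>x. \<eta> x * \<Theta> (\<phi> n x)) (\<lambda>x. (\<eta> x * k (\<phi> n x)) *\<^sub>R g n x + \<Theta> (\<phi> n x) *\<^sub>R e x)" for n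
  proof -
    have "((\<lambda>x. \<Theta> (\<phi> n x)) has_derivative (\<lambda>y. (k (\<phi> n x) *\<^sub>R g n x) \<bullet> y)) (at x)" for x
      using has_derivative_compose[OF test_fun_D(3)[OF t] d[unfolded has_field_derivative_def]] by simp
    moreover have "continuous_on UNIV (\<lambda>x. k (\<phi> n x) *\<^sub>R g n x)"
      by (intro continuous_intros continuous_on_compose2[OF k] test_fun_D[OF t]) auto
    ultimately show ?thesis using test_fun_mult_C1[OF \<eta>] by fastforce
  qed
  have lip2: "(\<Theta> a - \<Theta> b)^2 \<le> B^2 * (a - b)^2" for a b
    using lip[of a b] B0 unfolding power_mult_distrib[symmetric]
    by (simp add: abs_le_square_iff[symmetric] abs_mult)
  have conv1: "L2_tendsto ?\<mu> (\<lambda>n x. \<eta> x *\<^sub>R \<Theta> (\<phi> n x)) (\<lambda>x. \<eta> x *\<^sub>R \<Theta> (u x))"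
  proof (rule tendsto_L2_dominated[OF L\<eta>[OF Lt(1)] L\<eta>[OF L(1)] Lt(1) L(1) always_eventually l1, rule_format])
    fix n x
    have "(norm (\<eta> x *\<^sub>R \<Theta> (\<phi> n x) - \<eta> x *\<^sub>R \<Theta> (u x)))^2 = (\<eta> x)^2 * (\<Theta> (\<phi> n x) - \<Theta> (u x))^2"
      by (simp add: right_diff_distrib[symmetric] power_mult_distrib)
    also have "\<dots> \<le> C^2 * (B^2 * (\<phi> n x - u x)^2)"
      using power_mono[OF C(2) abs_ge_zero, of x 2] by (intro mult_mono lip2) auto
    finally show "(norm (\<eta> x *\<^sub>R \<Theta> (\<phi> n x) - \<eta> x *\<^sub>R \<Theta> (u x)))^2 \<le> C^2 * B^2 * (norm (\<phi> n x - u x))^2"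
      by (simp add: mult.assoc)
  qed
  have conv2: "L2_tendsto ?\<mu> (\<lambda>n x. \<Theta> (\<phi> n x) *\<^sub>R e x) (\<lambda>x. \<Theta> (u x) *\<^sub>R e x)"
  proof (rule tendsto_L2_dominated[OF Le'[OF Lt(1)] Le'[OF L(1)] Lt(1) L(1) always_eventually l1, rule_format])
    fix n x
    have "(norm (\<Theta> (\<phi> n x) *\<^sub>R e x - \<Theta> (u x) *\<^sub>R e x))^2 = (\<Theta> (\<phi> n x) - \<Theta> (u x))^2 * (norm (e x))^2"
      by (simp add: scaleR_left_diff_distrib[symmetric] power_mult_distrib)
    also have "\<dots> \<le> (B^2 * (\<phi> n x - u x)^2) * C^2"
      using power_mono[OF C(3) norm_ge_zero, of x 2] by (intro mult_mono lip2) auto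
    finally show "(norm (\<Theta> (\<phi> n x) *\<^sub>R e x - \<Theta> (u x) *\<^sub>R e x))^2 \<le> B^2 * C^2 * (norm (\<phi> n x - u x))^2"
      by (simp add: mult_ac)
  qed
  have kb: "(\<eta> x * k s)^2 \<le> C^2 * B^2" for x s
    unfolding power_mult_distrib[symmetric] using C(2)[of x] B[of s] C(1) B0
    by (simp add: abs_le_square_iff[symmetric] abs_mult mult_mono)
  have z: "L2 ?\<mu> (\<lambda>x. 0 :: real^'n)" by (simp add: L2_def)
  have a: "L2 ?\<mu> (\<lambda>x. (\<eta> x * k (\<phi> n x)) *\<^sub>R (g n x - G x))" "L2 ?\<mu> (\<lambda>x. (\<eta> x * k (\<phi> n x)) *\<^sub>R G x)" for n
    by (intro Lk L2_diff Lt L; simp)+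
  have b: "L2 ?\<mu> (\<lambda>x. (\<eta> x * k (u x)) *\<^sub>R G x)" by (intro Lk L) simp
  have conv3: "L2_tendsto ?\<mu> (\<lambda>n x. (\<eta> x * k (\<phi> n x)) *\<^sub>R (g n x - G x)) (\<lambda>x. 0)"
  proof (rule tendsto_L2_dominated[OF a(1) z Lt(2) L(2) always_eventually l2, rule_format])
    show "(norm ((\<eta> x * k (\<phi> n x)) *\<^sub>R (g n x - G x) - 0))^2 \<le> C^2 * B^2 * (norm (g n x - G x))^2" for n x
      using mult_right_mono[OF kb[of x "\<phi> n x"], of "(norm (g n x - G x))^2"]
      by (simp add: power_mult_distrib abs_mult)
  qed
  have conv4: "L2_tendsto ?\<mu> (\<lambda>n x. (\<eta> x * k (\<phi> n x)) *\<^sub>R G x) (\<lambda>x. (\<eta> x * k (u x)) *\<^sub>R G x)"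
  proof -
    have "(\<lambda>n. \<integral>x. (norm ((\<eta> x * k (\<phi> n x)) *\<^sub>R G x - (\<eta> x * k (u x)) *\<^sub>R G x))^2 \<partial>?\<mu>) \<longlonglongrightarrow> (\<integral>x. 0 \<partial>?\<mu>)"
    proof (rule integral_dominated_convergence[where w="\<lambda>x. 4 * (C^2 * B^2) * (norm (G x))^2"])
      show "AE x in ?\<mu>. (\<lambda>n. (norm ((\<eta> x * k (\<phi> n x)) *\<^sub>R G x - (\<eta> x * k (u x)) *\<^sub>R G x))^2) \<longlonglongrightarrow> 0"
        using ae
      proof eventually_elim
        case (elim x)
        have "(\<lambda>n. k (\<phi> n x)) \<longlonglongrightarrow> k (u x)"
          using elim k unfolding \<phi>_def by (intro isCont_tendsto_compose[of _ k]) (auto simp: continuous_on_eq_continuous_at)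
        then have "(\<lambda>n. (norm ((\<eta> x * k (\<phi> n x)) *\<^sub>R G x - (\<eta> x * k (u x)) *\<^sub>R G x))^2)
            \<longlonglongrightarrow> (norm ((\<eta> x * k (u x)) *\<^sub>R G x - (\<eta> x * k (u x)) *\<^sub>R G x))^2"
          by (intro tendsto_intros)
        then show ?case by simp
      qed
      show "AE x in ?\<mu>. norm ((norm ((\<eta> x * k (\<phi> n x)) *\<^sub>R G x - (\<eta> x * k (u x)) *\<^sub>R G x))^2) \<le> 4 * (C^2 * B^2) * (norm (G x))^2" for n
      proof (intro always_eventually allI)
        fix x
        have "(norm ((\<eta> x * k (\<phi> n x)) *\<^sub>R G x - (\<eta> x * k (u x)) *\<^sub>R G x))^2
            = (\<eta> x * k (\<phi> n x) - \<eta> x * k (u x))^2 * (norm (G x))^2"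
          by (simp add: scaleR_left_diff_distrib[symmetric] power_mult_distrib)
        also have "\<dots> \<le> (2 * (\<eta> x * k (\<phi> n x))^2 + 2 * (\<eta> x * k (u x))^2) * (norm (G x))^2"
          using norm_diff_square_le[of "\<eta> x * k (\<phi> n x)" "\<eta> x * k (u x)"] by (intro mult_right_mono) auto
        also have "\<dots> \<le> (4 * (C^2 * B^2)) * (norm (G x))^2"
          using kb[of x "\<phi> n x"] kb[of x "u x"] by (intro mult_right_mono) auto
        finally show "norm ((norm ((\<eta> x * k (\<phi> n x)) *\<^sub>R G x - (\<eta> x * k (u x)) *\<^sub>R G x))^2) \<le> 4 * (C^2 * B^2) * (norm (G x))^2"
          by simp
      qed
      show "integrable ?\<mu> (\<lambda>x. 4 * (C^2 * B^2) * (norm (G x))^2)" using L2_integrable_square[OF L(2)] by simp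
    qed measurable
    then show ?thesis by simp
  qed
  have conv5: "(\<lambda>n. \<integral>x. (norm (((\<eta> x * k (\<phi> n x)) *\<^sub>R (g n x - G x) + (\<eta> x * k (\<phi> n x)) *\<^sub>R G x + \<Theta> (\<phi> n x) *\<^sub>R e x)
      - (0 + (\<eta> x * k (u x)) *\<^sub>R G x + \<Theta> (u x) *\<^sub>R e x)))^2 \<partial>?\<mu>) \<longlonglongrightarrow> 0"
    by (rule tendsto_L2_add[OF L2_add[OF a] L2_add[OF z b] Le'[OF Lt(1)] Le'[OF L(1)]
          tendsto_L2_add[OF a(1) z a(2) b conv3 conv4] conv2])
  show ?thesis
  proof (rule H10I[OF \<Omega> _ _ tT])
    show "L2 ?\<mu> (\<lambda>x. \<eta> x * \<Theta> (u x))" using L\<eta>[OF L(1)] by simp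
    show "L2 ?\<mu> (\<lambda>x. (\<eta> x * k (u x)) *\<^sub>R G x + \<Theta> (u x) *\<^sub>R e x)" by (intro L2_add Lk Le' L) simp
    show "L2_tendsto ?\<mu> (\<lambda>n x. \<eta> x * \<Theta> (\<phi> n x)) (\<lambda>x. \<eta> x * \<Theta> (u x))" using conv1 by simp
    show "L2_tendsto ?\<mu> (\<lambda>n x. (\<eta> x * k (\<phi> n x)) *\<^sub>R g n x + \<Theta> (\<phi> n x) *\<^sub>R e x) (\<lambda>x. (\<eta> x * k (u x)) *\<^sub>R G x + \<Theta> (u x) *\<^sub>R e x)"
      using conv5 by (simp add: scaleR_diff_right)
  qed
qed

section \<open>Nonexistence\<close>

locale elliptic_absorption = elliptic_problem \<Omega> f p M \<alpha> \<beta> + absorption h \<sigma> \<alpha>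
  for \<Omega> :: "(real^'n) set" and f p M \<alpha> \<beta> h \<sigma>
begin

text \<open>To be read with a = grad u, b = grad v, y = v, \<theta> = \<Theta>(u) and q the
  truncated absorption. The right side exceeds the left by the form of A at b - y \<theta> a plus q
  \<theta> y^2 times ((A a) . a / \<alpha> - |a|^2), and ellipticity makes both nonnegative.\<close>

lemma Picone_pointwise:
  fixes A :: "real^'n^'n"
  assumes sym: "\<And>\<xi> \<eta>. (A *v \<xi>) \<bullet> \<eta> = (A *v \<eta>) \<bullet> \<xi>"
    and ell: "\<And>\<xi>. \<alpha> * (norm \<xi>)^2 \<le> (A *v \<xi>) \<bullet> \<xi>" and q: "0 \<le> q" and \<theta>: "0 \<le> \<theta>"
  shows "(A *v a) \<bullet> ((y^2 * (- (q / \<alpha>) * \<theta> - \<theta>^2)) *\<^sub>R a + \<theta> *\<^sub>R ((2 * y) *\<^sub>R b)) + q * (norm a)^2 * (y^2 * \<theta>)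
    \<le> (A *v b) \<bullet> b"
proof -
  define w where "w = (y * \<theta>) *\<^sub>R a"
  have "0 \<le> (A *v (b - w)) \<bullet> (b - w)"
    using order_trans[OF _ ell[of "b - w"]] \<alpha> by simp
  also have "\<dots> = (A *v b) \<bullet> b - 2 * ((A *v w) \<bullet> b) + (A *v w) \<bullet> w"
    using sym[of b w] by (simp add: matrix_vector_mult_diff_distrib inner_simps)
  also have "\<dots> = (A *v b) \<bullet> b - 2 * y * \<theta> * ((A *v a) \<bullet> b) + y^2 * \<theta>^2 * ((A *v a) \<bullet> a)"
    by (simp add: w_def matrix_vector_mult_scaleR power2_eq_square)
  finally have 1: "0 \<le> (A *v b) \<bullet> b - 2 * y * \<theta> * ((A *v a) \<bullet> b) + y^2 * \<theta>^2 * ((A *v a) \<bullet> a)" .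
  have "(q * \<theta> * y^2 / \<alpha>) * (\<alpha> * (norm a)^2) \<le> (q * \<theta> * y^2 / \<alpha>) * ((A *v a) \<bullet> a)"
    using q \<theta> \<alpha> by (intro mult_left_mono ell) auto
  then have 2: "q * \<theta> * y^2 * (norm a)^2 \<le> (q * \<theta> * y^2 / \<alpha>) * ((A *v a) \<bullet> a)"
    using \<alpha> by simp
  have 3: "(A *v a) \<bullet> ((y^2 * (- (q / \<alpha>) * \<theta> - \<theta>^2)) *\<^sub>R a + \<theta> *\<^sub>R ((2 * y) *\<^sub>R b))
      = 2 * y * \<theta> * ((A *v a) \<bullet> b) - y^2 * \<theta>^2 * ((A *v a) \<bullet> a) - (q * \<theta> * y^2 / \<alpha>) * ((A *v a) \<bullet> a)"
    by (simp add: inner_add_right algebra_simps)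
  have 4: "q * (norm a)^2 * (y^2 * \<theta>) = q * \<theta> * y^2 * (norm a)^2" by simp
  show ?thesis unfolding 3 4 using 1 2 by linarith
qed

text \<open>With the test function v^2 \<Theta>(u), the lower bound for \<Theta> bounds the source
  term from below, where the sign of \<open>lam\<close> enters. \<open>Picone_pointwise\<close>
  bounds the other side by the energy of v, up to the defect caused by the truncation.\<close>

lemma Picone_inequality:
  assumes sol: "weak_solution \<Omega> M h \<sigma> f lam u" and lam: "0 \<le> lam" and t: "test_fun \<Omega> v g"
  shows "lam * exp (- Hfun \<alpha> h \<sigma>) / psifun \<alpha> h \<sigma> * mass v v \<le> energy g g"
proof -
  obtain G where u: "H10 \<Omega> u G" and range: "AE x in lebesgue. x \<in> \<Omega> \<longrightarrow> 0 \<le> u x \<and> u x < \<sigma>"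
    and int: "set_integrable lebesgue \<Omega> (\<lambda>x. h (u x) * (norm (G x))^2)"
    and weak: "\<And>\<phi> \<Phi>. H10 \<Omega> \<phi> \<Phi> \<Longrightarrow> Linfty_on \<Omega> \<phi> \<Longrightarrow>
       (LINT x:\<Omega>|lebesgue. (M x *v G x) \<bullet> \<Phi> x) + (LINT x:\<Omega>|lebesgue. h (u x) * (norm (G x))^2 * \<phi> x)
         = lam * (LINT x:\<Omega>|lebesgue. f x * \<phi> x)"
    using sol unfolding weak_solution_def by blast
  have rangeAE: "AE x in \<mu>. 0 \<le> u x \<and> u x < \<sigma>"
    unfolding AE_lebesgue_on_iff[OF open_domain] by (rule range)
  have hint: "integrable \<mu> (\<lambda>x. h (u x) * (norm (G x))^2)"
    using int by (simp add: set_integrable_lebesgue_on_iff[OF open_domain])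
  note L = H10_L2[OF domain u] and Lt = test_fun_L2[OF domain t]
  have [measurable]: "u \<in> borel_measurable \<mu>" "G \<in> borel_measurable \<mu>" "v \<in> borel_measurable \<mu>" "g \<in> borel_measurable \<mu>"
    using L Lt by (auto dest: L2_measurable)
  obtain C where C: "C \<ge> 0" "\<And>x. \<bar>v x\<bar> \<le> C" "\<And>x. norm (g x) \<le> C"
    by (rule test_fun_bounded[OF t]) blast
  have v2C: "(v x)^2 \<le> C^2" for x using power_mono[OF C(2) abs_ge_zero, of x 2] by simp
  have tr_meas [measurable]: "(\<lambda>x. trunc (cut n) (u x)) \<in> borel_measurable \<mu>" for n
    using borel_measurable_continuous_onI[OF trunc_cont[OF cut_bounds]] by measurable
  \<comment> \<open>The amount of absorption that the n-th truncation discards; it tends to 0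
    because the full absorption is integrable.\<close>
  define \<delta> where "\<delta> = (\<lambda>n. \<integral>x. (h (u x) * (norm (G x))^2 - trunc (cut n) (u x) * (norm (G x))^2) \<partial>\<mu>)"
  have tint: "integrable \<mu> (\<lambda>x. trunc (cut n) (u x) * (norm (G x))^2)" for n
  proof (rule Bochner_Integration.integrable_bound[OF hint])
    show "AE x in \<mu>. norm (trunc (cut n) (u x) * (norm (G x))^2) \<le> norm (h (u x) * (norm (G x))^2)"
      using rangeAE
    proof eventually_elim
      case (elim x)
      have "0 \<le> trunc (cut n) (u x)" "trunc (cut n) (u x) \<le> h (u x)"
        using elim trunc_nonneg[OF cut_bounds] trunc_le[OF cut_bounds(1)] by auto
      then show ?case by (simp add: abs_mult mult_right_mono)
    qed
  qed measurable
  have \<delta>: "\<delta> \<longlonglongrightarrow> 0"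
  proof -
    have "\<delta> \<longlonglongrightarrow> (\<integral>x. 0 \<partial>\<mu>)"
      unfolding \<delta>_def
    proof (rule integral_dominated_convergence[where w="\<lambda>x. h (u x) * (norm (G x))^2"])
      show "AE x in \<mu>. (\<lambda>n. h (u x) * (norm (G x))^2 - trunc (cut n) (u x) * (norm (G x))^2) \<longlonglongrightarrow> 0"
        using rangeAE
      proof eventually_elim
        case (elim x)
        show ?case
        proof (rule tendsto_eventually)
          show "\<forall>\<^sub>F n in sequentially. h (u x) * (norm (G x))^2 - trunc (cut n) (u x) * (norm (G x))^2 = 0"
            using eventually_cut_ge[OF conjunct2[OF elim]]
            by (rule eventually_mono) (use elim in \<open>simp add: trunc_eq\<close>)
        qed
      qed
      show "AE x in \<mu>. norm (h (u x) * (norm (G x))^2 - trunc (cut n) (u x) * (norm (G x))^2) \<le> h (u x) * (norm (G x))^2" for n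
        using rangeAE
      proof eventually_elim
        case (elim x)
        have "0 \<le> trunc (cut n) (u x) * (norm (G x))^2" "trunc (cut n) (u x) * (norm (G x))^2 \<le> h (u x) * (norm (G x))^2"
          using elim trunc_nonneg[OF cut_bounds] trunc_le[OF cut_bounds(1)] by (auto intro!: mult_right_mono)
        then show ?case by simp
      qed
      show "(\<lambda>x. h (u x) * (norm (G x))^2 - trunc (cut n) (u x) * (norm (G x))^2) \<in> borel_measurable \<mu>" for n
        using borel_measurable_integrable[OF hint] borel_measurable_integrable[OF tint] by (rule borel_measurable_diff)
    qed (use hint in auto)
    then show ?thesis by simp
  qed
  \<comment> \<open>The error C^2 / \<epsilon> * \<delta> n forces the order of the limits: n tends
    to infinity with \<epsilon> fixed.\<close>
  have key: "lam * (exp (- Hfun \<alpha> h \<sigma>) / (psifun \<alpha> (trunc (cut n)) \<sigma> + \<epsilon>)) * mass v v \<le> energy g g + C^2 / \<epsilon> * \<delta> n"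
    if \<epsilon>: "\<epsilon> > 0" for n \<epsilon>
  proof -
    define c where "c = cut n"
    have c: "0 \<le> c" "c < \<sigma>" unfolding c_def by (rule cut_bounds)+
    define b where "b = exp (- Hfun \<alpha> h \<sigma>) / (psifun \<alpha> (trunc c) \<sigma> + \<epsilon>)"
    have b0: "0 \<le> b" unfolding b_def using psifun_trunc_nonneg[OF c, of \<sigma>] \<sigma> \<epsilon> by simp
    obtain \<Theta> k B where \<Theta>: "\<And>s. (\<Theta> has_real_derivative k s) (at s)" "continuous_on UNIV k" "\<And>s. \<bar>k s\<bar> \<le> B"
      "\<And>s. s \<in> {0..\<sigma>} \<Longrightarrow> \<Theta> s \<le> 1 / \<epsilon>" "\<And>s. s \<in> {0..\<sigma>} \<Longrightarrow> b \<le> \<Theta> s"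
      "\<And>s. s \<in> {0..\<sigma>} \<Longrightarrow> k s = - (trunc c s / \<alpha>) * \<Theta> s - (\<Theta> s)^2"
      unfolding b_def by (rule Picone_function[OF c \<epsilon>]) blast
    have tv: "test_fun \<Omega> (\<lambda>x. (v x)^2) (\<lambda>x. (2 * v x) *\<^sub>R g x)"
      using test_fun_mult_C1[OF t test_fun_D(3,2)[OF t]]
      by (simp add: power2_eq_square scaleR_add_left[symmetric])
    define \<phi> where "\<phi> = (\<lambda>x. (v x)^2 * \<Theta> (u x))"
    define \<Phi> where "\<Phi> = (\<lambda>x. ((v x)^2 * k (u x)) *\<^sub>R G x + \<Theta> (u x) *\<^sub>R ((2 * v x) *\<^sub>R g x))"
    have H: "H10 \<Omega> \<phi> \<Phi>"
      unfolding \<phi>_def \<Phi>_def by (rule H10_mult_compose[OF domain tv u \<Theta>(1-3)])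
    have bnd: "AE x in \<mu>. b * (v x)^2 \<le> \<phi> x \<and> 0 \<le> \<phi> x \<and> \<phi> x \<le> C^2 / \<epsilon>"
      using rangeAE
    proof eventually_elim
      case (elim x)
      then have s: "u x \<in> {0..\<sigma>}" by simp
      have 1: "b * (v x)^2 \<le> \<phi> x" unfolding \<phi>_def using \<Theta>(5)[OF s] by (simp add: mult.commute mult_right_mono)
      have "\<phi> x \<le> C^2 * (1 / \<epsilon>)" unfolding \<phi>_def
        using v2C[of x] \<Theta>(4,5)[OF s] b0 by (intro mult_mono) auto
      then show ?case using 1 mult_nonneg_nonneg[OF b0, of "(v x)^2"] by simp
    qed
    have "Linfty_on \<Omega> \<phi>"
      unfolding Linfty_on_def
    proof
      have "AE x in \<mu>. \<bar>\<phi> x\<bar> \<le> C^2 / \<epsilon>" using bnd by eventually_elim simp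
      then show "AE x in lebesgue. x \<in> \<Omega> \<longrightarrow> \<bar>\<phi> x\<bar> \<le> C^2 / \<epsilon>" by (simp add: AE_lebesgue_on_iff[OF open_domain])
    qed
    from weak[OF H this]
    have eq: "energy G \<Phi> + (\<integral>x. h (u x) * (norm (G x))^2 * \<phi> x \<partial>\<mu>) = lam * (\<integral>x. f x * \<phi> x \<partial>\<mu>)"
      unfolding set_integral_lebesgue_on[OF open_domain] energy_def .
    note L\<phi> = H10_L2[OF domain H]
    have [measurable]: "\<phi> \<in> borel_measurable \<mu>" "\<Phi> \<in> borel_measurable \<mu>" using L\<phi> by (auto dest: L2_measurable)
    have bounded_mult: "integrable \<mu> (\<lambda>x. w x * \<phi> x)" if w: "integrable \<mu> w" for w
    proof (rule Bochner_Integration.integrable_bound)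
      show "integrable \<mu> (\<lambda>x. w x * (C^2 / \<epsilon>))" using w by simp
      show "AE x in \<mu>. norm (w x * \<phi> x) \<le> norm (w x * (C^2 / \<epsilon>))"
        using bnd
      proof eventually_elim
        case (elim x)
        then have "\<bar>\<phi> x\<bar> \<le> \<bar>C^2 / \<epsilon>\<bar>" by linarith
        then show ?case unfolding real_norm_def abs_mult[of "w x"] by (rule mult_left_mono) simp
      qed
    qed (use w in measurable)
    have "lam * b * mass v v \<le> lam * (\<integral>x. f x * \<phi> x \<partial>\<mu>)"
    proof -
      have "(\<integral>x. b * (f x * (v x)^2) \<partial>\<mu>) \<le> (\<integral>x. f x * \<phi> x \<partial>\<mu>)"
      proof (intro integral_mono_AE integrable_mult_right test_fun_weight_integrable[OF t] bounded_mult f_integrable)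
        show "AE x in \<mu>. b * (f x * (v x)^2) \<le> f x * \<phi> x"
          using bnd f_nonneg_AE
        proof eventually_elim
          case (elim x)
          then show ?case using mult_left_mono[of "b * (v x)^2" "\<phi> x" "f x"] by (simp add: mult_ac)
        qed
      qed
      then have "b * mass v v \<le> (\<integral>x. f x * \<phi> x \<partial>\<mu>)" by (simp add: mass_def power2_eq_square mult.assoc)
      then show ?thesis using lam by (simp add: mult.assoc mult_left_mono)
    qed
    also have "\<dots> = (\<integral>x. (M x *v G x) \<bullet> \<Phi> x + h (u x) * (norm (G x))^2 * \<phi> x \<partial>\<mu>)"
      unfolding eq[symmetric] energy_def
      by (rule Bochner_Integration.integral_add[symmetric, OF energy_integrable[OF L(2) L\<phi>(2)] bounded_mult[OF hint]])
    also have "\<dots> \<le> (\<integral>x. (M x *v g x) \<bullet> g x + C^2 / \<epsilon> * (h (u x) * (norm (G x))^2 - trunc c (u x) * (norm (G x))^2) \<partial>\<mu>)"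
    proof (intro integral_mono_AE Bochner_Integration.integrable_add integrable_mult_right Bochner_Integration.integrable_diff
        energy_integrable L L\<phi> bounded_mult hint Lt)
      show "integrable \<mu> (\<lambda>x. trunc c (u x) * (norm (G x))^2)" unfolding c_def by (rule tint)
      show "AE x in \<mu>. (M x *v G x) \<bullet> \<Phi> x + h (u x) * (norm (G x))^2 * \<phi> x
          \<le> (M x *v g x) \<bullet> g x + C^2 / \<epsilon> * (h (u x) * (norm (G x))^2 - trunc c (u x) * (norm (G x))^2)"
        using rangeAE bnd M_symmetric_AE M_elliptic_AE
      proof eventually_elim
        case (elim x)
        then have s: "u x \<in> {0..\<sigma>}" by simp
        have "(M x *v G x) \<bullet> \<Phi> x + trunc c (u x) * (norm (G x))^2 * \<phi> x \<le> (M x *v g x) \<bullet> g x"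
          unfolding \<Phi>_def \<phi>_def \<Theta>(6)[OF s]
          by (rule Picone_pointwise) (use elim trunc_nonneg[OF c] order_trans[OF b0 \<Theta>(5)[OF s]] in auto)
        \<comment> \<open>The uncancelled part is nonnegative on the range of u, so the upper bound
          for \<phi> may be inserted.\<close>
        moreover have "(h (u x) * (norm (G x))^2 - trunc c (u x) * (norm (G x))^2) * \<phi> x
            \<le> (h (u x) * (norm (G x))^2 - trunc c (u x) * (norm (G x))^2) * (C^2 / \<epsilon>)"
          using elim trunc_le[OF c(1), of "u x"]
          by (intro mult_left_mono) (auto intro!: mult_right_mono)
        ultimately show ?case by (simp add: algebra_simps)
      qed
    qed
    also have "\<dots> = energy g g + C^2 / \<epsilon> * \<delta> n"
      unfolding energy_def \<delta>_def c_def
      using energy_integrable[OF Lt(2) Lt(2)] hint tint[of n]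
      by (subst Bochner_Integration.integral_add) auto
    finally show ?thesis unfolding b_def c_def .
  qed
  have fix_eps: "lam * (exp (- Hfun \<alpha> h \<sigma>) / (psifun \<alpha> h \<sigma> + \<epsilon>)) * mass v v \<le> energy g g" if \<epsilon>: "\<epsilon> > 0" for \<epsilon>
  proof (rule LIMSEQ_le)
    show "(\<lambda>n. lam * (exp (- Hfun \<alpha> h \<sigma>) / (psifun \<alpha> (trunc (cut n)) \<sigma> + \<epsilon>)) * mass v v)
        \<longlonglongrightarrow> lam * (exp (- Hfun \<alpha> h \<sigma>) / (psifun \<alpha> h \<sigma> + \<epsilon>)) * mass v v"
      using psifun_pos \<epsilon> by (intro tendsto_intros psifun_trunc_tendsto) auto
    have "(\<lambda>n. energy g g + C^2 / \<epsilon> * \<delta> n) \<longlonglongrightarrow> energy g g + C^2 / \<epsilon> * 0"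
      by (intro tendsto_intros \<delta>)
    then show "(\<lambda>n. energy g g + C^2 / \<epsilon> * \<delta> n) \<longlonglongrightarrow> energy g g" by simp
    show "\<exists>N. \<forall>n\<ge>N. lam * (exp (- Hfun \<alpha> h \<sigma>) / (psifun \<alpha> (trunc (cut n)) \<sigma> + \<epsilon>)) * mass v v \<le> energy g g + C^2 / \<epsilon> * \<delta> n"
      using key[OF \<epsilon>] by blast
  qed
  have "lam * (exp (- Hfun \<alpha> h \<sigma>) / (psifun \<alpha> h \<sigma> + 0)) * mass v v \<le> energy g g"
  proof (rule LIMSEQ_le_const2)
    show "(\<lambda>n. lam * (exp (- Hfun \<alpha> h \<sigma>) / (psifun \<alpha> h \<sigma> + inverse (real (Suc n)))) * mass v v)
        \<longlonglongrightarrow> lam * (exp (- Hfun \<alpha> h \<sigma>) / (psifun \<alpha> h \<sigma> + 0)) * mass v v"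
      using psifun_pos by (intro tendsto_intros LIMSEQ_inverse_real_of_nat) auto
    show "\<exists>N. \<forall>n\<ge>N. lam * (exp (- Hfun \<alpha> h \<sigma>) / (psifun \<alpha> h \<sigma> + inverse (real (Suc n)))) * mass v v \<le> energy g g"
      using fix_eps by (intro exI allI impI) simp
  qed
  then show ?thesis by simp
qed

section \<open>Consequences for the parameter\<close>

text \<open>\<open>Picone_inequality\<close> bounds every eigenvalue from below by the same number.
  It passes to the infimum because the set of eigenvalues is nonempty.\<close>

lemma solution_parameter_le:
  assumes sol: "weak_solution \<Omega> M h \<sigma> f lam u"
  shows "lam \<le> lambda1 \<Omega> M f * exp (Hfun \<alpha> h \<sigma>) * psifun \<alpha> h \<sigma>"
proof -
  have ne: "{m. is_eigenvalue \<Omega> M f m} \<noteq> {}" using eigenvalue_exists by blast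
  note \<psi> = psifun_pos
  show ?thesis
  proof (cases "lam \<le> 0")
    \<comment> \<open>For \<open>lam\<close> at most 0 the positivity of the eigenvalues is enough;
      the comparison through \<open>eigenvalue_ge\<close> works with a positive constant.\<close>
    case True
    have "0 \<le> lambda1 \<Omega> M f"
      unfolding lambda1_def by (rule cInf_greatest[OF ne]) (use eigenvalue_pos in force)
    then have "0 \<le> lambda1 \<Omega> M f * exp (Hfun \<alpha> h \<sigma>) * psifun \<alpha> h \<sigma>" using \<psi> by simp
    then show ?thesis using True by simp
  next
    case False
    define c where "c = lam * exp (- Hfun \<alpha> h \<sigma>) / psifun \<alpha> h \<sigma>"
    have c: "c > 0" using False \<psi> by (simp add: c_def)
    have "c \<le> lambda1 \<Omega> M f"
      unfolding lambda1_def
    proof (rule cInf_greatest[OF ne])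
      fix m assume "m \<in> {m. is_eigenvalue \<Omega> M f m}"
      then show "c \<le> m"
        using eigenvalue_ge[OF _ c] Picone_inequality[OF sol] False unfolding c_def by simp
    qed
    then have "c * (exp (Hfun \<alpha> h \<sigma>) * psifun \<alpha> h \<sigma>) \<le> lambda1 \<Omega> M f * (exp (Hfun \<alpha> h \<sigma>) * psifun \<alpha> h \<sigma>)"
      using \<psi> by (intro mult_right_mono) auto
    moreover have "c * (exp (Hfun \<alpha> h \<sigma>) * psifun \<alpha> h \<sigma>) = lam"
      using \<psi> by (simp add: c_def exp_minus field_simps)
    ultimately show ?thesis by (simp add: mult.assoc)
  qed
qed

text \<open>The bound on the parameter is one real number for all solutions, in particular for those
  bounded away from \<sigma>.\<close>

lemma Lambda_f_finite: "Lambda_f \<Omega> M h \<sigma> f < \<infinity>"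
proof -
  define S where "S = {lam. lam > 0 \<and> (\<exists>u \<epsilon>. \<epsilon> > 0 \<and> weak_solution \<Omega> M h \<sigma> f lam u \<and>
                   (AE x in lebesgue. x \<in> \<Omega> \<longrightarrow> u x \<le> \<sigma> - \<epsilon>))}"
  have "Sup (ereal ` S) \<le> ereal (lambda1 \<Omega> M f * exp (Hfun \<alpha> h \<sigma>) * psifun \<alpha> h \<sigma>)"
    by (rule Sup_least) (auto simp: S_def dest: solution_parameter_le)
  also have "\<dots> < \<infinity>" by simp
  finally show ?thesis unfolding Lambda_f_def Let_def S_def[symmetric] by simp
qed

end

theorem theorem1p9:
  fixes \<Omega> :: "(real^'n) set" and M :: "real^'n \<Rightarrow> real^'n^'n"
    and \<alpha> \<beta> \<sigma> p lam :: real and h :: "real \<Rightarrow> real" and f :: "real^'n \<Rightarrow> real"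
  assumes "open \<Omega>" and "bounded \<Omega>"
    and "0 < \<alpha>" and "\<alpha> \<le> \<beta>"
    and "\<And>i j. (\<lambda>x. M x $ i $ j) \<in> borel_measurable lebesgue"
    and "AE x in lebesgue. x \<in> \<Omega> \<longrightarrow> transpose (M x) = M x"
    and "AE x in lebesgue. x \<in> \<Omega> \<longrightarrow>
           (\<forall>\<xi>. \<alpha> * (norm \<xi>)^2 \<le> (M x *v \<xi>) \<bullet> \<xi> \<and> norm (M x *v \<xi>) \<le> \<beta> * norm \<xi>)"
    and "0 < \<sigma>"
    and "continuous_on {0..<\<sigma>} h" and "\<forall>s\<in>{0..<\<sigma>}. 0 \<le> h s"
    and "strict_mono_on {0..<\<sigma>} h"
    and "filterlim h at_top (at_left \<sigma>)"
    and "set_integrable lborel {0<..<\<sigma>} h"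
    and "1 \<le> p" and "real CARD('n) / 2 < p"
    and "f \<in> borel_measurable lebesgue"
    and "set_integrable lebesgue \<Omega> (\<lambda>x. \<bar>f x\<bar> powr p)"
    and "AE x in lebesgue. x \<in> \<Omega> \<longrightarrow> 0 \<le> f x"
    and "\<not> (AE x in lebesgue. x \<in> \<Omega> \<longrightarrow> f x = 0)"
    and "lam > lambda1 \<Omega> M f * exp (Hfun \<alpha> h \<sigma>) * psifun \<alpha> h \<sigma>"
  shows "(\<nexists>u. weak_solution \<Omega> M h \<sigma> f lam u) \<and> Lambda_f \<Omega> M h \<sigma> f < \<infinity>"
proof -
  interpret elliptic_absorption \<Omega> f p M \<alpha> \<beta> h \<sigma>
    by unfold_locales (fact assms)+
  show ?thesis
    using solution_parameter_le[of lam] Lambda_f_finite assms(20) by (meson not_le)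
qed

end
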